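(* Let $0\le\omega\le\pi/2$ and let $A:\mathcal{D}(A)\subset\mathcal{H}\to\mathcal{H}$ be an m-$\omega$-accretive operator in a separable Hilbert space $\mathcal{H}$ with $0\in\rho(A)$. Let $0<\alpha<\alpha^*:=\dfrac{3\pi}{4\pi+2\omega}$ and $\Upsilon_0^\alpha=2\cos\dfrac{2\pi\alpha}{3}+1$. Then for every $\varphi\in\mathcal{H}^{\frac23}$, $\psi\in\mathcal{H}^{\frac{2-\alpha}{3}}$ and $\xi\in\mathcal{H}^{\frac{2-2\alpha}{3}}$ the Cauchy problem $$u'''(t)+\Upsilon_0^\alpha A^{\frac{\alpha}{3}}u''(t)+\Upsilon_0^\alpha A^{\frac{2\alpha}{3}}u'(t)+A^\alpha u(t)=0,\quad t>0,$$ $$u(0)=\varphi,\quad u'(0)=\psi,\quad u''(0)=\xi,$$ has a unique solution $$u\in C^3((0,+\infty);\mathcal{H})\cap C^2((0,+\infty);\mathcal{H}^{\frac{\alpha}{3}})\cap C^1((0,+\infty);\mathcal{H}^{\frac{2\alpha}{3}})\cap C((0,+\infty);\mathcal{H}^{\alpha}),$$ and it is given by $$\begin{aligned} u(t)={}&e^{taA^{\frac{\alpha}{3}}}\varphi-\frac{a}{b-a}\Big[e^{tbA^{\frac{\alpha}{3}}}-e^{taA^{\frac{\alpha}{3}}}\Big]\varphi\\ &+\frac{ab}{1+b}\Big[\frac{1}{b-a}e^{tbA^{\frac{\alpha}{3}}}-\frac{1+b}{(1+a)(b-a)}e^{taA^{\frac{\alpha}{3}}}+\frac{1}{1+a}e^{-tA^{\frac{\alpha}{3}}}\Big]\varphi\\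 &+\frac{1}{b-a}A^{-\frac{\alpha}{3}}\Big[e^{tbA^{\frac{\alpha}{3}}}-e^{taA^{\frac{\alpha}{3}}}\Big]\psi\\ &-\frac{a+b}{1+b}A^{-\frac{\alpha}{3}}\Big[\frac{1}{b-a}e^{tbA^{\frac{\alpha}{3}}}-\frac{1+b}{(1+a)(b-a)}e^{taA^{\frac{\alpha}{3}}}+\frac{1}{1+a}e^{-tA^{\frac{\alpha}{3}}}\Big]\psi\\ &+\frac{1}{1+b}A^{-\frac{2\alpha}{3}}\Big[\frac{1}{b-a}e^{tbA^{\frac{\alpha}{3}}}-\frac{1+b}{(1+a)(b-a)}e^{taA^{\frac{\alpha}{3}}}+\frac{1}{1+a}e^{-tA^{\frac{\alpha}{3}}}\Big]\xi, \end{aligned}$$ with $a=e^{i\pi\frac{3-2\alpha}{3}}$ and $b=e^{i\pi\frac{3+2\alpha}{3}}$.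
   Context: $\mathcal{H}$ is a complex separable Hilbert space. An operator $A$ in $\mathcal{H}$ is accretive if $\mathrm{Re}\langle Au,u\rangle\ge 0$ for all $u\in\mathcal{D}(A)$; it is m-accretive if it is closed, accretive and has no proper accretive extension in $\mathcal{H}$ (equivalently, $-A$ generates a $C_0$-semigroup of contractions). For $0\le\omega\le\pi/2$, $A$ is $\omega$-accretive if its numerical range $W(A)=\{\langle Au,u\rangle: u\in\mathcal{D}(A),\|u\|=1\}$ is contained in $\{0\}\cup\{z\neq0:|\arg z|\le\omega\}$; it is m-$\omega$-accretive if it is $\omega$-accretive and m-accretive. For $0<\beta<1$, $A^\beta$ is the closure of the operator defined on $\mathcal{D}(A)$ by $A^\beta x=\frac{\sin(\pi\beta)}{\pi}\int_0^\infty\lambda^{\beta-1}A(\lambda I+A)^{-1}x\,d\lambda$; also $A^0=I$, $A^1=A$, and $A^{-\beta}=(A^\beta)^{-1}$, a bounded operator since $0\in\rho(A)$. For $0\le\beta\le1$, $\mathcal{H}^\beta=\mathcal{D}(A^\beta)$ (with $\mathcal{H}^0=\mathcal{H}$), a Banach space with norm $\|x\|_{\mathcal{H}^\beta}=\|A^\beta x\|_{\mathcal{H}}$. $e^{tcA^{\alpha/3}}$, $t\ge0$, denotes the strongly continuous (analytic) semigroup on $\mathcal{H}$ generated by $cA^{\alpha/3}$, for $c\in\{a,b,-1\}$; for these $c$ the operator $cA^{\alpha/3}$ is such a generator when $0<\alpha<\alpha^*$. Since the solution class is on the open half-line, the initial conditions mean that $u(t)\to\varphi$, $u'(t)\to\psi$,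 $u''(t)\to\xi$ in $\mathcal{H}$ as $t\to0^+$. *)

theory Defs
  imports "HOL-Analysis.Analysis"
begin

text \<open>
  The underlying real inner product space is the library's class; it is tied to the complex
  structure by \<open>inner x y = Re (cinner x y)\<close>. The form is linear in its first argument.
  Separability is expressed by additionally requiring the class
  \<open>second_countable_topology\<close>, which for metric spaces is the same thing.
\<close>

class complex_hilbert_space = real_inner + banach +
  fixes scaleC :: "complex \<Rightarrow> 'a \<Rightarrow> 'a" (infixr "*\<^sub>C" 75)
    and cinner :: "'a \<Rightarrow> 'a \<Rightarrow> complex"
  assumes scaleC_add_right: "c *\<^sub>C (x + y) = c *\<^sub>C x + c *\<^sub>C y"
    and scaleC_add_left: "(c + d) *\<^sub>C x = c *\<^sub>C x + d *\<^sub>C x"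
    and scaleC_scaleC: "c *\<^sub>C (d *\<^sub>C x) = (c * d) *\<^sub>C x"
    and scaleR_scaleC: "r *\<^sub>R x = complex_of_real r *\<^sub>C x"
    and cinner_commute: "cinner x y = cnj (cinner y x)"
    and cinner_add_left: "cinner (x + y) z = cinner x z + cinner y z"
    and cinner_scaleC_left: "cinner (c *\<^sub>C x) y = c * cinner x y"
    and inner_eq_Re_cinner: "inner x y = Re (cinner x y)"

instantiation complex :: complex_hilbert_space
begin

definition scaleC_complex :: "complex \<Rightarrow> complex \<Rightarrow> complex"
  where "scaleC_complex c x = c * x"

definition cinner_complex :: "complex \<Rightarrow> complex \<Rightarrow> complex"
  where "cinner_complex x y = x * cnj y"

instance
  by standard
    (auto simp: scaleC_complex_def cinner_complex_def algebra_simps scaleR_conv_of_real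
      inner_complex_def)

end

text \<open>
  An operator is identified with its graph. Thus \<open>Domain A\<close> is its domain, \<open>A \<subseteq> B\<close> says that \<open>B\<close>
  extends \<open>A\<close>, \<open>closed A\<close> that \<open>A\<close> is a closed operator, \<open>closure A\<close> is the closure of \<open>A\<close>,
  \<open>A\<inverse>\<close> (the converse relation) its inverse, and \<open>Id\<close> the identity operator.
\<close>

type_synonym 'h op = "('h \<times> 'h) set"

definition linear_op :: "'h::complex_hilbert_space op \<Rightarrow> bool" where
  "linear_op A \<longleftrightarrow> single_valued A \<and> (0, 0) \<in> A \<and>
     (\<forall>x y x' y'. (x, y) \<in> A \<longrightarrow> (x', y') \<in> A \<longrightarrow> (x + x', y + y') \<in> A) \<and>
     (\<forall>c x y. (x, y) \<in> A \<longrightarrow> (c *\<^sub>C x, c *\<^sub>C y) \<in> A)"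

text \<open>Unspecified for \<open>x \<notin> Domain A\<close>.\<close>

definition app :: "'h op \<Rightarrow> 'h \<Rightarrow> 'h" where
  "app A x = (THE y. (x, y) \<in> A)"

definition scale_op :: "complex \<Rightarrow> 'h::complex_hilbert_space op \<Rightarrow> 'h op" where
  "scale_op c A = {(x, c *\<^sub>C y) |x y. (x, y) \<in> A}"

definition shift_op :: "complex \<Rightarrow> 'h::complex_hilbert_space op \<Rightarrow> 'h op" where
  "shift_op z A = {(x, z *\<^sub>C x + y) |x y. (x, y) \<in> A}"

definition everywhere_bounded_op :: "'h::complex_hilbert_space op \<Rightarrow> bool" where
  "everywhere_bounded_op B \<longleftrightarrow>
     linear_op B \<and> Domain B = UNIV \<and> (\<exists>K. \<forall>x y. (x, y) \<in> B \<longrightarrow> norm y \<le> K * norm x)"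

definition resolvent_set :: "'h::complex_hilbert_space op \<Rightarrow> complex set" where
  "resolvent_set A = {z. everywhere_bounded_op ((shift_op z (scale_op (-1) A))\<inverse>)}"

definition accretive :: "'h::complex_hilbert_space op \<Rightarrow> bool" where
  "accretive A \<longleftrightarrow> linear_op A \<and> (\<forall>u v. (u, v) \<in> A \<longrightarrow> Re (cinner v u) \<ge> 0)"

definition m_accretive :: "'h::complex_hilbert_space op \<Rightarrow> bool" where
  "m_accretive A \<longleftrightarrow> closed A \<and> accretive A \<and> (\<forall>B. accretive B \<and> A \<subseteq> B \<longrightarrow> B = A)"

definition numerical_range :: "'h::complex_hilbert_space op \<Rightarrow> complex set" where
  "numerical_range A = {cinner v u |u v. (u, v) \<in> A \<and> norm u = 1}"

definition angle_accretive :: "real \<Rightarrow> 'h::complex_hilbert_space op \<Rightarrow> bool" where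
  "angle_accretive \<omega> A \<longleftrightarrow>
     linear_op A \<and> numerical_range A \<subseteq> {0} \<union> {z. z \<noteq> 0 \<and> \<bar>Arg z\<bar> \<le> \<omega>}"

definition m_angle_accretive :: "real \<Rightarrow> 'h::complex_hilbert_space op \<Rightarrow> bool" where
  "m_angle_accretive \<omega> A \<longleftrightarrow> angle_accretive \<omega> A \<and> m_accretive A"

definition balakrishnan ::
    "'h::{complex_hilbert_space, second_countable_topology} op \<Rightarrow> real \<Rightarrow> 'h op" where
  "balakrishnan A \<beta> =
     {(x, (sin (pi * \<beta>) / pi) *\<^sub>R
          (LINT l:{0<..}|lborel.
             l powr (\<beta> - 1) *\<^sub>R app A (app ((shift_op (complex_of_real l) A)\<inverse>) x))) |x.
        x \<in> Domain A}"

text \<open>Intended for \<open>-1 \<le> \<beta> \<le> 1\<close> only.\<close>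

definition frac_pow ::
    "'h::{complex_hilbert_space, second_countable_topology} op \<Rightarrow> real \<Rightarrow> 'h op" where
  "frac_pow A \<beta> =
     (let P = (\<lambda>\<gamma>. if \<gamma> = 0 then Id else if \<gamma> = 1 then A else closure (balakrishnan A \<gamma>))
      in if \<beta> < 0 then (P (- \<beta>))\<inverse> else P \<beta>)"

definition frac_space ::
    "'h::{complex_hilbert_space, second_countable_topology} op \<Rightarrow> real \<Rightarrow> 'h set" where
  "frac_space A \<beta> = Domain (frac_pow A \<beta>)"

definition frac_norm ::
    "'h::{complex_hilbert_space, second_countable_topology} op \<Rightarrow> real \<Rightarrow> 'h \<Rightarrow> real" where
  "frac_norm A \<beta> x = norm (app (frac_pow A \<beta>) x)"

text \<open>
  \<open>u \<in> C\<^sup>k((0,\<infinity>); H\<^sup>\<beta>)\<close>: the functions \<open>d 0, \<dots>, d k\<close> are the successive derivatives of \<open>u\<close>, with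
  difference quotients and continuity taken in the norm of \<open>H\<^sup>\<beta>\<close>. Values of \<open>u\<close> outside the open
  half-line play no role.
\<close>

definition Ck_frac ::
    "'h::{complex_hilbert_space, second_countable_topology} op \<Rightarrow> nat \<Rightarrow> real \<Rightarrow> (real \<Rightarrow> 'h) \<Rightarrow> bool"
  where
  "Ck_frac A k \<beta> u \<longleftrightarrow>
     (\<exists>d :: nat \<Rightarrow> real \<Rightarrow> 'h.
        (\<forall>t>0. d 0 t = u t) \<and>
        (\<forall>j\<le>k. \<forall>t>0. d j t \<in> frac_space A \<beta>) \<and>
        (\<forall>j<k. \<forall>t>0.
           ((\<lambda>s. frac_norm A \<beta> ((d j s - d j t) /\<^sub>R (s - t) - d (Suc j) t)) \<longlongrightarrow> 0) (at t)) \<and>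
        (\<forall>t>0. ((\<lambda>s. frac_norm A \<beta> (d k s - d k t)) \<longlongrightarrow> 0) (at t)))"

definition C0_semigroup :: "(real \<Rightarrow> 'h::complex_hilbert_space \<Rightarrow> 'h) \<Rightarrow> bool" where
  "C0_semigroup T \<longleftrightarrow>
     (\<forall>t\<ge>0. bounded_linear (T t) \<and> (\<forall>c x. T t (c *\<^sub>C x) = c *\<^sub>C T t x)) \<and>
     (\<forall>x. T 0 x = x) \<and>
     (\<forall>s\<ge>0. \<forall>t\<ge>0. \<forall>x. T (s + t) x = T s (T t x)) \<and>
     (\<forall>x. ((\<lambda>t. T t x) \<longlongrightarrow> x) (at_right 0))"

definition generator :: "(real \<Rightarrow> 'h::complex_hilbert_space \<Rightarrow> 'h) \<Rightarrow> 'h op" where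
  "generator T = {(x, y). ((\<lambda>h. (T h x - x) /\<^sub>R h) \<longlongrightarrow> y) (at_right 0)}"

text \<open>
  \<open>exp_op t G\<close> is \<open>e\<^sup>t\<^sup>G\<close>, meant for \<open>t \<ge> 0\<close> and a generator \<open>G\<close>. A generator determines its
  semigroup on \<open>t \<ge> 0\<close>, so the choice is immaterial there.
\<close>

definition exp_op :: "real \<Rightarrow> 'h::complex_hilbert_space op \<Rightarrow> 'h \<Rightarrow> 'h" where
  "exp_op t G = (SOME T. C0_semigroup T \<and> generator T = G) t"

definition vderiv :: "nat \<Rightarrow> (real \<Rightarrow> 'h::real_normed_vector) \<Rightarrow> real \<Rightarrow> 'h" where
  "vderiv n u = ((\<lambda>f t. vector_derivative f (at t)) ^^ n) u"

definition Upsilon0 :: "real \<Rightarrow> real" where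
  "Upsilon0 \<alpha> = 2 * cos (2 * pi * \<alpha> / 3) + 1"

definition is_solution ::
    "'h::{complex_hilbert_space, second_countable_topology} op \<Rightarrow> real \<Rightarrow> 'h \<Rightarrow> 'h \<Rightarrow> 'h
      \<Rightarrow> (real \<Rightarrow> 'h) \<Rightarrow> bool" where
  "is_solution A \<alpha> \<phi> \<psi> \<xi> u \<longleftrightarrow>
     Ck_frac A 3 0 u \<and> Ck_frac A 2 (\<alpha> / 3) u \<and> Ck_frac A 1 (2 * \<alpha> / 3) u \<and> Ck_frac A 0 \<alpha> u \<and>
     (\<forall>t>0. vderiv 3 u t
        + Upsilon0 \<alpha> *\<^sub>R app (frac_pow A (\<alpha> / 3)) (vderiv 2 u t)
        + Upsilon0 \<alpha> *\<^sub>R app (frac_pow A (2 * \<alpha> / 3)) (vderiv 1 u t)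
        + app (frac_pow A \<alpha>) (u t) = 0) \<and>
     (u \<longlongrightarrow> \<phi>) (at_right 0) \<and>
     (vderiv 1 u \<longlongrightarrow> \<psi>) (at_right 0) \<and>
     (vderiv 2 u \<longlongrightarrow> \<xi>) (at_right 0)"

end

theory Submission
  imports Defs
begin

text \<open>
  All operators are handled through the bounded accretive operator \<open>K = A\<inverse>\<close>, with
  \<open>A\<^sup>-\<^sup>\<gamma> = K\<^sup>\<gamma> = sin (\<pi>\<gamma>)/\<pi> \<integral> l\<^sup>-\<^sup>\<gamma> K (1 + l K)\<^sup>-\<^sup>1 dl\<close>. For a bounded coercive operator \<open>L\<close> the power \<open>L\<^sup>\<gamma>\<close> has,
  in commuting directions \<open>D\<close>, the derivative \<open>\<gamma> D L\<^sup>-\<^sup>1 L\<^sup>\<gamma>\<close>. Integrating this equation along the segment from the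
  identity to \<open>L\<close> gives the law of exponents, and along \<open>s \<mapsto> e\<^sup>-\<^sup>i\<^sup>s L\<close> it gives \<open>(e\<^sup>-\<^sup>i\<^sup>s L)\<^sup>\<gamma> = e\<^sup>-\<^sup>i\<^sup>\<gamma>\<^sup>s L\<^sup>\<gamma>\<close>, whence
  the numerical range of \<open>K\<^sup>\<gamma>\<close> lies in the sector of angle \<open>\<gamma>\<omega>\<close>; both statements pass from \<open>K + \<epsilon>\<close> to \<open>K\<close>.

  With \<open>C = A\<^sup>-\<^sup>\<alpha>\<^sup>/\<^sup>3\<close> the bound on \<open>\<alpha>\<close> says exactly that \<open>e\<^sup>i\<^sup>\<tau> C\<close> is sectorial with a margin for
  \<open>\<bar>\<tau>\<bar> \<le> 2\<pi>\<alpha>/3\<close>, so that \<open>c A\<^sup>\<alpha>\<^sup>/\<^sup>3\<close> generates a smoothing semigroup for \<open>c \<in> {a, b, -1}\<close>, obtained as the limit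
  of the exponentials of \<open>-(S + \<epsilon>)\<^sup>-\<^sup>1\<close> for \<open>S = - C/c\<close>. Since \<open>a\<close>, \<open>b\<close> and \<open>-1\<close> are the roots of
  \<open>x\<^sup>3 + \<Upsilon> x\<^sup>2 + \<Upsilon> x + 1\<close>, combinations of the three orbits solve the equation. For uniqueness,
  applying \<open>C\<^sup>3\<close> to the equation turns it into a product of three first order operators
  \<open>C d/dt - c\<close>, and \<open>C w' = c w\<close> with \<open>w \<rightarrow> 0\<close> at \<open>0\<close> forces \<open>w = 0\<close> because \<open>\<parallel>w\<parallel>\<close> is nonincreasing.
\<close>

section \<open>The complex structure\<close>

text \<open>The closed formula for \<open>u\<close> is Newton interpolation. Let f(c) be the
  semigroup generated by c A^(\<alpha>/3). Then f[a] = f(a), f[a,b] = (f(b) - f(a)) / (b - a) and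
  f[a,b,-1] = \<open>J\<close> / (1 + b) are divided differences, and u = f[a] \<phi> + f[a,b] (C
  \<psi> - a \<phi>) + f[a,b,-1] (C^2 \<xi> - (a + b) C \<psi> + a b \<phi>). One obstacle shapes
  the part on fractional powers: the derivative \<gamma> D L^-1 L^\<gamma> contains L^-1, which is
  unbounded when L = K. Differential equations are therefore solved for coercive operators only, and
  what is carried over to K are product identities and sign conditions, which survive strong limits
  with bounds independent of the coercivity constant. A second one concerns semigroups: the
  exponential in the statement is an arbitrary choice among semigroups with the given generator. The
  constructed semigroup can replace it only after uniqueness is known for every C0 semigroup with
  that generator, including those not known to be contractive.\<close>

lemma scaleC_one: "1 *\<^sub>C x = (x::'h::complex_hilbert_space)"
  using scaleR_scaleC[of 1 x] by simp

lemma scaleC_zero_left: "0 *\<^sub>C x = (0::'h::complex_hilbert_space)"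
  using scaleR_scaleC[of 0 x] by simp

lemma scaleC_zero_right: "c *\<^sub>C (0::'h::complex_hilbert_space) = 0"
  using scaleC_add_right[of c 0 0] by simp

lemma scaleC_minus_right: "c *\<^sub>C (- x) = - (c *\<^sub>C (x::'h::complex_hilbert_space))"
  using scaleC_add_right[of c x "-x"] by (simp add: scaleC_zero_right minus_unique)

lemma scaleC_minus_left: "(- c) *\<^sub>C x = - (c *\<^sub>C (x::'h::complex_hilbert_space))"
  using scaleC_add_left[of c "-c" x] by (simp add: scaleC_zero_left minus_unique)

lemma scaleC_diff_right: "c *\<^sub>C (x - y) = c *\<^sub>C x - c *\<^sub>C (y::'h::complex_hilbert_space)"
  using scaleC_add_right[of c x "-y"] by (simp add: scaleC_minus_right)

lemma scaleC_diff_left: "(c - d) *\<^sub>C x = c *\<^sub>C x - d *\<^sub>C (x::'h::complex_hilbert_space)"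
  using scaleC_add_left[of c "-d" x] by (simp add: scaleC_minus_left)

lemma scaleC_scaleR: "c *\<^sub>C (r *\<^sub>R x) = r *\<^sub>R (c *\<^sub>C (x::'h::complex_hilbert_space))"
  by (simp add: scaleR_scaleC scaleC_scaleC mult.commute)

lemma cinner_scaleC_right: "cinner x (c *\<^sub>C y) = cnj c * cinner x y"
  by (metis cinner_commute cinner_scaleC_left complex_cnj_mult)

lemma cinner_add_right: "cinner x (y + z) = cinner x y + cinner x z"
  by (metis cinner_commute cinner_add_left complex_cnj_add)

lemma cinner_self: "cinner x x = of_real ((norm x)\<^sup>2)"
proof -
  have "Im (cinner x x) = 0"
    using arg_cong[OF cinner_commute[of x x], of Im] by simp
  then show ?thesis
    by (simp add: complex_eq_iff power2_norm_eq_inner inner_eq_Re_cinner)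
qed

lemma norm_scaleC: "norm (c *\<^sub>C (x::'h::complex_hilbert_space)) = cmod c * norm x"
proof -
  have "(norm (c *\<^sub>C x))\<^sup>2 = Re (c * cnj c * cinner x x)"
    by (simp add: power2_norm_eq_inner inner_eq_Re_cinner cinner_scaleC_left cinner_scaleC_right algebra_simps)
  also have "\<dots> = (cmod c * norm x)\<^sup>2"
    by (simp add: cinner_self complex_norm_square[symmetric] power_mult_distrib flip: of_real_mult of_real_power)
  finally show ?thesis by (simp add: power2_eq_iff_nonneg)
qed

lemma bounded_linear_scaleC: "bounded_linear (\<lambda>x::'h::complex_hilbert_space. c *\<^sub>C x)"
  by (rule bounded_linear_intro[where K = "cmod c"])
    (auto simp: scaleC_add_right scaleC_scaleR norm_scaleC)

lemma Re_cinner_rotate: "Re (c * cinner x y) = inner (c *\<^sub>C x) y"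
  by (simp add: inner_eq_Re_cinner cinner_scaleC_left)

text \<open>Elements of the type \<open>\<Rightarrow>\<^sub>L\<close> are only real linear, so
  complex homogeneity is carried along as a separate property.\<close>

definition clinear :: "('h::complex_hilbert_space \<Rightarrow>\<^sub>L 'h) \<Rightarrow> bool" where
  "clinear U \<longleftrightarrow> (\<forall>c x. U (c *\<^sub>C x) = c *\<^sub>C U x)"

lift_definition scal :: "complex \<Rightarrow> 'h::complex_hilbert_space \<Rightarrow>\<^sub>L 'h" is "\<lambda>c x. c *\<^sub>C x"
  by (rule bounded_linear_scaleC)

lemma scal_apply [simp]: "scal c x = c *\<^sub>C x"
  by (simp add: scal.rep_eq)

lemma clinear_scal: "clinear (scal c)"
  by (simp add: clinear_def scaleC_scaleC mult.commute)

lemma clinear_compose: "clinear U \<Longrightarrow> clinear V \<Longrightarrow> clinear (U o\<^sub>L V)"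
  by (simp add: clinear_def)

section \<open>Coercive operators\<close>

definition inverse_pair :: "('h::real_normed_vector \<Rightarrow>\<^sub>L 'h) \<Rightarrow> ('h \<Rightarrow>\<^sub>L 'h) \<Rightarrow> bool" where
  "inverse_pair G R \<longleftrightarrow> (\<forall>x. R (G x) = x) \<and> (\<forall>x. G (R x) = x)"

lemma inverse_pair_unique: "inverse_pair G R \<Longrightarrow> inverse_pair G R' \<Longrightarrow> R = R'"
  unfolding inverse_pair_def by (metis blinfun_eqI)

lemma bij_bounded_below_inverse:
  fixes G :: "'h::real_normed_vector \<Rightarrow>\<^sub>L 'h"
  assumes "\<And>y. \<exists>x. G x = y" and c: "c > 0" and low: "\<And>x. c * norm x \<le> norm (G x)"
  shows "\<exists>R. inverse_pair G R \<and> norm R \<le> 1 / c"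
proof -
  obtain f where f: "\<And>y. G (f y) = y" using assms(1) by metis
  have inj: "x = x'" if "G x = G x'" for x x'
    using low[of "x - x'"] c that by (simp add: blinfun.diff_right mult_le_0_iff)
  have bd: "norm (f y) \<le> norm y * (1 / c)" for y
    using low[of "f y"] c by (simp add: f field_simps)
  have bl: "bounded_linear f"
    by (rule bounded_linear_intro[OF _ _ bd])
      (rule inj, simp add: f blinfun.add_right blinfun.scaleR_right)+
  have "inverse_pair G (Blinfun f)"
    unfolding inverse_pair_def using f inj by (auto simp: bounded_linear_Blinfun_apply[OF bl])
  moreover have "norm (Blinfun f) \<le> 1 / c"
    by (rule norm_blinfun_bound)
      (use bd c in \<open>auto simp: bounded_linear_Blinfun_apply[OF bl] mult.commute\<close>)
  ultimately show ?thesis by blast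
qed

lemma coercive_bounded_below:
  fixes G :: "'h::real_inner \<Rightarrow>\<^sub>L 'h"
  assumes "\<And>x. e * (norm x)\<^sup>2 \<le> inner (G x) x"
  shows "e * norm x \<le> norm (G x)"
proof (cases "x = 0")
  case False
  have "e * (norm x)\<^sup>2 \<le> norm (G x) * norm x"
    using assms[of x] norm_cauchy_schwarz[of "G x" x] by linarith
  then show ?thesis using False by (simp add: power2_eq_square flip: mult.assoc)
qed simp

text \<open>For small \<open>\<tau>\<close> the map \<open>x \<mapsto> x - \<tau> (G x - y)\<close> is a strict contraction, and its fixed point
  solves \<open>G x = y\<close>.\<close>

lemma coercive_inverse:
  fixes G :: "'h::{real_inner, banach} \<Rightarrow>\<^sub>L 'h"
  assumes e: "e > 0" and coe: "\<And>x. e * (norm x)\<^sup>2 \<le> inner (G x) x"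
  shows "\<exists>R. inverse_pair G R \<and> norm R \<le> 1 / e"
proof (rule bij_bounded_below_inverse[OF _ e coercive_bounded_below[OF coe]])
  fix y
  \<comment> \<open>Adding \<open>e\<close> keeps \<open>g\<close> positive and gives
    \<open>e \<le> g\<close>. The contraction factor is bounded by
    \<open>1 - 2 \<tau> e + \<tau>^2 g^2\<close>, which is smallest at
    \<open>\<tau> = e / g^2\<close>, with value \<open>q = 1 - (e / g)^2\<close>.\<close>
  define g where "g = norm G + e"
  define \<tau> where "\<tau> = e / g\<^sup>2"
  have g: "g > 0" "norm G \<le> g" "e \<le> g" using e norm_ge_zero[of G] unfolding g_def by linarith+
  define q where "q = 1 - \<tau> * e"
  have te: "\<tau> * e = (e / g)\<^sup>2" by (simp add: \<tau>_def power2_eq_square)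
  have "e / g \<le> 1" "e / g > 0" using g e by auto
  then have q: "0 \<le> q" "q < 1" using power_mono[of "e / g" 1 2] by (auto simp: q_def te)
  have \<tau>: "\<tau> > 0" using e g by (simp add: \<tau>_def)
  have est: "(norm (x - \<tau> *\<^sub>R G x))\<^sup>2 \<le> q * (norm x)\<^sup>2" for x
  proof -
    have "norm (G x) \<le> g * norm x"
      by (rule order_trans[OF norm_blinfun]) (simp add: g mult_right_mono)
    then have "(norm (G x))\<^sup>2 \<le> g\<^sup>2 * (norm x)\<^sup>2"
      using power_mono[of "norm (G x)" "g * norm x" 2] by (simp add: power_mult_distrib)
    then have 1: "\<tau>\<^sup>2 * (norm (G x))\<^sup>2 \<le> \<tau>\<^sup>2 * (g\<^sup>2 * (norm x)\<^sup>2)"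
      by (rule mult_left_mono) simp
    have 2: "\<tau>\<^sup>2 * (g\<^sup>2 * (norm x)\<^sup>2) = \<tau> * e * (norm x)\<^sup>2"
      using g by (simp add: \<tau>_def power2_eq_square)
    have 3: "\<tau> * (e * (norm x)\<^sup>2) \<le> \<tau> * inner (G x) x"
      using coe[of x] \<tau> by (intro mult_left_mono) auto
    have "(norm (x - \<tau> *\<^sub>R G x))\<^sup>2 = (norm x)\<^sup>2 - 2 * (\<tau> * inner (G x) x) + \<tau>\<^sup>2 * (norm (G x))\<^sup>2"
      unfolding power2_norm_eq_inner
      by (simp add: inner_diff_left inner_diff_right inner_commute power2_eq_square)
    also have "\<dots> \<le> q * (norm x)\<^sup>2"
      using 1 2 3 by (simp add: q_def algebra_simps)
    finally show ?thesis .
  qed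
  define T where "T x = x - \<tau> *\<^sub>R (G x - y)" for x
  have "dist (T x) (T x') \<le> sqrt q * dist x x'" for x x'
  proof -
    have "T x - T x' = (x - x') - \<tau> *\<^sub>R G (x - x')"
      by (simp add: T_def blinfun.diff_right algebra_simps)
    then have "(dist (T x) (T x'))\<^sup>2 \<le> (sqrt q * dist x x')\<^sup>2"
      using est[of "x - x'"] q by (simp add: dist_norm power_mult_distrib)
    then show ?thesis by (rule power2_le_imp_le) (use q in simp)
  qed
  moreover have "0 \<le> sqrt q" "sqrt q < 1" using q by auto
  ultimately have "\<exists>!x. T x = x" by (intro banach_fix_type[of "sqrt q" T]) auto
  then obtain x where "T x = x" by blast
  then show "\<exists>x. G x = y" using \<tau> by (auto simp: T_def)
qed

section \<open>Resolvent families \<open>(1 + l L)^-1\<close>\<close>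

definition rinv :: "('h::real_normed_vector \<Rightarrow>\<^sub>L 'h) \<Rightarrow> ('h \<Rightarrow>\<^sub>L 'h)" where
  "rinv G = (THE R. inverse_pair G R)"

lemma rinv_eq: "inverse_pair G R \<Longrightarrow> rinv G = R"
  unfolding rinv_def using inverse_pair_unique by blast

definition shifted :: "('h::real_normed_vector \<Rightarrow>\<^sub>L 'h) \<Rightarrow> real \<Rightarrow> ('h \<Rightarrow>\<^sub>L 'h)" where
  "shifted L l = id_blinfun + l *\<^sub>R L"

lemma shifted_apply: "shifted L l x = x + l *\<^sub>R L x"
  by (simp add: shifted_def blinfun.add_left blinfun.scaleR_left)

text \<open>For \<open>L = A^-1\<close> this is \<open>A (l + A)^-1\<close>, the bounded operator
  under the Balakrishnan integral.\<close>

definition rho :: "('h::real_normed_vector \<Rightarrow>\<^sub>L 'h) \<Rightarrow> real \<Rightarrow> ('h \<Rightarrow>\<^sub>L 'h)" where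
  "rho L l = rinv (shifted L l)"

text \<open>The bound is a function of \<open>l\<close> because two regimes occur: a constant for
  accretive \<open>L\<close>, and \<open>M / (1 + l)\<close> for coercive \<open>L\<close>. The
  decay in the second is what makes the weighted integral of \<open>rho L\<close> itself
  converge.\<close>

definition res_bound :: "(real \<Rightarrow> real) \<Rightarrow> ('h::real_normed_vector \<Rightarrow>\<^sub>L 'h) \<Rightarrow> bool" where
  "res_bound g L \<longleftrightarrow> (\<forall>l\<ge>0. inverse_pair (shifted L l) (rho L l) \<and> norm (rho L l) \<le> g l)"

lemma res_boundI:
  assumes "\<And>l. l \<ge> 0 \<Longrightarrow> \<exists>R. inverse_pair (shifted L l) R \<and> norm R \<le> g l"
  shows "res_bound g L"
  unfolding res_bound_def rho_def using assms rinv_eq by metis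

lemma res_bound_mono: "res_bound g L \<Longrightarrow> (\<And>l. l \<ge> 0 \<Longrightarrow> g l \<le> g' l) \<Longrightarrow> res_bound g' L"
  unfolding res_bound_def by (meson order_trans)

context
  fixes L :: "'h::real_normed_vector \<Rightarrow>\<^sub>L 'h" and g
  assumes L: "res_bound g L"
begin

lemma rho_left: "l \<ge> 0 \<Longrightarrow> rho L l (x + l *\<^sub>R L x) = x"
  using L by (auto simp: res_bound_def inverse_pair_def shifted_apply)

lemma rho_right: "l \<ge> 0 \<Longrightarrow> rho L l x + l *\<^sub>R L (rho L l x) = x"
  using L by (auto simp: res_bound_def inverse_pair_def shifted_apply)

lemma norm_rho: "l \<ge> 0 \<Longrightarrow> norm (rho L l) \<le> g l"
  using L by (auto simp: res_bound_def)

lemma norm_rho_apply: "l \<ge> 0 \<Longrightarrow> norm (rho L l x) \<le> g l * norm x"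
  by (rule order_trans[OF norm_blinfun]) (simp add: norm_rho mult_right_mono)

lemma rho_commute:
  fixes U :: "'h \<Rightarrow>\<^sub>L 'h"
  assumes "\<And>x. U (L x) = L (U x)" "l \<ge> 0"
  shows "blinfun_apply U (rho L l x) = rho L l (U x)"
proof -
  have "U (rho L l x) + l *\<^sub>R L (U (rho L l x)) = U x"
    using arg_cong[OF rho_right[OF assms(2), of x], of "blinfun_apply U"]
    by (simp add: blinfun.add_right blinfun.scaleR_right assms(1))
  then show ?thesis using rho_left[OF assms(2), of "U (rho L l x)"] by simp
qed

lemma rho_L: "l \<ge> 0 \<Longrightarrow> rho L l (L x) = L (rho L l x)"
  using rho_commute[of L l x] by simp

lemma rho_eqI: "l \<ge> 0 \<Longrightarrow> y + l *\<^sub>R L y = x \<Longrightarrow> rho L l x = y"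
  by (drule sym) (simp add: rho_left)

end

text \<open>The second resolvent identity. Commutation is used to place \<open>L' - L\<close>
  innermost, so that the identity can be applied again to the outer resolvents; this yields
  quadratic remainders.\<close>

lemma rho_difference:
  assumes L: "res_bound g L" and L': "res_bound g' L'" and com: "\<And>x. L (L' x) = L' (L x)" and l: "l \<ge> 0"
  shows "rho L l x - rho L' l x = l *\<^sub>R rho L l (rho L' l ((L' - L) x))"
proof -
  have "rho L l x - rho L' l x = rho L l (x - (rho L' l x + l *\<^sub>R L (rho L' l x)))"
    by (simp add: blinfun.diff_right rho_left[OF L l])
  also have "x - (rho L' l x + l *\<^sub>R L (rho L' l x)) = l *\<^sub>R (L' - L) (rho L' l x)"
    by (subst rho_right[OF L' l, of x, symmetric])
      (simp add: blinfun.diff_left scaleR_diff_right)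
  also have "(L' - L) (rho L' l x) = rho L' l ((L' - L) x)"
    by (rule rho_commute[OF L' _ l]) (simp add: blinfun.diff_left blinfun.diff_right com)
  finally show ?thesis by (simp add: blinfun.scaleR_right)
qed

lemma rho_resolvent_eq:
  assumes L: "res_bound g L" and l: "l \<ge> 0" "m \<ge> 0"
  shows "rho L l x - rho L m x = (m - l) *\<^sub>R rho L l (rho L m (L x))"
proof -
  have "rho L l x - rho L m x = rho L l (x - (rho L m x + l *\<^sub>R L (rho L m x)))"
    by (simp add: blinfun.diff_right rho_left[OF L l(1)])
  also have "x - (rho L m x + l *\<^sub>R L (rho L m x)) = (m - l) *\<^sub>R L (rho L m x)"
    by (subst rho_right[OF L l(2), of x, symmetric])
      (simp add: algebra_simps)
  finally show ?thesis by (simp add: blinfun.scaleR_right rho_L[OF L l(2)])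
qed

lemma rho_lipschitz:
  assumes L: "res_bound (\<lambda>_. M) L" and l: "l \<ge> 0" "m \<ge> 0"
  shows "norm (rho L l x - rho L m x) \<le> \<bar>l - m\<bar> * (M * (M * (norm L * norm x)))"
proof -
  have M: "M \<ge> 0" using order_trans[OF norm_ge_zero norm_rho[OF L l(1)]] .
  have "norm (rho L l (rho L m (L x))) \<le> M * (M * (norm L * norm x))"
    by (intro order_trans[OF norm_rho_apply[OF L l(1)]] mult_left_mono M
          order_trans[OF norm_rho_apply[OF L l(2)]] norm_blinfun)
  then show ?thesis
    by (simp add: rho_resolvent_eq[OF L l] abs_minus_commute mult_left_mono)
qed

lemma continuous_on_rho:
  assumes L: "res_bound (\<lambda>_. M) L"
  shows "continuous_on {0..} (\<lambda>l. rho L l x)"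
proof -
  define B where "B = M * (M * (norm L * norm x))"
  have "M \<ge> 0" using order_trans[OF norm_ge_zero norm_rho[OF L, of 0]] by simp
  then have "B \<ge> 0" by (simp add: B_def)
  then have "B-lipschitz_on {0..} (\<lambda>l. rho L l x)"
    using rho_lipschitz[OF L] by (auto simp: lipschitz_on_def dist_norm B_def mult.commute)
  then show ?thesis by (rule lipschitz_on_continuous_on)
qed

lemma square_abs: "(x::real)\<^sup>2 = \<bar>x\<bar> * \<bar>x\<bar>"
  by (simp add: power2_eq_square)

lemma has_vector_derivative_iff_tendsto:
  fixes f :: "real \<Rightarrow> 'a::real_normed_vector"
  shows "(f has_vector_derivative D) (at t within S) \<longleftrightarrow>
    ((\<lambda>s. (f s - f t) /\<^sub>R (s - t)) \<longlongrightarrow> D) (at t within S)"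
proof -
  have "norm (f s - f t - (s - t) *\<^sub>R D) / norm (s - t) = norm ((f s - f t) /\<^sub>R (s - t) - D)" if "s \<noteq> t" for s
  proof -
    have "(f s - f t) /\<^sub>R (s - t) - D = (f s - f t - (s - t) *\<^sub>R D) /\<^sub>R (s - t)"
      using that by (simp add: scaleR_diff_right)
    then show ?thesis by (simp add: divide_inverse mult.commute)
  qed
  then have *: "(\<forall>\<^sub>F s in at t within S. norm (f s - f t - (s - t) *\<^sub>R D) / norm (s - t) = norm ((f s - f t) /\<^sub>R (s - t) - D))"
    by (simp add: eventually_at_filter)
  have "(f has_vector_derivative D) (at t within S) \<longleftrightarrow>
    ((\<lambda>s. norm (f s - f t - (s - t) *\<^sub>R D) / norm (s - t)) \<longlongrightarrow> 0) (at t within S)"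
    unfolding has_vector_derivative_def has_derivative_iff_norm
    by (simp add: bounded_linear_scaleR_left)
  also have "\<dots> \<longleftrightarrow> ((\<lambda>s. norm ((f s - f t) /\<^sub>R (s - t) - D)) \<longlongrightarrow> 0) (at t within S)"
    by (rule tendsto_cong[OF *])
  also have "\<dots> \<longleftrightarrow> ((\<lambda>s. (f s - f t) /\<^sub>R (s - t)) \<longlongrightarrow> D) (at t within S)"
    by (simp only: tendsto_norm_zero_iff LIM_zero_iff)
  finally show ?thesis .
qed

text \<open>Resolvents, inverses and orbits of regular vectors all come with an explicit second
  order remainder, which is the only source of their differentiability here.\<close>

lemma has_vector_derivative_quadraticI:
  fixes f :: "real \<Rightarrow> 'a::real_normed_vector"
  assumes "\<And>s. s \<in> S \<Longrightarrow> norm (f s - f t - (s - t) *\<^sub>R D) \<le> B * (s - t)\<^sup>2"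
  shows "(f has_vector_derivative D) (at t within S)"
proof -
  have "norm ((f s - f t) /\<^sub>R (s - t) - D) \<le> norm (s - t) * B" if "s \<in> S" "s \<noteq> t" for s
  proof -
    have "(f s - f t) /\<^sub>R (s - t) - D = (f s - f t - (s - t) *\<^sub>R D) /\<^sub>R (s - t)"
      using that by (simp add: scaleR_diff_right)
    then have "norm ((f s - f t) /\<^sub>R (s - t) - D) = norm (f s - f t - (s - t) *\<^sub>R D) / \<bar>s - t\<bar>"
      by (simp add: divide_inverse mult.commute)
    also have "\<dots> \<le> (B * (s - t)\<^sup>2) / \<bar>s - t\<bar>"
      using assms[OF that(1)] by (simp add: divide_right_mono)
    also have "\<dots> = norm (s - t) * B"
      using that unfolding square_abs by (simp del: abs_mult_self_eq)
    finally show ?thesis .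
  qed
  then have "eventually (\<lambda>s. norm ((f s - f t) /\<^sub>R (s - t) - D) \<le> norm (s - t) * B) (at t within S)"
    by (auto simp: eventually_at_filter)
  moreover have "((\<lambda>s. s - t) \<longlongrightarrow> 0) (at t within S)"
    by (rule tendsto_eq_intros refl | simp)+
  ultimately have "((\<lambda>s. (f s - f t) /\<^sub>R (s - t) - D) \<longlongrightarrow> 0) (at t within S)"
    by (rule tendsto_0_le[rotated])
  then show ?thesis by (simp add: has_vector_derivative_iff_tendsto LIM_zero_iff)
qed

lemma rho_has_vector_derivative:
  fixes L :: "'h::real_normed_vector \<Rightarrow>\<^sub>L 'h" and x :: 'h
  assumes L: "res_bound (\<lambda>_. M) L" and l: "l \<ge> 0"
  shows "((\<lambda>l. blinfun_apply (rho L l) x) has_vector_derivative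
    - blinfun_apply (rho L l) (blinfun_apply (rho L l) (L x))) (at l within {0..})"
proof (rule has_vector_derivative_quadraticI)
  fix m assume m: "m \<in> {0::real..}"
  define y where "y = rho L l (L x)"
  define c where "c = M * (M * (norm L * norm y))"
  have "rho L m x - rho L l x = (l - m) *\<^sub>R rho L m y"
    using rho_resolvent_eq[OF L, of m l x] m l by (simp add: y_def)
  then have "rho L m x - rho L l x - (m - l) *\<^sub>R (- rho L l y) = (l - m) *\<^sub>R (rho L m y - rho L l y)"
    by (simp add: algebra_simps)
  then have "norm (rho L m x - rho L l x - (m - l) *\<^sub>R (- rho L l y)) \<le> \<bar>l - m\<bar> * (\<bar>m - l\<bar> * c)"
    using rho_lipschitz[OF L, of m l y] m l by (simp add: mult_left_mono c_def)
  also have "\<dots> = c * (m - l)\<^sup>2"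
    unfolding square_abs by (simp add: abs_minus_commute del: abs_mult_self_eq)
  finally show "norm (rho L m x - rho L l x - (m - l) *\<^sub>R (- rho L l (rho L l (L x)))) \<le> c * (m - l)\<^sup>2"
    by (simp add: y_def)
qed

section \<open>Weighted integrals of operator families\<close>

definition kern :: "real \<Rightarrow> real \<Rightarrow> real" where
  "kern \<gamma> l = l powr (- \<gamma>) / (1 + l)"

lemma Beta_reflection:
  assumes "0 < \<gamma>" "\<gamma> < (1::real)"
  shows "Beta (1 - \<gamma>) \<gamma> = pi / sin (pi * \<gamma>)"
proof -
  have "complex_of_real (Gamma \<gamma> * Gamma (1 - \<gamma>)) = Gamma (complex_of_real \<gamma>) * Gamma (1 - complex_of_real \<gamma>)"
    by (simp flip: Gamma_complex_of_real)
  also have "\<dots> = complex_of_real (pi / sin (pi * \<gamma>))"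
    by (simp add: Gamma_reflection_complex flip: sin_of_real)
  finally have "Gamma \<gamma> * Gamma (1 - \<gamma>) = pi / sin (pi * \<gamma>)"
    using of_real_eq_iff by blast
  then show ?thesis by (simp add: Beta_def mult.commute)
qed

text \<open>The substitution \<open>l = x / (1 - x)\<close> sends the unit interval to the half-line
  and \<open>1 + l\<close> to \<open>1 / (1 - x)\<close>. It turns the kernel into the Beta density
  with parameters \<open>1 - \<gamma>\<close> and \<open>\<gamma>\<close>, whose integral the
  reflection formula evaluates.\<close>

lemma kern_integral_aux:
  assumes g: "0 < \<gamma>" "\<gamma> < 1"
  shows "set_integrable lborel {0<..} (kern \<gamma>)" (is ?I)
    and "(LINT l:{0<..}|lborel. kern \<gamma> l) = pi / sin (pi * \<gamma>)" (is ?E)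
proof -
  define h where "h x = x powr (1 - \<gamma> - 1) * (1 - x) powr (\<gamma> - 1)" for x :: real
  define u where "u x = x / (1 - x)" for x :: real
  define u' where "u' x = 1 / (1 - x)\<^sup>2" for x :: real
  have h_int: "set_integrable lborel {0..1} h"
    unfolding h_def by (rule integrable_Beta) (use g in auto)
  have h_int': "set_integrable lborel {0<..<1} h"
    by (rule set_integrable_subset[OF h_int]) auto
  have eq: "kern \<gamma> (u x) * u' x = h x" if "0 < x" "x < 1" for x
  proof -
    have 1: "1 + u x = inverse (1 - x)" using that by (simp add: u_def field_simps)
    have "(u x) powr (- \<gamma>) = x powr (- \<gamma>) * (1 - x) powr \<gamma>"
      using that by (simp add: u_def powr_divide powr_minus field_simps)
    then have "kern \<gamma> (u x) * u' x = x powr (- \<gamma>) * ((1 - x) powr \<gamma> * (1 - x) / (1 - x)\<^sup>2)"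
      using that by (simp add: kern_def 1 u'_def divide_inverse mult_ac)
    also have "(1 - x) powr \<gamma> * (1 - x) / (1 - x)\<^sup>2 = (1 - x) powr (\<gamma> - 1)"
      using that by (simp add: powr_diff power2_eq_square)
    finally show ?thesis by (simp add: h_def)
  qed
  have ein: "einterval 0 1 = {0<..<1}" "einterval 0 \<infinity> = {0<..}"
    by (auto simp: einterval_def)
  have int: "set_integrable lborel (einterval 0 1) (\<lambda>x. kern \<gamma> (u x) * u' x)"
    unfolding ein by (rule iffD1[OF set_integrable_cong h_int']) (auto simp: eq)
  have lim1: "((ereal \<circ> u \<circ> real_of_ereal) \<longlongrightarrow> 0) (at_right 0)"
  proof -
    have "(u \<longlongrightarrow> 0 / (1 - 0)) (at_right 0)"
      unfolding u_def by (intro tendsto_intros) auto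
    then show ?thesis
      unfolding zero_ereal_def by (simp add: ereal_tendsto_simps o_assoc[symmetric] comp_assoc)
  qed
  have lim2: "((ereal \<circ> u \<circ> real_of_ereal) \<longlongrightarrow> \<infinity>) (at_left 1)"
  proof -
    have "filterlim u at_top (at_left 1)"
      unfolding u_def
      by (rule LIM_at_top_divide[where a = 1])
        (auto intro!: tendsto_eq_intros simp: eventually_at_filter)
    then show ?thesis
      unfolding one_ereal_def by (simp add: ereal_tendsto_simps)
  qed
  have d: "(u has_real_derivative u' x) (at x)" "isCont (kern \<gamma>) (u x)" "isCont u' x" "0 \<le> kern \<gamma> (u x)"
    if "0 < ereal x" "ereal x < 1" for x
  proof -
    have x: "0 < x" "x < 1" using that by auto
    show "(u has_real_derivative u' x) (at x)"
      unfolding u_def u'_def using x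
      by (auto intro!: derivative_eq_intros simp: power2_eq_square field_simps)
    have "u x > 0" using x by (simp add: u_def)
    then show "isCont (kern \<gamma>) (u x)"
      unfolding kern_def[abs_def] by (intro continuous_intros) auto
    show "isCont u' x"
      unfolding u'_def using x by (intro continuous_intros) auto
    show "0 \<le> kern \<gamma> (u x)" using \<open>u x > 0\<close> by (simp add: kern_def)
  qed
  have u'_nonneg: "0 \<le> u' x" for x by (simp add: u'_def)
  have zero_less_one: "(0::ereal) < 1" by simp
  note sub = interval_integral_substitution_nonneg[OF zero_less_one d u'_nonneg lim1 lim2 int]
  show ?I using sub(1) by (simp add: ein)
  have "(LINT l:{0<..}|lborel. kern \<gamma> l) = (LBINT x=0..1. kern \<gamma> (u x) * u' x)"
    using sub(2) by (simp add: interval_lebesgue_integral_0_infty)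
  also have "\<dots> = (LINT x:{0<..<1}|lborel. kern \<gamma> (u x) * u' x)"
    by (simp add: interval_lebesgue_integral_def ein)
  also have "\<dots> = (LINT x:{0<..<1}|lborel. h x)"
    by (rule set_lebesgue_integral_cong) (auto simp: eq)
  also have "\<dots> = integral {0<..<1} h"
    by (rule set_borel_integral_eq_integral[OF h_int'])
  also have "\<dots> = Beta (1 - \<gamma>) \<gamma>"
    using has_integral_Beta_real[of "1 - \<gamma>" \<gamma>] g unfolding h_def[symmetric]
    by (simp add: has_integral_Icc_iff_Ioo integral_unique)
  finally show ?E using Beta_reflection[OF g] by simp
qed

lemma kern_integrable: "0 < (\<gamma>::real) \<Longrightarrow> \<gamma> < 1 \<Longrightarrow> set_integrable lborel {0<..} (\<lambda>l. l powr (- \<gamma>) / (1 + l))"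
  using kern_integral_aux(1)[of \<gamma>] by (simp add: kern_def[abs_def])

lemma kern_integral: "0 < (\<gamma>::real) \<Longrightarrow> \<gamma> < 1 \<Longrightarrow> (LINT l:{0<..}|lborel. l powr (- \<gamma>) / (1 + l)) = pi / sin (pi * \<gamma>)"
  using kern_integral_aux(2)[of \<gamma>] by (simp add: kern_def[abs_def])

lemma sin_pi_pos: "0 < (\<gamma>::real) \<Longrightarrow> \<gamma> < 1 \<Longrightarrow> sin (pi * \<gamma>) > 0"
  by (rule sin_gt_zero) auto

text \<open>Decay like \<open>1 / (1 + l)\<close> makes \<open>l powr (- \<gamma>)\<close> times the
  family integrable at both ends exactly for \<open>0 < \<gamma> < 1\<close>. Continuity is required
  vector by vector only, which is stable under strong constructions.\<close>

definition wfam :: "real \<Rightarrow> (real \<Rightarrow> 'h::real_normed_vector \<Rightarrow>\<^sub>L 'h) \<Rightarrow> bool" where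
  "wfam B \<Phi> \<longleftrightarrow> (\<forall>l>0. norm (\<Phi> l) \<le> B / (1 + l)) \<and> (\<forall>x. continuous_on {0<..} (\<lambda>l. \<Phi> l x))"

text \<open>The prefactor is the reciprocal of the integral of the kernel
  \<open>l powr (- \<gamma>) / (1 + l)\<close>; hence a family bounded by \<open>B / (1 + l)\<close>
  has an integral of norm at most \<open>B\<close>. The integral is taken vector by vector because
  the separable space is \<open>'h\<close>, not the space of operators.\<close>

definition wint :: "real \<Rightarrow> (real \<Rightarrow> 'h::{banach, second_countable_topology} \<Rightarrow>\<^sub>L 'h) \<Rightarrow> 'h \<Rightarrow>\<^sub>L 'h" where
  "wint \<gamma> \<Phi> = Blinfun (\<lambda>x. (sin (pi * \<gamma>) / pi) *\<^sub>R (LINT l:{0<..}|lborel. l powr (- \<gamma>) *\<^sub>R \<Phi> l x))"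

context
  fixes \<gamma> :: real and B :: real and \<Phi> :: "real \<Rightarrow> 'h::{banach, second_countable_topology} \<Rightarrow>\<^sub>L 'h"
  assumes g: "0 < \<gamma>" "\<gamma> < 1" and F: "wfam B \<Phi>"
begin

lemma wfam_norm_le: "l > 0 \<Longrightarrow> norm (l powr (- \<gamma>) *\<^sub>R \<Phi> l x) \<le> (B * norm x) * (l powr (- \<gamma>) / (1 + l))"
proof -
  assume l: "l > 0"
  have "norm (\<Phi> l x) \<le> B / (1 + l) * norm x"
    using F l by (intro order_trans[OF norm_blinfun] mult_right_mono) (auto simp: wfam_def)
  then have "l powr (- \<gamma>) * norm (\<Phi> l x) \<le> l powr (- \<gamma>) * (B / (1 + l) * norm x)"
    by (intro mult_left_mono) auto
  then show ?thesis by (simp add: mult_ac)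
qed

lemma wfam_integrable: "set_integrable lborel {0<..} (\<lambda>l. l powr (- \<gamma>) *\<^sub>R \<Phi> l x)"
proof (rule set_integrable_bound)
  show "set_integrable lborel {0<..} (\<lambda>l. (B * norm x) * (l powr (- \<gamma>) / (1 + l)))"
    by (intro set_integrable_mult_right kern_integrable g)
  have "continuous_on {0<..} (\<lambda>l. l powr (- \<gamma>) *\<^sub>R \<Phi> l x)"
    using F by (intro continuous_on_scaleR continuous_on_powr) (auto simp: wfam_def)
  then show "set_borel_measurable lborel {0<..} (\<lambda>l. l powr (- \<gamma>) *\<^sub>R \<Phi> l x)"
    using borel_measurable_continuous_on_indicator[of "{0<..}" "\<lambda>l. l powr (- \<gamma>) *\<^sub>R \<Phi> l x"]
    by (simp add: set_borel_measurable_def)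
  show "AE l in lborel. l \<in> {0<..} \<longrightarrow> norm (l powr (- \<gamma>) *\<^sub>R \<Phi> l x)
      \<le> norm ((B * norm x) * (l powr (- \<gamma>) / (1 + l)))"
  proof (rule AE_I2, rule impI)
    fix l :: real assume "l \<in> {0<..}"
    then show "norm (l powr (- \<gamma>) *\<^sub>R \<Phi> l x) \<le> norm ((B * norm x) * (l powr (- \<gamma>) / (1 + l)))"
      using wfam_norm_le[of l x] order_trans[OF wfam_norm_le abs_ge_self, of l x] by simp
  qed
qed

lemma wint_norm_le: "norm ((sin (pi * \<gamma>) / pi) *\<^sub>R (LINT l:{0<..}|lborel. l powr (- \<gamma>) *\<^sub>R \<Phi> l x)) \<le> norm x * B"
proof -
  have "norm (LINT l:{0<..}|lborel. l powr (- \<gamma>) *\<^sub>R \<Phi> l x)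
      \<le> (LINT l:{0<..}|lborel. (B * norm x) * (l powr (- \<gamma>) / (1 + l)))"
    unfolding set_lebesgue_integral_def
  proof (rule Bochner_Integration.integral_norm_bound_integral)
    show "integrable lborel (\<lambda>l. indicat_real {0<..} l *\<^sub>R (l powr (- \<gamma>) *\<^sub>R \<Phi> l x))"
      using wfam_integrable by (simp add: set_integrable_def)
    have "set_integrable lborel {0<..} (\<lambda>l. (B * norm x) * (l powr (- \<gamma>) / (1 + l)))"
      by (intro set_integrable_mult_right kern_integrable g)
    then show "integrable lborel (\<lambda>l. indicat_real {0<..} l *\<^sub>R (B * norm x * (l powr (- \<gamma>) / (1 + l))))"
      by (simp only: set_integrable_def)
    fix l :: real
    show "norm (indicat_real {0<..} l *\<^sub>R (l powr (- \<gamma>) *\<^sub>R \<Phi> l x))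
        \<le> indicat_real {0<..} l *\<^sub>R (B * norm x * (l powr (- \<gamma>) / (1 + l)))"
      using wfam_norm_le[of l x] by (auto simp: indicator_def)
  qed
  also have "\<dots> = (B * norm x) * (pi / sin (pi * \<gamma>))"
    by (simp only: set_integral_mult_right kern_integral[OF g])
  finally have "(sin (pi * \<gamma>) / pi) * norm (LINT l:{0<..}|lborel. l powr (- \<gamma>) *\<^sub>R \<Phi> l x)
      \<le> (sin (pi * \<gamma>) / pi) * ((B * norm x) * (pi / sin (pi * \<gamma>)))"
    using sin_pi_pos[OF g] by (intro mult_left_mono) auto
  also have "\<dots> = norm x * B" using sin_pi_pos[OF g] by simp
  finally show ?thesis using sin_pi_pos[OF g] by simp
qed

lemma wint_apply: "wint \<gamma> \<Phi> x = (sin (pi * \<gamma>) / pi) *\<^sub>R (LINT l:{0<..}|lborel. l powr (- \<gamma>) *\<^sub>R \<Phi> l x)"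
proof -
  have "bounded_linear (\<lambda>x. (sin (pi * \<gamma>) / pi) *\<^sub>R (LINT l:{0<..}|lborel. l powr (- \<gamma>) *\<^sub>R \<Phi> l x))"
  proof (rule bounded_linear_intro[OF _ _ wint_norm_le])
    fix x y r
    have "(LINT l:{0<..}|lborel. l powr (- \<gamma>) *\<^sub>R \<Phi> l (x + y)) =
      (LINT l:{0<..}|lborel. l powr (- \<gamma>) *\<^sub>R \<Phi> l x) + (LINT l:{0<..}|lborel. l powr (- \<gamma>) *\<^sub>R \<Phi> l y)"
      using set_integral_add(2)[OF wfam_integrable wfam_integrable, of x y]
      by (simp add: blinfun.add_right scaleR_add_right)
    then show "(sin (pi * \<gamma>) / pi) *\<^sub>R (LINT l:{0<..}|lborel. l powr (- \<gamma>) *\<^sub>R \<Phi> l (x + y)) =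
      (sin (pi * \<gamma>) / pi) *\<^sub>R (LINT l:{0<..}|lborel. l powr (- \<gamma>) *\<^sub>R \<Phi> l x) +
      (sin (pi * \<gamma>) / pi) *\<^sub>R (LINT l:{0<..}|lborel. l powr (- \<gamma>) *\<^sub>R \<Phi> l y)"
      by (simp add: scaleR_add_right)
    have "(LINT l:{0<..}|lborel. l powr (- \<gamma>) *\<^sub>R \<Phi> l (r *\<^sub>R x)) =
      r *\<^sub>R (LINT l:{0<..}|lborel. l powr (- \<gamma>) *\<^sub>R \<Phi> l x)"
      by (subst set_integral_scaleR_right[symmetric]) (simp add: blinfun.scaleR_right mult.commute)
    then show "(sin (pi * \<gamma>) / pi) *\<^sub>R (LINT l:{0<..}|lborel. l powr (- \<gamma>) *\<^sub>R \<Phi> l (r *\<^sub>R x)) =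
      r *\<^sub>R (sin (pi * \<gamma>) / pi) *\<^sub>R (LINT l:{0<..}|lborel. l powr (- \<gamma>) *\<^sub>R \<Phi> l x)"
      by (simp add: mult.commute)
  qed
  then show ?thesis unfolding wint_def by (simp add: bounded_linear_Blinfun_apply)
qed

lemma norm_wint: "norm (wint \<gamma> \<Phi>) \<le> B"
proof (rule norm_blinfun_bound)
  have "norm (\<Phi> 1) \<le> B / (1 + 1)" using F unfolding wfam_def by (metis zero_less_one)
  then have "0 \<le> B / (1 + 1)" by (rule order_trans[OF norm_ge_zero])
  then show "B \<ge> 0" by simp
  show "norm (wint \<gamma> \<Phi> x) \<le> B * norm x" for x
    using wint_norm_le[of x] by (simp add: wint_apply mult.commute)
qed

text \<open>The target space of \<open>T\<close> is arbitrary: operators give commutation and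
  composition rules, and functionals \<open>inner _ y\<close> reduce operator identities and sign
  conditions to real integrals.\<close>

lemma wint_linear_image:
  assumes T: "bounded_linear T"
  shows "T (wint \<gamma> \<Phi> x) = (sin (pi * \<gamma>) / pi) *\<^sub>R (LINT l:{0<..}|lborel. l powr (- \<gamma>) *\<^sub>R T (\<Phi> l x))"
proof -
  interpret T: bounded_linear T by (rule T)
  have "T (LINT l:{0<..}|lborel. l powr (- \<gamma>) *\<^sub>R \<Phi> l x) = (LINT l:{0<..}|lborel. l powr (- \<gamma>) *\<^sub>R T (\<Phi> l x))"
    unfolding set_lebesgue_integral_def
    using wfam_integrable[of x] integral_bounded_linear[OF T, of lborel "\<lambda>l. indicat_real {0<..} l *\<^sub>R l powr (- \<gamma>) *\<^sub>R \<Phi> l x"]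
    by (simp add: set_integrable_def T.scaleR)
  then show ?thesis by (simp add: wint_apply T.scaleR)
qed

lemma wfam_compose_left: "wfam (norm U * B) (\<lambda>l. U o\<^sub>L \<Phi> l)"
  unfolding wfam_def
proof (intro conjI allI impI)
  fix l :: real assume "l > 0"
  then have "norm U * norm (\<Phi> l) \<le> norm U * (B / (1 + l))"
    using F by (intro mult_left_mono) (auto simp: wfam_def)
  then show "norm (U o\<^sub>L \<Phi> l) \<le> norm U * B / (1 + l)"
    using norm_blinfun_compose[of U "\<Phi> l"] by simp
next
  fix x
  show "continuous_on {0<..} (\<lambda>l. (U o\<^sub>L \<Phi> l) x)"
    using F by (auto simp: wfam_def intro!: bounded_linear.continuous_on[OF blinfun.bounded_linear_right])
qed

lemma wint_commute:
  fixes U :: "'h \<Rightarrow>\<^sub>L 'h"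
  assumes "\<And>l x. l > 0 \<Longrightarrow> blinfun_apply U (\<Phi> l x) = \<Phi> l (U x)"
  shows "blinfun_apply U (wint \<gamma> \<Phi> x) = wint \<gamma> \<Phi> (U x)"
  by (subst wint_linear_image[OF blinfun.bounded_linear_right], subst wint_apply)
    (auto simp: assms intro!: set_lebesgue_integral_cong)

end

lemma wint_compose_left:
  fixes U :: "'h::{banach, second_countable_topology} \<Rightarrow>\<^sub>L 'h"
  assumes "0 < \<gamma>" "\<gamma> < 1" "wfam B \<Phi>"
  shows "U (wint \<gamma> \<Phi> x) = wint \<gamma> (\<lambda>l. U o\<^sub>L \<Phi> l) x"
  by (simp add: wint_linear_image[OF assms blinfun.bounded_linear_right]
      wint_apply[OF assms(1,2) wfam_compose_left[OF assms]])

lemma wfam_add: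
  assumes "wfam B \<Phi>" "wfam C \<Psi>"
  shows "wfam (B + C) (\<lambda>l. \<Phi> l + \<Psi> l)"
  using assms unfolding wfam_def
  by (auto simp: blinfun.add_left add_divide_distrib intro!: continuous_on_add norm_triangle_mono)

lemma wint_add:
  assumes g: "0 < \<gamma>" "\<gamma> < 1" and F: "wfam B \<Phi>" and G: "wfam C \<Psi>"
  shows "wint \<gamma> (\<lambda>l. \<Phi> l + \<Psi> l) = wint \<gamma> \<Phi> + wint \<gamma> \<Psi>"
proof (rule blinfun_eqI)
  fix x
  have "(LINT l:{0<..}|lborel. l powr (- \<gamma>) *\<^sub>R (\<Phi> l x + \<Psi> l x)) =
      (LINT l:{0<..}|lborel. l powr (- \<gamma>) *\<^sub>R \<Phi> l x) + (LINT l:{0<..}|lborel. l powr (- \<gamma>) *\<^sub>R \<Psi> l x)"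
    using set_integral_add(2)[OF wfam_integrable[OF g F] wfam_integrable[OF g G], of x x]
    by (simp add: scaleR_add_right)
  then show "wint \<gamma> (\<lambda>l. \<Phi> l + \<Psi> l) x = (wint \<gamma> \<Phi> + wint \<gamma> \<Psi>) x"
    by (simp add: wint_apply[OF g wfam_add[OF F G]] wint_apply[OF g F] wint_apply[OF g G]
        blinfun.add_left scaleR_add_right)
qed

section \<open>Fractional powers of bounded operators\<close>

definition fpow :: "real \<Rightarrow> ('h::{banach, second_countable_topology} \<Rightarrow>\<^sub>L 'h) \<Rightarrow> 'h \<Rightarrow>\<^sub>L 'h" where
  "fpow \<gamma> L = wint \<gamma> (\<lambda>l. L o\<^sub>L rho L l)"

text \<open>Since \<open>l L rho = 1 - rho\<close>, one has
  \<open>(1 + l) L rho = L rho + 1 - rho\<close>, which is bounded. So \<open>L rho\<close> decays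
  like \<open>1 / (1 + l)\<close> even where \<open>rho\<close> alone is merely bounded.\<close>

lemma wfam_L_rho:
  assumes L: "res_bound (\<lambda>_. M) L"
  shows "wfam (1 + M + norm L * M) (\<lambda>l. L o\<^sub>L rho L l)"
  unfolding wfam_def
proof (intro conjI allI impI)
  fix l :: real assume l: "l > 0"
  have M: "M \<ge> 0" using order_trans[OF norm_ge_zero norm_rho[OF L, of 0]] by simp
  have "norm ((1 + l) *\<^sub>R (L o\<^sub>L rho L l)) \<le> 1 + M + norm L * M"
  proof (rule norm_blinfun_bound)
    fix x
    have r: "norm (rho L l x) \<le> M * norm x" using norm_rho_apply[OF L] l by simp
    have "l *\<^sub>R L (rho L l x) = x - rho L l x"
      using rho_right[OF L, of l x] l by (simp add: eq_diff_eq add.commute)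
    then have "((1 + l) *\<^sub>R (L o\<^sub>L rho L l)) x = L (rho L l x) + (x - rho L l x)"
      by (simp add: blinfun.scaleR_left scaleR_add_left blinfun.add_left)
    also have "norm \<dots> \<le> norm L * (M * norm x) + (norm x + M * norm x)"
      by (intro norm_triangle_mono order_trans[OF norm_triangle_ineq4] add_mono
          order_trans[OF norm_blinfun] mult_left_mono r) auto
    finally show "norm (((1 + l) *\<^sub>R (L o\<^sub>L rho L l)) x) \<le> (1 + M + norm L * M) * norm x"
      by (simp add: algebra_simps)
  qed (use M in auto)
  moreover have "norm ((1 + l) *\<^sub>R (L o\<^sub>L rho L l)) = (1 + l) * norm (L o\<^sub>L rho L l)"
    using l by (subst norm_scaleR) auto
  ultimately show "norm (L o\<^sub>L rho L l) \<le> (1 + M + norm L * M) / (1 + l)"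
    using l by (simp add: pos_le_divide_eq mult.commute)
next
  fix x
  have "continuous_on {0<..} (\<lambda>l. rho L l x)"
    by (rule continuous_on_subset[OF continuous_on_rho[OF L]]) auto
  then show "continuous_on {0<..} (\<lambda>l. (L o\<^sub>L rho L l) x)"
    by (auto intro!: bounded_linear.continuous_on[OF blinfun.bounded_linear_right])
qed

lemma fpow_commute:
  fixes U :: "'h::{banach, second_countable_topology} \<Rightarrow>\<^sub>L 'h"
  assumes L: "res_bound (\<lambda>_. M) L" and g: "0 < \<gamma>" "\<gamma> < 1" and com: "\<And>x. U (L x) = L (U x)"
  shows "U (fpow \<gamma> L x) = fpow \<gamma> L (U x)"
  unfolding fpow_def
  by (rule wint_commute[OF g wfam_L_rho[OF L]]) (simp add: com rho_commute[OF L com])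

lemma res_bound_decay_const:
  assumes L: "res_bound (\<lambda>l. M / (1 + l)) L"
  shows "res_bound (\<lambda>_. M) L"
proof (rule res_bound_mono[OF L])
  fix l :: real assume "l \<ge> 0"
  moreover have "M \<ge> 0" using order_trans[OF norm_ge_zero norm_rho[OF L, of 0]] by simp
  ultimately show "M / (1 + l) \<le> M" by (simp add: divide_le_eq algebra_simps)
qed

lemma wfam_rho:
  assumes L: "res_bound (\<lambda>l. M / (1 + l)) L"
  shows "wfam M (rho L)"
  unfolding wfam_def
  using norm_rho[OF L]
  by (auto intro!: continuous_on_subset[OF continuous_on_rho[OF res_bound_decay_const[OF L]], of "{0<..}"])

lemma norm_rho_rho:
  assumes L: "res_bound (\<lambda>l. M / (1 + l)) L" and L': "res_bound (\<lambda>l. M / (1 + l)) L'" and l: "l \<ge> 0"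
  shows "norm (rho L l (rho L' l x)) \<le> M / (1 + l) * (M / (1 + l) * norm x)"
proof -
  have M: "M \<ge> 0" using order_trans[OF norm_ge_zero norm_rho[OF L, of 0]] by simp
  show ?thesis
    by (intro order_trans[OF norm_rho_apply[OF L l]] mult_left_mono norm_rho_apply[OF L' l])
      (use M l in auto)
qed

lemma wfam_rho_rho:
  fixes L :: "'h::real_normed_vector \<Rightarrow>\<^sub>L 'h"
  assumes L: "res_bound (\<lambda>l. M / (1 + l)) L"
  shows "wfam (M * M) (\<lambda>l. rho L l o\<^sub>L rho L l)"
  unfolding wfam_def
proof (intro conjI allI impI)
  have M: "M \<ge> 0" using order_trans[OF norm_ge_zero norm_rho[OF L, of 0]] by simp
  fix l :: real assume l: "l > 0"
  show "norm (rho L l o\<^sub>L rho L l) \<le> M * M / (1 + l)"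
  proof (rule norm_blinfun_bound)
    fix x :: 'h
    have "M / (1 + l) * (M / (1 + l) * norm x) \<le> M / (1 + l) * (M * norm x)"
      using M l by (intro mult_left_mono mult_right_mono) (auto simp: divide_le_eq algebra_simps)
    then show "norm ((rho L l o\<^sub>L rho L l) x) \<le> M * M / (1 + l) * norm x"
      using norm_rho_rho[OF L L, of l x] l by simp
  qed (use M l in auto)
next
  fix x :: 'h
  have cont: "continuous_on {0<..} (\<lambda>l. rho L l x)" for x
    by (rule continuous_on_subset[OF continuous_on_rho[OF res_bound_decay_const[OF L]]]) auto
  show "continuous_on {0<..} (\<lambda>l. (rho L l o\<^sub>L rho L l) x)"
    unfolding continuous_on
  proof
    fix l :: real assume l: "l \<in> {0<..}"
    define y where "y = rho L l x"
    have M: "M \<ge> 0" using order_trans[OF norm_ge_zero norm_rho[OF L, of 0]] by simp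
    have "((\<lambda>m. M * norm (rho L m x - y)) \<longlongrightarrow> M * norm (y - y)) (at l within {0<..})"
      using cont[of x] l by (intro tendsto_intros) (auto simp: continuous_on y_def)
    then have lim: "((\<lambda>m. M * norm (rho L m x - y)) \<longlongrightarrow> 0) (at l within {0<..})" by simp
    have "\<forall>\<^sub>F m in at l within {0<..}. norm (rho L m (rho L m x - y)) \<le> M * norm (rho L m x - y)"
      unfolding eventually_at_filter
      by (rule always_eventually) (use norm_rho_apply[OF res_bound_decay_const[OF L]] in simp)
    from Lim_null_comparison[OF this lim]
    have "((\<lambda>m. rho L m (rho L m x - y)) \<longlongrightarrow> 0) (at l within {0<..})" .
    moreover have "((\<lambda>m. rho L m y) \<longlongrightarrow> rho L l y) (at l within {0<..})"
      using cont[of y] l by (auto simp: continuous_on)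
    ultimately have "((\<lambda>m. rho L m (rho L m x - y) + rho L m y) \<longlongrightarrow> 0 + rho L l y) (at l within {0<..})"
      by (rule tendsto_add)
    then show "((\<lambda>m. (rho L m o\<^sub>L rho L m) x) \<longlongrightarrow> (rho L l o\<^sub>L rho L l) x) (at l within {0<..})"
      by (simp add: blinfun.diff_right y_def)
  qed
qed

lemma greaterThan_subseteq_atLeast: "{a<..} \<subseteq> {a::real..}"
  by auto

text \<open>Integration by parts: \<open>l powr (1 - \<gamma>) *\<^sub>R rho L l x\<close> vanishes at both ends of the half-line and has
  derivative \<open>l powr (- \<gamma>) *\<^sub>R (rho L l (rho L l x) - \<gamma> *\<^sub>R rho L l x)\<close>.\<close>

lemma wint_rho_rho:
  fixes L :: "'h::{real_inner, banach, second_countable_topology} \<Rightarrow>\<^sub>L 'h"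
  assumes L: "res_bound (\<lambda>l. M / (1 + l)) L" and g: "0 < \<gamma>" "\<gamma> < 1"
  shows "wint \<gamma> (\<lambda>l. rho L l o\<^sub>L rho L l) = \<gamma> *\<^sub>R wint \<gamma> (rho L)"
\<comment> \<open>Pairing with a vector \<open>y\<close> leaves real integrals, to which the
  fundamental theorem on the half-line applies.\<close>
proof (rule blinfun_eqI, rule vector_eq_rdot[THEN iffD1, rule_format])
  fix x y :: 'h
  note Lc = res_bound_decay_const[OF L]
  have M: "M \<ge> 0" using order_trans[OF norm_ge_zero norm_rho[OF L, of 0]] by simp
  define p where "p l = inner (rho L l x) y" for l
  define q where "q l = inner (rho L l (rho L l x)) y" for l
  define F where "F l = l powr (1 - \<gamma>) * p l" for l
  define f where "f l = l powr (- \<gamma>) * q l - \<gamma> * (l powr (- \<gamma>) * p l)" for l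
  have cp: "continuous_on {0<..} p"
    unfolding p_def using wfam_rho[OF L] by (auto simp: wfam_def intro!: continuous_on_inner)
  have cq: "continuous_on {0<..} q"
    unfolding q_def using wfam_rho_rho[OF L] by (auto simp: wfam_def intro!: continuous_on_inner)
  have bl: "bounded_linear (\<lambda>z. inner z y)" by (rule bounded_linear_inner_left)
  have intp: "set_integrable lborel {0<..} (\<lambda>l. l powr (- \<gamma>) * p l)"
    using wfam_integrable[OF g wfam_rho[OF L], of x] integrable_bounded_linear[OF bl]
    by (fastforce simp: set_integrable_def p_def mult.assoc)
  have intq: "set_integrable lborel {0<..} (\<lambda>l. l powr (- \<gamma>) * q l)"
    using wfam_integrable[OF g wfam_rho_rho[OF L], of x] integrable_bounded_linear[OF bl]
    by (fastforce simp: set_integrable_def q_def mult.assoc)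
  have ein: "einterval 0 \<infinity> = {0<..}" by (auto simp: einterval_def)
  have dp: "(p has_real_derivative (q l - p l) / l) (at l)" if l: "l > 0" for l
  proof -
    have "((\<lambda>l. rho L l x) has_vector_derivative - rho L l (rho L l (L x))) (at l)"
      using has_vector_derivative_within_subset[OF rho_has_vector_derivative[OF Lc less_imp_le[OF l], of x] greaterThan_subseteq_atLeast]
        at_within_open[of l "{0<..}"] l by simp
    from bounded_linear.has_vector_derivative[OF bl this]
    have 1: "(p has_vector_derivative inner (- rho L l (rho L l (L x))) y) (at l)"
      by (simp add: p_def[abs_def])
    have "l *\<^sub>R rho L l (rho L l (L x)) = rho L l (l *\<^sub>R L (rho L l x))"
      using rho_L[OF Lc, of l] l by (simp add: blinfun.scaleR_right)
    also have "l *\<^sub>R L (rho L l x) = x - rho L l x"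
      using rho_right[OF Lc, of l x] l by (simp add: eq_diff_eq add.commute)
    finally have "l * inner (- rho L l (rho L l (L x))) y = q l - p l"
      unfolding p_def q_def by (simp add: blinfun.diff_right inner_diff_left flip: inner_scaleR_left)
    then have "inner (- rho L l (rho L l (L x))) y = (q l - p l) / l"
      using l by (simp add: field_simps)
    then show ?thesis using 1 by (simp add: has_real_derivative_iff_has_vector_derivative)
  qed
  have "(LBINT l=0..\<infinity>. f l) = 0 - 0"
  proof (rule interval_integral_FTC_integrable[where F = F])
    fix l :: real assume "0 < ereal l" "ereal l < \<infinity>"
    then have l: "l > 0" by simp
    have "(F has_real_derivative ((1 - \<gamma>) * l powr (1 - \<gamma> - 1)) * p l + (q l - p l) / l * l powr (1 - \<gamma>)) (at l)"
      unfolding F_def by (rule DERIV_mult[OF has_real_derivative_powr[OF l] dp[OF l]])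
    moreover have "l powr (1 - \<gamma>) = l * l powr (- \<gamma>)"
      using l by (simp add: powr_diff powr_minus divide_inverse)
    moreover have "(1 - \<gamma>) * l powr (1 - \<gamma> - 1) * p l + (q l - p l) / l * (l * l powr (- \<gamma>)) = f l"
      using l by (simp add: f_def field_simps)
    ultimately have "(F has_real_derivative f l) (at l)" by simp
    then show "(F has_vector_derivative f l) (at l)"
      by (simp add: has_real_derivative_iff_has_vector_derivative)
    have "isCont p l" "isCont q l"
      using cp cq l by (auto simp: continuous_on_eq_continuous_at)
    then show "isCont f l"
      unfolding f_def using l by (intro continuous_intros) auto
  next
    show "set_integrable lborel (einterval 0 \<infinity>) f"
      unfolding ein f_def using intp intq by (intro set_integral_diff(1) set_integrable_mult_right)
    have pb: "\<bar>p l\<bar> \<le> M / (1 + l) * norm x * norm y" if "l > 0" for l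
    proof -
      have "\<bar>p l\<bar> \<le> norm (rho L l x) * norm y"
        unfolding p_def by (rule Cauchy_Schwarz_ineq2)
      also have "\<dots> \<le> M / (1 + l) * norm x * norm y"
        using norm_rho_apply[OF L, of l x] that by (intro mult_right_mono) auto
      finally show ?thesis .
    qed
    define c where "c = M * norm x * norm y"
    have c: "c \<ge> 0" using M by (simp add: c_def)
    \<comment> \<open>Two bounds for the boundary term: boundedness of the resolvent makes it vanish
      at 0 because \<open>\<gamma> < 1\<close>, and its decay like \<open>1 / l\<close> makes it
      vanish at infinity because \<open>0 < \<gamma>\<close>.\<close>
    have Fb0: "norm (F l) \<le> c * l powr (1 - \<gamma>)" if "l > 0" for l
    proof -
      have "M / (1 + l) \<le> M" using M that by (simp add: divide_le_eq algebra_simps)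
      then have "M / (1 + l) * norm x * norm y \<le> c" unfolding c_def by (intro mult_right_mono) auto
      then have "\<bar>p l\<bar> \<le> c" using pb[OF that] by linarith
      then have "\<bar>p l\<bar> * l powr (1 - \<gamma>) \<le> c * l powr (1 - \<gamma>)" by (intro mult_right_mono) auto
      then show ?thesis by (simp add: F_def abs_mult mult.commute)
    qed
    have Fb1: "norm (F l) \<le> c * l powr (- \<gamma>)" if "l > 0" for l
    proof -
      have "M / (1 + l) \<le> M / l" using M that by (intro divide_left_mono) auto
      then have "M / (1 + l) * norm x * norm y \<le> M / l * norm x * norm y" by (intro mult_right_mono) auto
      then have "\<bar>p l\<bar> \<le> c / l" using pb[OF that] by (simp add: c_def)
      then have "norm (F l) \<le> l powr (1 - \<gamma>) * (c / l)"
        unfolding F_def norm_mult by (intro mult_mono) auto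
      also have "\<dots> = c * l powr (- \<gamma>)"
        using that by (simp add: powr_diff powr_minus field_simps)
      finally show ?thesis .
    qed
    have "((\<lambda>l::real. c * l powr (1 - \<gamma>)) \<longlongrightarrow> c * 0 powr (1 - \<gamma>)) (at_right 0)"
      using g by (intro tendsto_intros tendsto_powr') (auto simp: eventually_at_filter)
    then have lim0: "((\<lambda>l::real. c * l powr (1 - \<gamma>)) \<longlongrightarrow> 0) (at_right 0)" by simp
    have "(F \<longlongrightarrow> 0) (at_right 0)"
      by (rule Lim_null_comparison[OF eventually_at_rightI[OF Fb0, of 0 1] lim0]) auto
    then show "((F \<circ> real_of_ereal) \<longlongrightarrow> 0) (at_right 0)"
      unfolding zero_ereal_def by (simp add: ereal_tendsto_simps)
    have "((\<lambda>l::real. c * l powr (- \<gamma>)) \<longlongrightarrow> c * 0) at_top"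
      using g by (intro tendsto_intros tendsto_neg_powr filterlim_ident) auto
    then have lim1: "((\<lambda>l::real. c * l powr (- \<gamma>)) \<longlongrightarrow> 0) at_top" by simp
    have "(F \<longlongrightarrow> 0) at_top"
      by (rule Lim_null_comparison[OF eventually_mono[OF eventually_gt_at_top[of 0] Fb1] lim1])
    then show "((F \<circ> real_of_ereal) \<longlongrightarrow> 0) (at_left \<infinity>)"
      by (simp add: ereal_tendsto_simps)
  qed simp
  then have "(LINT l:{0<..}|lborel. f l) = 0"
    by (simp add: interval_lebesgue_integral_0_infty)
  then have "(LINT l:{0<..}|lborel. l powr (- \<gamma>) * q l) = \<gamma> * (LINT l:{0<..}|lborel. l powr (- \<gamma>) * p l)"
    unfolding f_def using set_integral_diff(2)[OF intq set_integrable_mult_right[OF intp, of \<gamma>]] by simp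
  then show "inner (wint \<gamma> (\<lambda>l. rho L l o\<^sub>L rho L l) x) y = inner ((\<gamma> *\<^sub>R wint \<gamma> (rho L)) x) y"
    using wint_linear_image[OF g wfam_rho[OF L] bl, of x] wint_linear_image[OF g wfam_rho_rho[OF L] bl, of x]
    by (simp add: p_def q_def blinfun.scaleR_left)
qed

lemma L_wint_rho:
  assumes L: "res_bound (\<lambda>l. M / (1 + l)) L" and g: "0 < \<gamma>" "\<gamma> < 1"
  shows "L (wint \<gamma> (rho L) x) = fpow \<gamma> L x"
  unfolding fpow_def by (rule wint_compose_left[OF g wfam_rho[OF L]])

text \<open>So the derivative of \<open>fpow \<gamma>\<close> at \<open>L\<close> in a commuting direction \<open>D\<close> is \<open>\<gamma> D L\<^sup>-\<^sup>1 L\<^sup>\<gamma>\<close>.\<close>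

lemma fpow_estimate:
  fixes L L' :: "'h::{real_inner, banach, second_countable_topology} \<Rightarrow>\<^sub>L 'h"
  assumes L: "res_bound (\<lambda>l. M / (1 + l)) L" and L': "res_bound (\<lambda>l. M / (1 + l)) L'"
    and com: "\<And>x. L (L' x) = L' (L x)" and g: "0 < \<gamma>" "\<gamma> < 1"
  shows "norm (fpow \<gamma> L' - fpow \<gamma> L - \<gamma> *\<^sub>R ((L' - L) o\<^sub>L wint \<gamma> (rho L))) \<le> M ^ 3 * (norm (L' - L))\<^sup>2"
proof -
  note Lc = res_bound_decay_const[OF L] and Lc' = res_bound_decay_const[OF L']
  define D where "D = L' - L"
  have M: "M \<ge> 0" using order_trans[OF norm_ge_zero norm_rho[OF L, of 0]] by simp
  have comD: "D (L x) = L (D x)" "D (L' x) = L' (D x)" for x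
    by (simp_all add: D_def blinfun.diff_left blinfun.diff_right com)
  \<comment> \<open>\<open>R l\<close> is the second order Taylor remainder of the integrand
    \<open>L rho L l\<close>, whose first order term in direction \<open>D\<close> is
    \<open>D rho rho\<close>. By \<open>wint_rho_rho\<close> its weighted integral is the operator
    to be estimated.\<close>
  define R where "R l = (L' o\<^sub>L rho L' l) + - (L o\<^sub>L rho L l) + - (D o\<^sub>L (rho L l o\<^sub>L rho L l))" for l
  have w1: "wfam (1 + M + norm L' * M) (\<lambda>l. L' o\<^sub>L rho L' l)" by (rule wfam_L_rho[OF Lc'])
  have neg: "- U = (- id_blinfun) o\<^sub>L U" for U :: "'h \<Rightarrow>\<^sub>L 'h"
    by (rule blinfun_eqI) (simp add: blinfun.minus_left)
  note w2 = wfam_compose_left[OF g wfam_L_rho[OF Lc], of "- id_blinfun", folded neg]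
  note w3' = wfam_compose_left[OF g wfam_rho_rho[OF L], of D]
  note w3 = wfam_compose_left[OF g w3', of "- id_blinfun", folded neg]
  have wneg: "wint \<gamma> (\<lambda>l. - \<Phi> l) = - wint \<gamma> \<Phi>" if "wfam B \<Phi>" for B and \<Phi> :: "real \<Rightarrow> 'h \<Rightarrow>\<^sub>L 'h"
    by (rule blinfun_eqI) (simp add: neg[of "\<Phi> _"] wint_compose_left[OF g that, symmetric] blinfun.minus_left)
  have "wint \<gamma> R = wint \<gamma> (\<lambda>l. L' o\<^sub>L rho L' l) + wint \<gamma> (\<lambda>l. - (L o\<^sub>L rho L l))
      + wint \<gamma> (\<lambda>l. - (D o\<^sub>L (rho L l o\<^sub>L rho L l)))"
    unfolding R_def wint_add[OF g wfam_add[OF w1 w2] w3] wint_add[OF g w1 w2] ..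
  also have "\<dots> = fpow \<gamma> L' - fpow \<gamma> L - wint \<gamma> (\<lambda>l. D o\<^sub>L (rho L l o\<^sub>L rho L l))"
    by (simp add: wneg[OF wfam_L_rho[OF Lc]] wneg[OF w3'] fpow_def)
  also have "wint \<gamma> (\<lambda>l. D o\<^sub>L (rho L l o\<^sub>L rho L l)) = \<gamma> *\<^sub>R (D o\<^sub>L wint \<gamma> (rho L))"
    by (rule blinfun_eqI) (simp add: wint_compose_left[OF g wfam_rho_rho[OF L], symmetric] wint_rho_rho[OF L g]
        blinfun.scaleR_left blinfun.scaleR_right)
  finally have eq: "fpow \<gamma> L' - fpow \<gamma> L - \<gamma> *\<^sub>R ((L' - L) o\<^sub>L wint \<gamma> (rho L)) = wint \<gamma> R"
    by (simp add: D_def)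
  have "wfam (M ^ 3 * (norm D)\<^sup>2) R"
    unfolding wfam_def
  proof (intro conjI allI impI)
    show "continuous_on {0<..} (\<lambda>l. R l x)" for x
      using wfam_add[OF wfam_add[OF w1 w2] w3] by (simp add: wfam_def R_def)
    fix l :: real assume l: "l > 0"
    show "norm (R l) \<le> M ^ 3 * (norm D)\<^sup>2 / (1 + l)"
    proof (rule norm_blinfun_bound)
      fix x
      have aux: "w = (x - r) /\<^sub>R l" if "r + l *\<^sub>R w = x" for r w :: 'h
        using that l by auto
      have Lr': "L' (rho L' l x) = (x - rho L' l x) /\<^sub>R l" and Lr: "L (rho L l x) = (x - rho L l x) /\<^sub>R l"
        using l by (intro aux rho_right[OF Lc'] rho_right[OF Lc]; simp)+
      have "L' (rho L' l x) - L (rho L l x) = (rho L l x - rho L' l x) /\<^sub>R l"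
        unfolding Lr Lr' by (simp flip: scaleR_diff_right)
      also have "\<dots> = rho L l (rho L' l (D x))"
        using l by (simp add: rho_difference[OF Lc Lc' com] D_def)
      finally have "R l x = rho L l (rho L' l (D x)) - rho L l (rho L l (D x))"
        by (simp add: R_def blinfun.add_left blinfun.minus_left blinfun.diff_left rho_commute[OF Lc comD(1)] less_imp_le[OF l])
      \<comment> \<open>A second use of the resolvent identity produces the second factor
        \<open>D\<close>. The extra factor \<open>l\<close> is harmless, since three resolvents
        contribute \<open>(1 + l)^-3\<close> while one power suffices for the weighted
        integral.\<close>
      also have "\<dots> = rho L l (- (l *\<^sub>R rho L l (rho L' l (D (D x)))))"
        using rho_difference[OF Lc Lc' com, of l "D x", folded D_def] l
        by (simp flip: blinfun.diff_right) (metis minus_diff_eq)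
      finally have Req: "R l x = - (l *\<^sub>R rho L l (rho L l (rho L' l (D (D x)))))"
        by (simp add: blinfun.minus_right blinfun.scaleR_right)
      define z where "z = D (D x)"
      have z: "norm z \<le> (norm D)\<^sup>2 * norm x"
        unfolding z_def power2_eq_square mult.assoc
        by (intro order_trans[OF norm_blinfun] mult_left_mono norm_blinfun) auto
      have "norm (R l x) = l * norm (rho L l (rho L l (rho L' l z)))"
        unfolding Req using l by (simp add: z_def)
      also have "\<dots> \<le> l * (M / (1 + l) * (M / (1 + l) * (M / (1 + l) * ((norm D)\<^sup>2 * norm x))))"
        using l M by (intro mult_left_mono order_trans[OF norm_rho_apply[OF L]] order_trans[OF norm_rho_apply[OF L']] z) auto
      also have "\<dots> = (M ^ 3 * (norm D)\<^sup>2 / (1 + l) * norm x) * (l / (1 + l)\<^sup>2)"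
        using l by (simp add: power2_eq_square power3_eq_cube field_simps)
      also have "\<dots> \<le> (M ^ 3 * (norm D)\<^sup>2 / (1 + l) * norm x) * 1"
        using l M by (intro mult_left_mono) (auto simp: divide_le_eq power2_eq_square algebra_simps)
      finally show "norm (R l x) \<le> M ^ 3 * (norm D)\<^sup>2 / (1 + l) * norm x" by simp
    qed (use M l in auto)
  qed
  from norm_wint[OF g this] show ?thesis unfolding eq D_def .
qed

text \<open>The quadratic remainder divided by \<open>t - s\<close> is at most a constant times
  \<open>norm (\<Lambda> t - \<Lambda> s) * norm (q t)\<close>, where the quotient \<open>q\<close>
  converges and the other factor tends to 0. A single \<open>M\<close> along the whole path is what
  makes the constant uniform.\<close>

lemma fpow_path_derivative:
  fixes \<Lambda> :: "real \<Rightarrow> 'h::{real_inner, banach, second_countable_topology} \<Rightarrow>\<^sub>L 'h"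
  assumes res: "\<And>s. s \<in> S \<Longrightarrow> res_bound (\<lambda>l. M / (1 + l)) (\<Lambda> s)"
    and com: "\<And>s t x. s \<in> S \<Longrightarrow> t \<in> S \<Longrightarrow> \<Lambda> s (\<Lambda> t x) = \<Lambda> t (\<Lambda> s x)"
    and g: "0 < \<gamma>" "\<gamma> < 1" and s: "s \<in> S"
    and der: "(\<Lambda> has_vector_derivative D) (at s within S)"
  shows "((\<lambda>s. fpow \<gamma> (\<Lambda> s)) has_vector_derivative \<gamma> *\<^sub>R (D o\<^sub>L wint \<gamma> (rho (\<Lambda> s)))) (at s within S)"
proof -
  define Z where "Z = wint \<gamma> (rho (\<Lambda> s))"
  define q where "q t = (\<Lambda> t - \<Lambda> s) /\<^sub>R (t - s)" for t
  define e where "e t = (fpow \<gamma> (\<Lambda> t) - fpow \<gamma> (\<Lambda> s)) /\<^sub>R (t - s) - \<gamma> *\<^sub>R (q t o\<^sub>L Z)" for t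
  have q: "(q \<longlongrightarrow> D) (at s within S)"
    using der unfolding has_vector_derivative_iff_tendsto q_def .
  have "(\<Lambda> \<longlongrightarrow> \<Lambda> s) (at s within S)"
    using has_vector_derivative_continuous[OF der] by (simp add: continuous_within)
  then have L0: "((\<lambda>t. \<Lambda> t - \<Lambda> s) \<longlongrightarrow> 0) (at s within S)" by (simp add: LIM_zero)
  have bound: "norm (e t) \<le> M ^ 3 * (norm (\<Lambda> t - \<Lambda> s) * norm (q t))" if "t \<in> S" "t \<noteq> s" for t
  proof -
    have "(\<Lambda> t - \<Lambda> s) o\<^sub>L Z = (t - s) *\<^sub>R (q t o\<^sub>L Z)"
      by (rule blinfun_eqI) (use that in \<open>simp add: q_def blinfun.scaleR_left\<close>)
    then have "e t = (fpow \<gamma> (\<Lambda> t) - fpow \<gamma> (\<Lambda> s) - \<gamma> *\<^sub>R ((\<Lambda> t - \<Lambda> s) o\<^sub>L Z)) /\<^sub>R (t - s)"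
      using that by (simp add: e_def scaleR_diff_right)
    then have "norm (e t) = norm (fpow \<gamma> (\<Lambda> t) - fpow \<gamma> (\<Lambda> s) - \<gamma> *\<^sub>R ((\<Lambda> t - \<Lambda> s) o\<^sub>L Z)) / \<bar>t - s\<bar>"
      by (simp add: divide_inverse mult.commute)
    also have "\<dots> \<le> M ^ 3 * (norm (\<Lambda> t - \<Lambda> s))\<^sup>2 / \<bar>t - s\<bar>"
      unfolding Z_def using that s
      by (intro divide_right_mono fpow_estimate res com g) auto
    also have "\<dots> = M ^ 3 * (norm (\<Lambda> t - \<Lambda> s) * norm (q t))"
      by (simp add: q_def power2_eq_square divide_inverse mult_ac)
    finally show ?thesis .
  qed
  have "((\<lambda>t. M ^ 3 * (norm (\<Lambda> t - \<Lambda> s) * norm (q t))) \<longlongrightarrow> M ^ 3 * (norm (0::'h \<Rightarrow>\<^sub>L 'h) * norm D)) (at s within S)"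
    by (intro tendsto_intros L0 q)
  then have lim: "((\<lambda>t. M ^ 3 * (norm (\<Lambda> t - \<Lambda> s) * norm (q t))) \<longlongrightarrow> 0) (at s within S)" by simp
  have "(e \<longlongrightarrow> 0) (at s within S)"
    by (rule Lim_null_comparison[OF _ lim]) (use bound in \<open>auto simp: eventually_at_filter\<close>)
  moreover have "((\<lambda>t. \<gamma> *\<^sub>R (q t o\<^sub>L Z)) \<longlongrightarrow> \<gamma> *\<^sub>R (D o\<^sub>L Z)) (at s within S)"
    by (intro tendsto_intros q bounded_bilinear.tendsto[OF bounded_bilinear_blinfun_compose])
  ultimately have "((\<lambda>t. e t + \<gamma> *\<^sub>R (q t o\<^sub>L Z)) \<longlongrightarrow> 0 + \<gamma> *\<^sub>R (D o\<^sub>L Z)) (at s within S)"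
    by (rule tendsto_add)
  then show ?thesis by (simp add: has_vector_derivative_iff_tendsto e_def Z_def)
qed

text \<open>With \<open>e \<le> 1\<close> the same constant serves for the identity, hence for every
  point of the segment from the identity to \<open>L\<close> and, scaled by \<open>1 + l\<close>,
  for \<open>1 + l L\<close>.\<close>

definition coercive :: "real \<Rightarrow> ('h::real_inner \<Rightarrow>\<^sub>L 'h) \<Rightarrow> bool" where
  "coercive e L \<longleftrightarrow> 0 < e \<and> e \<le> 1 \<and> (\<forall>x. e * (norm x)\<^sup>2 \<le> inner (L x) x)"

lemma res_bound_coercive:
  fixes L :: "'h::{real_inner, banach} \<Rightarrow>\<^sub>L 'h"
  assumes "coercive e L"
  shows "res_bound (\<lambda>l. (1 / e) / (1 + l)) L"
proof (rule res_boundI)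
  fix l :: real assume l: "l \<ge> 0"
  have e: "0 < e" "e \<le> 1" using assms by (auto simp: coercive_def)
  have "e * (1 + l) * (norm x)\<^sup>2 \<le> inner (shifted L l x) x" for x
  proof -
    have "l * (e * (norm x)\<^sup>2) \<le> l * inner (L x) x"
      using assms l by (intro mult_left_mono) (auto simp: coercive_def)
    moreover have "e * (norm x)\<^sup>2 \<le> 1 * (norm x)\<^sup>2" using e by (intro mult_right_mono) auto
    moreover have "(norm x)\<^sup>2 = inner x x" by (rule power2_norm_eq_inner)
    ultimately show ?thesis
      by (simp add: shifted_apply inner_add_left algebra_simps)
  qed
  moreover have "0 < e * (1 + l)" using e l by simp
  ultimately have "\<exists>R. inverse_pair (shifted L l) R \<and> norm R \<le> 1 / (e * (1 + l))"
    by (intro coercive_inverse)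
  then show "\<exists>R. inverse_pair (shifted L l) R \<and> norm R \<le> (1 / e) / (1 + l)" by simp
qed

text \<open>The value at the starting point of the segment, which supplies the initial condition of
  the differential equations below.\<close>

lemma fpow_id:
  assumes g: "0 < \<gamma>" "\<gamma> < 1"
  shows "fpow \<gamma> (id_blinfun :: 'h::{real_inner, banach, second_countable_topology} \<Rightarrow>\<^sub>L 'h) = id_blinfun"
proof (rule blinfun_eqI)
  fix x :: 'h
  have r: "res_bound (\<lambda>l. (1 / 1) / (1 + l)) (id_blinfun :: 'h \<Rightarrow>\<^sub>L 'h)"
    by (rule res_bound_coercive) (simp add: coercive_def power2_norm_eq_inner)
  note rc = res_bound_decay_const[OF r]
  have rho: "rho id_blinfun l x = (1 / (1 + l)) *\<^sub>R x" if "l > 0" for l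
  proof (rule rho_eqI[OF rc])
    have "(1 / (1 + l)) *\<^sub>R x + l *\<^sub>R ((1 / (1 + l)) *\<^sub>R x) = ((1 / (1 + l)) + l * (1 / (1 + l))) *\<^sub>R x"
      by (simp add: scaleR_add_left)
    also have "(1 / (1 + l)) + l * (1 / (1 + l)) = 1" using that by (simp add: field_simps)
    finally show "(1 / (1 + l)) *\<^sub>R x + l *\<^sub>R id_blinfun ((1 / (1 + l)) *\<^sub>R x) = x" by simp
  qed (use that in simp)
  have "(LINT l:{0<..}|lborel. l powr (- \<gamma>) *\<^sub>R (id_blinfun o\<^sub>L rho id_blinfun l) x) =
      (LINT l:{0<..}|lborel. (l powr (- \<gamma>) / (1 + l)) *\<^sub>R x)"
    by (rule set_lebesgue_integral_cong) (auto simp: rho divide_inverse)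
  also have "\<dots> = (LINT l:{0<..}|lborel. l powr (- \<gamma>) / (1 + l)) *\<^sub>R x"
    using kern_integrable[OF g]
    unfolding set_lebesgue_integral_def set_integrable_def
    by (subst integral_scaleR_left[symmetric]) auto
  also have "\<dots> = (pi / sin (pi * \<gamma>)) *\<^sub>R x" by (simp add: kern_integral[OF g])
  finally show "fpow \<gamma> id_blinfun x = id_blinfun x"
    using sin_pi_pos[OF g] by (simp add: fpow_def wint_apply[OF g wfam_L_rho[OF rc]])
qed

section \<open>The law of exponents and rotations\<close>

text \<open>Along the segment from \<open>I\<close> to \<open>L\<close> the products of fractional powers with exponents adding up to 1 satisfy
  the same linear differential equation \<open>L\<^sub>s W' = (L - I) W\<close> as the segment itself.\<close>

context
  fixes L :: "'h::{real_inner, banach, second_countable_topology} \<Rightarrow>\<^sub>L 'h" and e :: real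
  assumes L: "coercive e L"
begin

definition seg :: "real \<Rightarrow> 'h \<Rightarrow>\<^sub>L 'h" where
  "seg s = id_blinfun + s *\<^sub>R (L - id_blinfun)"

lemma seg_apply: "seg s x = x + s *\<^sub>R (L x - x)"
  by (simp add: seg_def blinfun.add_left blinfun.scaleR_left blinfun.diff_left)

lemma seg_0: "seg 0 = id_blinfun" and seg_1: "seg 1 = L"
  by (simp_all add: seg_def)

lemma seg_commute: "seg s (seg t x) = seg t (seg s x)"
  by (simp add: seg_apply blinfun.add_right blinfun.scaleR_right blinfun.diff_right algebra_simps)

lemma seg_coercive:
  assumes "s \<in> {0..1}"
  shows "coercive e (seg s)"
proof -
  have e: "0 < e" "e \<le> 1" using L by (auto simp: coercive_def)
  have "e * (norm x)\<^sup>2 \<le> inner (seg s x) x" for x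
  proof -
    have "(1 - s) * (e * (norm x)\<^sup>2) \<le> (1 - s) * (1 * (norm x)\<^sup>2)"
      using assms e by (intro mult_left_mono mult_right_mono) auto
    moreover have "s * (e * (norm x)\<^sup>2) \<le> s * inner (L x) x"
      using assms L by (intro mult_left_mono) (auto simp: coercive_def)
    moreover have "inner (seg s x) x = (1 - s) * (norm x)\<^sup>2 + s * inner (L x) x"
      by (simp add: seg_apply inner_add_left inner_diff_left power2_norm_eq_inner algebra_simps)
    ultimately show ?thesis by (simp add: algebra_simps)
  qed
  then show ?thesis using e by (simp add: coercive_def)
qed

lemma seg_res: "s \<in> {0..1} \<Longrightarrow> res_bound (\<lambda>l. (1 / e) / (1 + l)) (seg s)"
  by (intro res_bound_coercive seg_coercive)

lemma seg_derivative: "(seg has_vector_derivative (L - id_blinfun)) (at s within S)"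
  unfolding seg_def by (auto intro!: derivative_eq_intros)

text \<open>With \<open>J s\<close> the inverse of \<open>seg s\<close> and
  \<open>D = L - 1\<close>, the product \<open>J W\<close> has derivative
  \<open>J W' - J D J W\<close>. The equation gives \<open>W' = J D W\<close>, and \<open>J\<close>
  commutes with \<open>D\<close>, so \<open>J W\<close> is constant and equals its value at 0, the
  identity.\<close>

lemma seg_linear_ode:
  fixes W :: "real \<Rightarrow> 'h \<Rightarrow>\<^sub>L 'h"
  assumes W0: "W 0 = id_blinfun"
    and W: "\<And>s. s \<in> {0..1} \<Longrightarrow> (W has_vector_derivative W' s) (at s within {0..1})"
    and ode: "\<And>s x. s \<in> {0..1} \<Longrightarrow> seg s (W' s x) = (L - id_blinfun) (W s x)"
  shows "W 1 = L"
proof -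
  have e: "e > 0" using L by (auto simp: coercive_def)
  define D where "D = L - id_blinfun"
  define J where "J s = rinv (seg s)" for s
  have Jex: "inverse_pair (seg s) (J s) \<and> norm (J s) \<le> 1 / e" if s: "s \<in> {0..1}" for s
    using coercive_inverse[of e "seg s"] seg_coercive[OF s] rinv_eq unfolding coercive_def J_def by metis
  have J1: "J s (seg s x) = x" "seg s (J s x) = x" if "s \<in> {0..1}" for s x
    using Jex[OF that] by (auto simp: inverse_pair_def)
  have Jn: "norm (J s x) \<le> (1 / e) * norm x" if "s \<in> {0..1}" for s x
    using Jex[OF that] by (intro order_trans[OF norm_blinfun] mult_right_mono) auto
  have Jcom: "J s (U x) = U (J s x)" if "s \<in> {0..1}" "\<And>y. U (seg s y) = seg s (U y)" for s x and U :: "'h \<Rightarrow>\<^sub>L 'h"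
    using J1[OF that(1)] that(2) by metis
  have Dseg: "D (seg s x) = seg s (D x)" for s x
    by (simp add: D_def seg_apply blinfun.add_right blinfun.scaleR_right blinfun.diff_right blinfun.diff_left algebra_simps)
  have JD: "J s (D x) = D (J s x)" if "s \<in> {0..1}" for s x
    by (rule Jcom[OF that Dseg])
  have Jdiff: "J t x - J s x = - ((t - s) *\<^sub>R J t (D (J s x)))" if "t \<in> {0..1}" "s \<in> {0..1}" for s t x
  proof -
    have "J t x - J s x = J t (seg s (J s x)) - J t (seg t (J s x))"
      using J1 that by simp
    also have "\<dots> = J t (- ((t - s) *\<^sub>R D (J s x)))"
      by (simp add: seg_apply D_def blinfun.diff_left algebra_simps flip: blinfun.diff_right)
    finally show ?thesis by (simp add: blinfun.minus_right blinfun.scaleR_right)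
  qed
  have Jder: "(J has_vector_derivative - (J s o\<^sub>L (D o\<^sub>L J s))) (at s within {0..1})" if s: "s \<in> {0..1}" for s
  proof (rule has_vector_derivative_quadraticI)
    fix t :: real assume t: "t \<in> {0..1}"
    define c where "c = 1 / e"
    have c: "c > 0" using e by (simp add: c_def)
    show "norm (J t - J s - (t - s) *\<^sub>R (- (J s o\<^sub>L (D o\<^sub>L J s)))) \<le> (c * (norm D * (c * (norm D * c)))) * (t - s)\<^sup>2"
    proof (rule norm_blinfun_bound)
      fix x
      define y where "y = D (J s x)"
      have "(J t - J s - (t - s) *\<^sub>R (- (J s o\<^sub>L (D o\<^sub>L J s)))) x = - ((t - s) *\<^sub>R (J t y - J s y))"
        using Jdiff[OF t s, of x]
        by (simp add: blinfun.diff_left blinfun.minus_left blinfun.scaleR_left blinfun.add_left y_def scaleR_diff_right)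
      also have "J t y - J s y = - ((t - s) *\<^sub>R J t (D (J s y)))" by (rule Jdiff[OF t s])
      finally have "norm ((J t - J s - (t - s) *\<^sub>R (- (J s o\<^sub>L (D o\<^sub>L J s)))) x) = (t - s)\<^sup>2 * norm (J t (D (J s y)))"
        by (simp add: power2_eq_square abs_mult_self_eq flip: mult.assoc abs_mult)
      also have "\<dots> \<le> (t - s)\<^sup>2 * (c * (norm D * (c * (norm D * (c * norm x)))))"
        unfolding y_def c_def using c
        by (intro mult_left_mono order_trans[OF Jn[OF t]] order_trans[OF Jn[OF s]] order_trans[OF norm_blinfun[of D]] order_refl) (auto simp: c_def)
      finally show "norm ((J t - J s - (t - s) *\<^sub>R (- (J s o\<^sub>L (D o\<^sub>L J s)))) x) \<le> (c * (norm D * (c * (norm D * c)))) * (t - s)\<^sup>2 * norm x"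
        by (simp add: mult_ac)
    qed (use c in simp)
  qed
  have Vder: "((\<lambda>s. J s o\<^sub>L W s) has_vector_derivative 0) (at s within {0..1})" if s: "s \<in> {0..1}" for s
  proof -
    have "(J s o\<^sub>L W' s) + (- (J s o\<^sub>L (D o\<^sub>L J s)) o\<^sub>L W s) = 0"
    proof (rule blinfun_eqI)
      fix x
      have "W' s x = J s (D (W s x))" using ode[OF s, of x] J1[OF s] by (metis D_def)
      then show "((J s o\<^sub>L W' s) + (- (J s o\<^sub>L (D o\<^sub>L J s)) o\<^sub>L W s)) x = blinfun_apply 0 x"
        by (simp add: blinfun.add_left blinfun.minus_left JD[OF s])
    qed
    then show ?thesis
      using bounded_bilinear.has_vector_derivative[OF bounded_bilinear_blinfun_compose Jder[OF s] W[OF s]] by simp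
  qed
  obtain c where c: "\<And>s. s \<in> {0..1} \<Longrightarrow> (J s o\<^sub>L W s) = c"
    using has_vector_derivative_zero_constant[of "{0..1::real}" "\<lambda>s. J s o\<^sub>L W s"] Vder by (auto simp: convex_real_interval)
  show "W 1 = L"
  proof (rule blinfun_eqI)
    fix x
    have "J 1 (W 1 x) = J 0 (W 0 x)"
      using c[of 0] c[of 1] by (metis atLeastAtMost_iff blinfun_apply_blinfun_compose order_refl zero_le_one)
    also have "\<dots> = x" using J1(1)[of 0 x] by (simp add: W0 seg_0)
    finally have "seg 1 (J 1 (W 1 x)) = seg 1 x" by simp
    then show "W 1 x = L x" using J1(2)[of 1] by (simp add: seg_1)
  qed
qed

context
  fixes \<gamma> :: real assumes g: "0 < \<gamma>" "\<gamma> < 1"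
begin

lemma fpow_seg_derivative:
  assumes "s \<in> {0..1}"
  shows "((\<lambda>s. fpow \<gamma> (seg s)) has_vector_derivative \<gamma> *\<^sub>R ((L - id_blinfun) o\<^sub>L wint \<gamma> (rho (seg s)))) (at s within {0..1})"
  by (rule fpow_path_derivative[OF seg_res seg_commute g assms seg_derivative])

lemma fpow_seg_commute:
  assumes "s \<in> {0..1}"
  shows "seg s (fpow \<gamma> (seg s) x) = fpow \<gamma> (seg s) (seg s x)"
    and "(L - id_blinfun) (fpow \<gamma> (seg s) x) = fpow \<gamma> (seg s) ((L - id_blinfun) x)"
proof -
  note r = res_bound_decay_const[OF seg_res[OF assms]]
  show "seg s (fpow \<gamma> (seg s) x) = fpow \<gamma> (seg s) (seg s x)"
    by (rule fpow_commute[OF r g]) simp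
  show "(L - id_blinfun) (fpow \<gamma> (seg s) x) = fpow \<gamma> (seg s) ((L - id_blinfun) x)"
    by (rule fpow_commute[OF r g])
      (simp add: seg_apply blinfun.add_right blinfun.scaleR_right blinfun.diff_right blinfun.diff_left algebra_simps)
qed

lemma seg_fpow_derivative:
  assumes "s \<in> {0..1}"
  shows "seg s ((\<gamma> *\<^sub>R ((L - id_blinfun) o\<^sub>L wint \<gamma> (rho (seg s)))) x) = \<gamma> *\<^sub>R (L - id_blinfun) (fpow \<gamma> (seg s) x)"
proof -
  have "seg s ((L - id_blinfun) y) = (L - id_blinfun) (seg s y)" for y
    by (simp add: seg_apply blinfun.add_right blinfun.scaleR_right blinfun.diff_right blinfun.diff_left algebra_simps)
  then show ?thesis
    by (simp add: blinfun.scaleR_left blinfun.scaleR_right L_wint_rho[OF seg_res[OF assms] g])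
qed

end

lemma fpow_prod2_coercive:
  assumes g: "0 < \<beta>" "0 < \<gamma>" "\<beta> + \<gamma> = 1"
  shows "fpow \<beta> L (fpow \<gamma> L x) = L x"
proof -
  have b1: "\<beta> < 1" "\<gamma> < 1" using g by auto
  define W where "W s = fpow \<beta> (seg s) o\<^sub>L fpow \<gamma> (seg s)" for s
  define B where "B s = \<beta> *\<^sub>R ((L - id_blinfun) o\<^sub>L wint \<beta> (rho (seg s)))" for s
  define C where "C s = \<gamma> *\<^sub>R ((L - id_blinfun) o\<^sub>L wint \<gamma> (rho (seg s)))" for s
  have "W 1 = L"
  proof (rule seg_linear_ode)
    show "W 0 = id_blinfun" by (rule blinfun_eqI) (simp add: W_def seg_0 fpow_id g b1)
    fix s :: real assume s: "s \<in> {0..1}"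
    show "(W has_vector_derivative (fpow \<beta> (seg s) o\<^sub>L C s) + (B s o\<^sub>L fpow \<gamma> (seg s))) (at s within {0..1})"
      unfolding W_def B_def C_def
      by (intro bounded_bilinear.has_vector_derivative[OF bounded_bilinear_blinfun_compose] fpow_seg_derivative g b1 s)
    fix x
    have "seg s (((fpow \<beta> (seg s) o\<^sub>L C s) + (B s o\<^sub>L fpow \<gamma> (seg s))) x) =
      fpow \<beta> (seg s) (seg s (C s x)) + seg s (B s (fpow \<gamma> (seg s) x))"
      by (simp add: blinfun.add_left blinfun.add_right fpow_seg_commute[OF g(1) b1(1) s])
    also have "\<dots> = (L - id_blinfun) ((\<gamma> + \<beta>) *\<^sub>R fpow \<beta> (seg s) (fpow \<gamma> (seg s) x))"
      unfolding B_def C_def seg_fpow_derivative[OF g(1) b1(1) s] seg_fpow_derivative[OF g(2) b1(2) s]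
      by (simp only: blinfun.scaleR_right blinfun.add_right fpow_seg_commute(2)[OF g(1) b1(1) s] scaleR_add_left)
    finally show "seg s (((fpow \<beta> (seg s) o\<^sub>L C s) + (B s o\<^sub>L fpow \<gamma> (seg s))) x) = (L - id_blinfun) (W s x)"
      using g by (simp add: W_def add.commute)
  qed
  then show ?thesis by (metis W_def blinfun_apply_blinfun_compose seg_1)
qed

text \<open>Exponents with sum 1 are the case in which the product can be compared with the segment
  itself. The third factor is there so that the law for \<open>\<beta> + \<gamma> < 1\<close>
  follows by cancelling \<open>\<delta> = 1 - \<beta> - \<gamma>\<close>.\<close>

lemma fpow_prod3_coercive:
  assumes g: "0 < \<beta>" "0 < \<gamma>" "0 < \<delta>" "\<beta> + \<gamma> + \<delta> = 1"
  shows "fpow \<beta> L (fpow \<gamma> L (fpow \<delta> L x)) = L x"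
proof -
  have b1: "\<beta> < 1" "\<gamma> < 1" "\<delta> < 1" using g by auto
  define W where "W s = fpow \<beta> (seg s) o\<^sub>L (fpow \<gamma> (seg s) o\<^sub>L fpow \<delta> (seg s))" for s
  define B where "B s = \<beta> *\<^sub>R ((L - id_blinfun) o\<^sub>L wint \<beta> (rho (seg s)))" for s
  define C where "C s = \<gamma> *\<^sub>R ((L - id_blinfun) o\<^sub>L wint \<gamma> (rho (seg s)))" for s
  define D where "D s = \<delta> *\<^sub>R ((L - id_blinfun) o\<^sub>L wint \<delta> (rho (seg s)))" for s
  define W' where "W' s = (fpow \<beta> (seg s) o\<^sub>L ((fpow \<gamma> (seg s) o\<^sub>L D s) + (C s o\<^sub>L fpow \<delta> (seg s)))) +
        (B s o\<^sub>L (fpow \<gamma> (seg s) o\<^sub>L fpow \<delta> (seg s)))" for s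
  have "W 1 = L"
  proof (rule seg_linear_ode)
    show "W 0 = id_blinfun" by (rule blinfun_eqI) (simp add: W_def seg_0 fpow_id g b1)
    fix s :: real assume s: "s \<in> {0..1}"
    show "(W has_vector_derivative W' s) (at s within {0..1})"
      unfolding W_def B_def C_def D_def W'_def
      by (intro bounded_bilinear.has_vector_derivative[OF bounded_bilinear_blinfun_compose] fpow_seg_derivative g b1 s)
    fix x
    note cb = fpow_seg_commute[OF g(1) b1(1) s] and cc = fpow_seg_commute[OF g(2) b1(2) s]
    have "seg s (W' s x) = fpow \<beta> (seg s) (fpow \<gamma> (seg s) (seg s (D s x))) + fpow \<beta> (seg s) (seg s (C s (fpow \<delta> (seg s) x)))
      + seg s (B s (fpow \<gamma> (seg s) (fpow \<delta> (seg s) x)))"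
      by (simp add: W'_def blinfun.add_left blinfun.add_right cb cc)
    also have "\<dots> = (L - id_blinfun) ((\<delta> + \<gamma> + \<beta>) *\<^sub>R fpow \<beta> (seg s) (fpow \<gamma> (seg s) (fpow \<delta> (seg s) x)))"
      unfolding B_def C_def D_def seg_fpow_derivative[OF g(1) b1(1) s] seg_fpow_derivative[OF g(2) b1(2) s] seg_fpow_derivative[OF g(3) b1(3) s]
      by (simp only: blinfun.scaleR_right blinfun.add_right cb(2) cc(2) scaleR_add_left)
    finally show "seg s (W' s x) = (L - id_blinfun) (W s x)"
      using g by (simp add: W_def add.commute add.left_commute)
  qed
  then show ?thesis by (metis W_def blinfun_apply_blinfun_compose seg_1)
qed

end

text \<open>The operator \<open>1 + l e^(-is) L\<close> equals \<open>e^(-is) H\<close> with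
  \<open>H = e^(is) + l L\<close>, and \<open>H\<close> is coercive with constant \<open>l e\<close>
  because \<open>cos s \<ge> 0\<close>. This degenerates as \<open>l\<close> tends to 0, where
  \<open>H\<close> is instead close to a rotation; a weighted sum of both estimates covers all
  \<open>l\<close>.\<close>

lemma res_bound_rotated:
  fixes L :: "'h::complex_hilbert_space \<Rightarrow>\<^sub>L 'h"
  assumes L: "coercive e L" and s: "\<bar>s\<bar> \<le> pi / 2"
  shows "res_bound (\<lambda>l. ((norm L + 1 + e) / e) / (1 + l)) (scal (cis (- s)) o\<^sub>L L)"
proof (rule res_boundI)
  fix l :: real assume l: "l \<ge> 0"
  have e: "0 < e" "e \<le> 1" using L by (auto simp: coercive_def)
  define n where "n = norm L + 1 + e"
  have n: "n > 0" using e by (simp add: n_def add_nonneg_pos)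
  define H where "H = scal (cis s) + l *\<^sub>R L"
  have GH: "shifted (scal (cis (- s)) o\<^sub>L L) l x = cis (- s) *\<^sub>C H x" for x
    by (simp add: shifted_apply H_def blinfun.add_left blinfun.scaleR_left scaleC_add_right scaleC_scaleC scaleC_scaleR
        cis_mult scaleC_one)
  have cs: "cos s \<ge> 0" using s by (intro cos_ge_zero) auto
  have Hc: "(l * e) * (norm x)\<^sup>2 \<le> inner (H x) x" for x
  proof -
    have "l * (e * (norm x)\<^sup>2) \<le> l * inner (L x) x"
      using L l by (intro mult_left_mono) (auto simp: coercive_def)
    moreover have "inner (cis s *\<^sub>C x) x = cos s * (norm x)\<^sup>2"
      by (simp add: Re_cinner_rotate[symmetric] cinner_self)
    moreover have "0 \<le> cos s * (norm x)\<^sup>2" using cs by simp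
    ultimately show ?thesis
      by (simp add: H_def blinfun.add_left blinfun.scaleR_left inner_add_left)
  qed
  have "\<exists>R. inverse_pair (shifted (scal (cis (- s)) o\<^sub>L L) l) R \<and> norm R \<le> 1 / (e * (1 + l) / n)"
  proof (rule bij_bounded_below_inverse)
    show "\<exists>x. shifted (scal (cis (- s)) o\<^sub>L L) l x = y" for y
    proof (cases "l = 0")
      case True then show ?thesis by (auto simp: shifted_apply)
    next
      case False
      then have "0 < l * e" using l e by simp
      from coercive_inverse[OF this Hc] obtain R where "inverse_pair H R" by blast
      then have "H (R (cis s *\<^sub>C y)) = cis s *\<^sub>C y" by (simp add: inverse_pair_def)
      then have "shifted (scal (cis (- s)) o\<^sub>L L) l (R (cis s *\<^sub>C y)) = y"
        unfolding GH by (simp add: scaleC_scaleC cis_mult scaleC_one)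
      then show ?thesis by blast
    qed
    show "0 < e * (1 + l) / n" using e l n by simp
    fix x
    have 1: "l * e * norm x \<le> norm (H x)" by (rule coercive_bounded_below[OF Hc])
    have "norm x = norm (cis s *\<^sub>C x)" by (simp add: norm_scaleC)
    also have "cis s *\<^sub>C x = H x - l *\<^sub>R L x" by (simp add: H_def blinfun.add_left blinfun.scaleR_left)
    also have "norm \<dots> \<le> norm (H x) + l * (norm L * norm x)"
      using l by (intro order_trans[OF norm_triangle_ineq4] add_mono) (auto intro!: mult_left_mono norm_blinfun)
    finally have 2: "norm x - l * (norm L * norm x) \<le> norm (H x)" by simp
    \<comment> \<open>The weights \<open>norm L + 1\<close> and \<open>e\<close> are chosen so that
      the terms with \<open>norm L\<close> cancel on the left, leaving exactly
      \<open>e (1 + l) norm x\<close>.\<close>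
    have "(norm L + 1) * (l * e * norm x) + e * (norm x - l * (norm L * norm x)) \<le> (norm L + 1) * norm (H x) + e * norm (H x)"
      using 1 2 e by (intro add_mono mult_left_mono) auto
    then have "e * (1 + l) * norm x \<le> n * norm (H x)" by (simp add: n_def algebra_simps)
    then show "e * (1 + l) / n * norm x \<le> norm (shifted (scal (cis (- s)) o\<^sub>L L) l x)"
      using n by (simp add: GH norm_scaleC field_simps)
  qed
  then show "\<exists>R. inverse_pair (shifted (scal (cis (- s)) o\<^sub>L L) l) R \<and> norm R \<le> ((norm L + 1 + e) / e) / (1 + l)"
    by (simp add: n_def)
qed

lemma scal_bounded_linear: "bounded_linear (scal :: complex \<Rightarrow> 'h::complex_hilbert_space \<Rightarrow>\<^sub>L 'h)"
proof (rule bounded_linear_intro[where K = 1])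
  show "scal (c + d) = scal c + (scal d :: 'h \<Rightarrow>\<^sub>L 'h)" for c d
    by (rule blinfun_eqI) (simp add: blinfun.add_left scaleC_add_left)
  show "scal (r *\<^sub>R c) = r *\<^sub>R (scal c :: 'h \<Rightarrow>\<^sub>L 'h)" for r c
    by (rule blinfun_eqI) (simp only: blinfun.scaleR_left scaleR_scaleC[of r "c *\<^sub>C _"] scaleC_scaleC scaleR_conv_of_real scal_apply)
  show "norm (scal c :: 'h \<Rightarrow>\<^sub>L 'h) \<le> norm c * 1" for c
    by (rule norm_blinfun_bound) (auto simp: norm_scaleC)
qed

text \<open>\<open>s \<mapsto> (e\<^sup>-\<^sup>i\<^sup>s L)\<^sup>\<gamma>\<close> solves \<open>P' = -i\<gamma> P\<close>.\<close>

lemma fpow_rotate: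
  fixes L :: "'h::{complex_hilbert_space, second_countable_topology} \<Rightarrow>\<^sub>L 'h"
  assumes L: "coercive e L" and cl: "clinear L" and g: "0 < \<gamma>" "\<gamma> < 1" and s: "\<bar>s\<bar> \<le> pi / 2"
  shows "fpow \<gamma> (scal (cis (- s)) o\<^sub>L L) x = cis (- (\<gamma> * s)) *\<^sub>C fpow \<gamma> L x"
proof -
  define S where "S = {- (pi / 2)..pi / 2}"
  define \<Lambda> where "\<Lambda> s = scal (cis (- s)) o\<^sub>L L" for s
  define P where "P s = fpow \<gamma> (\<Lambda> s)" for s
  have res: "res_bound (\<lambda>l. ((norm L + 1 + e) / e) / (1 + l)) (\<Lambda> s)" if "s \<in> S" for s
    unfolding \<Lambda>_def by (rule res_bound_rotated[OF L]) (use that in \<open>auto simp: S_def\<close>)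
  have com: "\<Lambda> s (\<Lambda> t x) = \<Lambda> t (\<Lambda> s x)" for s t x
    using cl by (simp add: \<Lambda>_def clinear_def scaleC_scaleC mult.commute)
  have cisd: "((\<lambda>s. cis (r * s)) has_vector_derivative (\<i> * of_real r) * cis (r * s)) (at s within S)" for r s
  proof -
    have "((\<lambda>z. exp (\<i> * of_real r * z)) has_field_derivative \<i> * of_real r * exp (\<i> * of_real r * of_real s)) (at (of_real s))"
      by (auto intro!: derivative_eq_intros)
    from has_vector_derivative_real_field[OF this] show ?thesis
      by (simp add: cis_conv_exp mult.assoc)
  qed
  have der: "(\<Lambda> has_vector_derivative (scal (- \<i>) o\<^sub>L \<Lambda> s)) (at s within S)" for s
  proof -
    have "((\<lambda>s. cis (- s)) has_vector_derivative - \<i> * cis (- s)) (at s within S)"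
      using cisd[of "-1" s] by simp
    from bounded_linear.has_vector_derivative[OF bounded_linear_compose[OF bounded_bilinear.bounded_linear_left[OF bounded_bilinear_blinfun_compose, of L] scal_bounded_linear] this]
    have "(\<Lambda> has_vector_derivative (scal (- \<i> * cis (- s)) o\<^sub>L L)) (at s within S)"
      by (simp add: \<Lambda>_def[abs_def] o_def)
    moreover have "(scal (- \<i> * cis (- s)) o\<^sub>L L) = (scal (- \<i>) o\<^sub>L \<Lambda> s)"
      by (rule blinfun_eqI) (simp add: \<Lambda>_def scaleC_scaleC)
    ultimately show ?thesis by simp
  qed
  have Pder: "(P has_vector_derivative \<gamma> *\<^sub>R (scal (- \<i>) o\<^sub>L P s)) (at s within S)" if "s \<in> S" for s
  proof -
    have "((scal (- \<i>) o\<^sub>L \<Lambda> s) o\<^sub>L wint \<gamma> (rho (\<Lambda> s))) = (scal (- \<i>) o\<^sub>L P s)"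
      by (rule blinfun_eqI) (simp add: P_def L_wint_rho[OF res[OF that] g])
    then show ?thesis
      using fpow_path_derivative[OF res com g that der] by (simp add: P_def[abs_def])
  qed
  define V where "V s = scal (cis (\<gamma> * s)) o\<^sub>L P s" for s
  have Vder: "(V has_vector_derivative 0) (at s within S)" if "s \<in> S" for s
  proof -
    have "(scal (cis (\<gamma> * s)) o\<^sub>L (\<gamma> *\<^sub>R (scal (- \<i>) o\<^sub>L P s))) + (scal ((\<i> * of_real \<gamma>) * cis (\<gamma> * s)) o\<^sub>L P s) = 0"
      by (rule blinfun_eqI)
        (simp add: blinfun.add_left blinfun.scaleR_left scaleR_scaleC scaleC_scaleC scaleC_add_left[symmetric] scaleC_zero_left mult_ac)
    then show ?thesis
      unfolding V_def
      using bounded_bilinear.has_vector_derivative[OF bounded_bilinear_blinfun_compose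
          bounded_linear.has_vector_derivative[OF scal_bounded_linear cisd[of \<gamma> s]] Pder[OF that]] by simp
  qed
  obtain c where c: "\<And>s. s \<in> S \<Longrightarrow> V s = c"
    using has_vector_derivative_zero_constant[of S V] Vder by (auto simp: S_def convex_real_interval)
  have "s \<in> S" "0 \<in> S" using s by (auto simp: S_def abs_le_iff)
  then have "V s = V 0" using c by metis
  then have "cis (\<gamma> * s) *\<^sub>C P s x = P 0 x"
    by (metis V_def blinfun_apply_blinfun_compose cis_zero mult_zero_right scal_apply scaleC_one)
  moreover have "\<Lambda> 0 = L" by (rule blinfun_eqI) (simp add: \<Lambda>_def scaleC_one)
  ultimately have "cis (\<gamma> * s) *\<^sub>C P s x = fpow \<gamma> L x" by (simp add: P_def)
  then have "cis (- (\<gamma> * s)) *\<^sub>C cis (\<gamma> * s) *\<^sub>C P s x = cis (- (\<gamma> * s)) *\<^sub>C fpow \<gamma> L x" by simp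
  then show ?thesis by (simp add: scaleC_scaleC cis_mult scaleC_one P_def \<Lambda>_def)
qed

lemma strong_tendsto_compose:
  fixes A :: "nat \<Rightarrow> 'h::real_normed_vector \<Rightarrow>\<^sub>L 'h"
  assumes A: "\<And>x. (\<lambda>n. A n x) \<longlonglongrightarrow> A' x" and bd: "\<And>n. norm (A n) \<le> B" and y: "y \<longlonglongrightarrow> y'"
  shows "(\<lambda>n. A n (y n)) \<longlonglongrightarrow> A' y'"
proof -
  have "(\<lambda>n. B * norm (y n - y')) \<longlonglongrightarrow> B * norm (y' - y')" by (intro tendsto_intros y)
  then have lim: "(\<lambda>n. B * norm (y n - y')) \<longlonglongrightarrow> 0" by simp
  have "(\<lambda>n. A n (y n - y')) \<longlonglongrightarrow> 0"
    by (rule Lim_null_comparison[OF _ lim], rule always_eventually, rule allI)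
      (rule order_trans[OF norm_blinfun mult_right_mono[OF bd]], simp)
  from tendsto_add[OF this A[of y']] show ?thesis by (simp add: blinfun.diff_right)
qed

text \<open>For \<open>y = rho \<Lambda> l x\<close>, so that \<open>x = y + l \<Lambda> y\<close>,
  the integrand paired with \<open>x\<close> is
  \<open>inner (c \<Lambda> y) y + l Re c |\<Lambda> y|^2\<close>. Both terms are nonnegative, and
  the weight is positive.\<close>

lemma fpow_rotated_nonneg:
  fixes \<Lambda> :: "'h::{complex_hilbert_space, second_countable_topology} \<Rightarrow>\<^sub>L 'h"
  assumes res: "res_bound (\<lambda>_. M) \<Lambda>" and g: "0 < \<gamma>" "\<gamma> < 1" and c: "Re c \<ge> 0"
    and nn: "\<And>y. 0 \<le> inner (c *\<^sub>C \<Lambda> y) y"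
  shows "0 \<le> inner (c *\<^sub>C fpow \<gamma> \<Lambda> x) x"
proof -
  have bl: "bounded_linear (\<lambda>z. inner (c *\<^sub>C z) x)"
    by (rule bounded_linear_compose[OF bounded_linear_inner_left bounded_linear_scaleC])
  have "0 \<le> inner (c *\<^sub>C (\<Lambda> o\<^sub>L rho \<Lambda> l) x) x" if l: "l > 0" for l
  proof -
    define y where "y = rho \<Lambda> l x"
    have x: "x = y + l *\<^sub>R \<Lambda> y" using rho_right[OF res, of l x] l by (simp add: y_def)
    have "inner (c *\<^sub>C z) z = Re c * (norm z)\<^sup>2" for z :: 'h
      by (simp add: Re_cinner_rotate[symmetric] cinner_self)
    then have "inner (c *\<^sub>C \<Lambda> y) (y + l *\<^sub>R \<Lambda> y) = inner (c *\<^sub>C \<Lambda> y) y + l * (Re c * (norm (\<Lambda> y))\<^sup>2)"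
      by (simp add: inner_add_right)
    also have "\<dots> \<ge> 0" using nn[of y] c l by simp
    finally have "0 \<le> inner (c *\<^sub>C \<Lambda> y) (y + l *\<^sub>R \<Lambda> y)" .
    then show ?thesis unfolding x[symmetric] by (simp add: y_def)
  qed
  then have "0 \<le> (LINT l:{0<..}|lborel. l powr (- \<gamma>) *\<^sub>R inner (c *\<^sub>C (\<Lambda> o\<^sub>L rho \<Lambda> l) x) x)"
    unfolding set_lebesgue_integral_def by (intro Bochner_Integration.integral_nonneg) (auto simp: indicator_def)
  then show ?thesis
    unfolding fpow_def wint_linear_image[OF g wfam_L_rho[OF res] bl, of x]
    using sin_pi_pos[OF g] by (auto intro!: mult_nonneg_nonneg)
qed

section \<open>Accretive operators as strong limits of coercive ones\<close>

context
  fixes K :: "'h::{complex_hilbert_space, second_countable_topology} \<Rightarrow>\<^sub>L 'h"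
  assumes acc: "\<And>x. 0 \<le> inner (K x) x"
begin

definition Kreg :: "nat \<Rightarrow> 'h \<Rightarrow>\<^sub>L 'h" where
  "Kreg n = K + (1 / (real n + 1)) *\<^sub>R id_blinfun"

lemma Kreg_apply: "Kreg n x = K x + (1 / (real n + 1)) *\<^sub>R x"
  by (simp add: Kreg_def blinfun.add_left blinfun.scaleR_left)

lemma Kreg_coercive: "coercive (1 / (real n + 1)) (Kreg n)"
  using acc by (simp add: coercive_def Kreg_apply inner_add_left power2_norm_eq_inner)

lemma res_bound_accretive: "res_bound (\<lambda>_. 1) K"
proof (rule res_boundI)
  fix l :: real assume l: "l \<ge> 0"
  have "1 * (norm x)\<^sup>2 \<le> inner (shifted K l x) x" for x
    using l acc[of x] by (simp add: shifted_apply inner_add_left power2_norm_eq_inner)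
  from coercive_inverse[OF zero_less_one this]
  show "\<exists>R. inverse_pair (shifted K l) R \<and> norm R \<le> 1" by simp
qed

end

context
  fixes K :: "'h::{complex_hilbert_space, second_countable_topology} \<Rightarrow>\<^sub>L 'h"
  assumes acc: "\<And>x. 0 \<le> inner (K x) x"
begin

lemma res_bound_Kreg: "res_bound (\<lambda>_. 1) (Kreg K n)"
proof (rule res_bound_accretive)
  show "0 \<le> inner (Kreg K n x) x" for x
    using acc[of x] by (simp add: Kreg_apply[OF acc] inner_add_left)
qed

lemma norm_Kreg: "norm (Kreg K n) \<le> norm K + 1"
proof (rule norm_blinfun_bound)
  fix x :: 'h
  have "(1 / (real n + 1)) * norm x \<le> 1 * norm x" by (intro mult_right_mono) auto
  then have "norm ((1 / (real n + 1)) *\<^sub>R x) \<le> 1 * norm x" by simp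
  then have "norm (Kreg K n x) \<le> norm K * norm x + 1 * norm x"
    unfolding Kreg_apply[OF acc]
    by (intro order_trans[OF norm_triangle_ineq] add_mono norm_blinfun)
  then show "norm (Kreg K n x) \<le> (norm K + 1) * norm x" by (simp add: algebra_simps)
qed simp

text \<open>The bound is independent of \<open>n\<close> because it rests on accretivity alone; the
  coercivity constant \<open>1 / (n + 1)\<close> degenerates and must not enter. It is the majorant
  for dominated convergence.\<close>

lemma wfam_Kreg: "wfam (norm K + 3) (\<lambda>l. Kreg K n o\<^sub>L rho (Kreg K n) l)"
proof -
  have "1 + 1 + norm (Kreg K n) * 1 \<le> norm K + 3" using norm_Kreg[of n] by simp
  then have "(1 + 1 + norm (Kreg K n) * 1) / (1 + l) \<le> (norm K + 3) / (1 + l)" if "l > 0" for l :: real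
    using that by (intro divide_right_mono) auto
  then show ?thesis using wfam_L_rho[OF res_bound_Kreg, of n] unfolding wfam_def by (meson order_trans)
qed

context
  fixes \<gamma> :: real assumes g: "0 < \<gamma>" "\<gamma> < 1"
begin

lemma norm_fpow_Kreg: "norm (fpow \<gamma> (Kreg K n)) \<le> norm K + 3"
  unfolding fpow_def by (rule norm_wint[OF g wfam_Kreg])

text \<open>Dominated convergence. For fixed \<open>l\<close>, the relation
  \<open>l L rho = 1 - rho\<close> and the resolvent identity turn the difference of the integrands
  into \<open>rho K l (rho (Kreg K n) l x)\<close> divided by \<open>n + 1\<close>, and both
  resolvents are contractions.\<close>

lemma fpow_Kreg_tendsto: "(\<lambda>n. fpow \<gamma> (Kreg K n) x) \<longlonglongrightarrow> fpow \<gamma> K x"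
proof -
  note rK = res_bound_accretive[OF acc]
  define f where "f n l = indicat_real {0<..} l *\<^sub>R (l powr (- \<gamma>) *\<^sub>R (Kreg K n o\<^sub>L rho (Kreg K n) l) x)" for n l
  define f' where "f' l = indicat_real {0<..} l *\<^sub>R (l powr (- \<gamma>) *\<^sub>R (K o\<^sub>L rho K l) x)" for l
  define w where "w l = indicat_real {0<..} l *\<^sub>R (((norm K + 3) * norm x) * (l powr (- \<gamma>) / (1 + l)))" for l
  have "(\<lambda>n. integral\<^sup>L lborel (f n)) \<longlonglongrightarrow> integral\<^sup>L lborel f'"
  proof (rule integral_dominated_convergence)
    show "f' \<in> borel_measurable lborel"
      using wfam_integrable[OF g wfam_L_rho[OF rK]] unfolding f'_def set_integrable_def by (rule borel_measurable_integrable)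
    show "f n \<in> borel_measurable lborel" for n
      using wfam_integrable[OF g wfam_Kreg] unfolding f_def set_integrable_def by (rule borel_measurable_integrable)
    have "set_integrable lborel {0<..} (\<lambda>l. ((norm K + 3) * norm x) * (l powr (- \<gamma>) / (1 + l)))"
      by (intro set_integrable_mult_right kern_integrable g)
    then show "integrable lborel w" by (simp only: w_def[abs_def] set_integrable_def)
    show "AE l in lborel. norm (f n l) \<le> w l" for n
      using wfam_norm_le[OF g wfam_Kreg[of n], of _ x] by (intro AE_I2) (auto simp: f_def w_def indicator_def)
    show "AE l in lborel. (\<lambda>n. f n l) \<longlonglongrightarrow> f' l"
    proof (rule AE_I2)
      fix l :: real
      show "(\<lambda>n. f n l) \<longlonglongrightarrow> f' l"
      proof (cases "l > 0")
        case l: True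
        have b: "norm (Kreg K n (rho (Kreg K n) l x) - K (rho K l x)) \<le> (1 / (real n + 1)) * norm x" for n
        proof -
          note rn = res_bound_Kreg[of n]
          have com: "K (Kreg K n x) = Kreg K n (K x)" for x
            by (simp add: Kreg_apply[OF acc] blinfun.add_right blinfun.scaleR_right)
          have aux: "w = (x - r) /\<^sub>R l" if "r + l *\<^sub>R w = x" for r w :: 'h
            using that l by auto
          have "Kreg K n (rho (Kreg K n) l x) = (x - rho (Kreg K n) l x) /\<^sub>R l" "K (rho K l x) = (x - rho K l x) /\<^sub>R l"
            using l by (intro aux rho_right[OF rn] rho_right[OF rK]; simp)+
          then have "Kreg K n (rho (Kreg K n) l x) - K (rho K l x) = (rho K l x - rho (Kreg K n) l x) /\<^sub>R l"
            by (simp flip: scaleR_diff_right)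
          also have "\<dots> = rho K l (rho (Kreg K n) l ((Kreg K n - K) x))"
            using l by (simp add: rho_difference[OF rK rn com])
          also have "(Kreg K n - K) x = (1 / (real n + 1)) *\<^sub>R x"
            by (simp add: blinfun.diff_left Kreg_apply[OF acc])
          finally show ?thesis
            using order_trans[OF norm_rho_apply[OF rK, of l "rho (Kreg K n) l ((1 / (real n + 1)) *\<^sub>R x)"]]
              norm_rho_apply[OF rn, of l "(1 / (real n + 1)) *\<^sub>R x"] l by simp
        qed
        have lim: "(\<lambda>n. (1 / (real n + 1)) * norm x) \<longlonglongrightarrow> 0"
          using tendsto_mult_left_zero[OF LIMSEQ_inverse_real_of_nat, of "norm x"] by (simp add: divide_inverse add.commute)
        have "(\<lambda>n. Kreg K n (rho (Kreg K n) l x) - K (rho K l x)) \<longlonglongrightarrow> 0"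
          by (rule Lim_null_comparison[OF always_eventually lim]) (use b in blast)
        then have "(\<lambda>n. Kreg K n (rho (Kreg K n) l x)) \<longlonglongrightarrow> K (rho K l x)" by (rule LIM_zero_cancel)
        then show ?thesis using l unfolding f_def f'_def by (auto intro!: tendsto_intros)
      qed (simp add: f_def f'_def)
    qed
  qed
  then show ?thesis
    unfolding fpow_def wint_apply[OF g wfam_Kreg] wint_apply[OF g wfam_L_rho[OF rK]] f_def f'_def set_lebesgue_integral_def
    by (intro tendsto_scaleR tendsto_const)
qed

end

lemma Kreg_tendsto: "(\<lambda>n. Kreg K n x) \<longlonglongrightarrow> K x"
proof -
  have "(\<lambda>n. K x + (1 / (real n + 1)) *\<^sub>R x) \<longlonglongrightarrow> K x + 0 *\<^sub>R x"
    using LIMSEQ_inverse_real_of_nat by (intro tendsto_intros) (simp add: divide_inverse add.commute)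
  then show ?thesis by (simp add: Kreg_apply[OF acc])
qed

lemma fpow_prod2:
  assumes g: "0 < \<beta>" "0 < \<gamma>" "\<beta> + \<gamma> = 1"
  shows "fpow \<beta> K (fpow \<gamma> K x) = K x"
proof -
  have b1: "\<beta> < 1" "\<gamma> < 1" using g by auto
  have "(\<lambda>n. fpow \<beta> (Kreg K n) (fpow \<gamma> (Kreg K n) x)) \<longlonglongrightarrow> fpow \<beta> K (fpow \<gamma> K x)"
    by (intro strong_tendsto_compose[OF fpow_Kreg_tendsto norm_fpow_Kreg] fpow_Kreg_tendsto g b1)
  then have "(\<lambda>n. Kreg K n x) \<longlonglongrightarrow> fpow \<beta> K (fpow \<gamma> K x)"
    by (simp add: fpow_prod2_coercive[OF Kreg_coercive[OF acc] g])
  then show ?thesis using Kreg_tendsto LIMSEQ_unique by blast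
qed

lemma fpow_prod3:
  assumes g: "0 < \<beta>" "0 < \<gamma>" "0 < \<delta>" "\<beta> + \<gamma> + \<delta> = 1"
  shows "fpow \<beta> K (fpow \<gamma> K (fpow \<delta> K x)) = K x"
proof -
  have b1: "\<beta> < 1" "\<gamma> < 1" "\<delta> < 1" using g by auto
  have "(\<lambda>n. fpow \<beta> (Kreg K n) (fpow \<gamma> (Kreg K n) (fpow \<delta> (Kreg K n) x))) \<longlonglongrightarrow> fpow \<beta> K (fpow \<gamma> K (fpow \<delta> K x))"
    by (intro strong_tendsto_compose[OF fpow_Kreg_tendsto norm_fpow_Kreg] fpow_Kreg_tendsto g b1)
  then have "(\<lambda>n. Kreg K n x) \<longlonglongrightarrow> fpow \<beta> K (fpow \<gamma> K (fpow \<delta> K x))"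
    by (simp add: fpow_prod3_coercive[OF Kreg_coercive[OF acc] g])
  then show ?thesis using Kreg_tendsto LIMSEQ_unique by blast
qed

lemma clinear_fpow:
  assumes cl: "clinear K" and g: "0 < \<gamma>" "\<gamma> < 1"
  shows "clinear (fpow \<gamma> K)"
  unfolding clinear_def
proof (intro allI)
  fix c x
  have "scal c (fpow \<gamma> K x) = fpow \<gamma> K (scal c x)"
    by (rule fpow_commute[OF res_bound_accretive[OF acc] g]) (use cl in \<open>simp add: clinear_def\<close>)
  then show "fpow \<gamma> K (c *\<^sub>C x) = c *\<^sub>C fpow \<gamma> K x" by simp
qed

lemma fpow_accretive:
  assumes g: "0 < \<gamma>" "\<gamma> < 1"
  shows "0 \<le> inner (fpow \<gamma> K x) x"
  using fpow_rotated_nonneg[OF res_bound_accretive[OF acc] g, of 1 x] acc by (simp add: scaleC_one)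

text \<open>Nonnegativity for \<open>c \<Lambda>\<close> with
  \<open>\<Lambda> = e^(-is) (K + 1/(n+1))\<close> passes to \<open>c \<Lambda>^\<gamma>\<close>,
  and rotation extracts the factor \<open>e^(-i\<gamma>s)\<close>. The condition on
  \<open>Re c\<close> is needed for the first passage; the one on \<open>Re (c e^(-is))\<close>
  keeps the term \<open>1/(n+1)\<close> from spoiling the sign.\<close>

lemma fpow_sector:
  assumes cl: "clinear K" and g: "0 < \<gamma>" "\<gamma> < 1" and s: "\<bar>s\<bar> \<le> pi / 2"
    and c: "Re c \<ge> 0" "Re (c * cis (- s)) \<ge> 0"
    and nn: "\<And>y. 0 \<le> inner ((c * cis (- s)) *\<^sub>C K y) y"
  shows "0 \<le> inner ((c * cis (- (\<gamma> * s))) *\<^sub>C fpow \<gamma> K x) x"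
proof -
  have "0 \<le> inner ((c * cis (- (\<gamma> * s))) *\<^sub>C fpow \<gamma> (Kreg K n) x) x" for n
  proof -
    note co = Kreg_coercive[OF acc, of n]
    have cl': "clinear (Kreg K n)"
      using cl by (simp add: clinear_def Kreg_apply[OF acc] scaleC_add_right scaleC_scaleR)
    define \<Lambda> where "\<Lambda> = scal (cis (- s)) o\<^sub>L Kreg K n"
    have "0 \<le> inner (c *\<^sub>C \<Lambda> y) y" for y
    proof -
      have "inner (c *\<^sub>C \<Lambda> y) y = inner ((c * cis (- s)) *\<^sub>C K y) y + (1 / (real n + 1)) * inner ((c * cis (- s)) *\<^sub>C y) y"
        by (simp add: \<Lambda>_def Kreg_apply[OF acc] scaleC_scaleC scaleC_add_right scaleC_scaleR inner_add_left)
      moreover have "inner ((c * cis (- s)) *\<^sub>C y) y = Re (c * cis (- s)) * (norm y)\<^sup>2"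
        by (simp add: Re_cinner_rotate[symmetric] cinner_self)
      ultimately show ?thesis using nn[of y] c(2) by simp
    qed
    from fpow_rotated_nonneg[OF res_bound_decay_const[OF res_bound_rotated[OF co s]] g c(1), folded \<Lambda>_def, OF this]
    have "0 \<le> inner (c *\<^sub>C fpow \<gamma> \<Lambda> x) x" .
    then show ?thesis by (simp add: \<Lambda>_def fpow_rotate[OF co cl' g s] scaleC_scaleC)
  qed
  moreover have "(\<lambda>n. inner ((c * cis (- (\<gamma> * s))) *\<^sub>C fpow \<gamma> (Kreg K n) x) x) \<longlonglongrightarrow> inner ((c * cis (- (\<gamma> * s))) *\<^sub>C fpow \<gamma> K x) x"
    by (intro tendsto_inner tendsto_const bounded_linear.tendsto[OF bounded_linear_scaleC] fpow_Kreg_tendsto g)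
  ultimately show ?thesis by (intro LIMSEQ_le_const) auto
qed

context
  assumes inj: "\<And>x. K x = 0 \<Longrightarrow> x = 0"
begin

lemma fpow_eq_0:
  assumes g: "0 < \<gamma>" "\<gamma> < 1" and "fpow \<gamma> K x = 0"
  shows "x = 0"
  using fpow_prod2[of "1 - \<gamma>" \<gamma> x] assms inj by simp

text \<open>After multiplication by \<open>K^\<delta>\<close>,
  \<open>\<delta> = 1 - \<beta> - \<gamma>\<close>, both sides equal \<open>K\<close>, and
  \<open>K^\<delta>\<close> is injective.\<close>

lemma fpow_add:
  assumes g: "0 < \<beta>" "0 < \<gamma>" "\<beta> + \<gamma> < 1"
  shows "fpow \<beta> K (fpow \<gamma> K x) = fpow (\<beta> + \<gamma>) K x"
proof -
  define \<delta> where "\<delta> = 1 - (\<beta> + \<gamma>)"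
  have "fpow \<delta> K (fpow \<beta> K (fpow \<gamma> K x)) = K x"
    by (rule fpow_prod3) (use g in \<open>auto simp: \<delta>_def\<close>)
  moreover have "fpow \<delta> K (fpow (\<beta> + \<gamma>) K x) = K x"
    by (rule fpow_prod2) (use g in \<open>auto simp: \<delta>_def\<close>)
  ultimately have "fpow \<delta> K (fpow \<beta> K (fpow \<gamma> K x) - fpow (\<beta> + \<gamma>) K x) = 0" by (simp add: blinfun.diff_right)
  then have "fpow \<beta> K (fpow \<gamma> K x) - fpow (\<beta> + \<gamma>) K x = 0"
    by (rule fpow_eq_0[rotated 2]) (use g in \<open>auto simp: \<delta>_def\<close>)
  then show ?thesis by simp
qed

text \<open>For \<open>u\<^sub>\<epsilon> = x - \<epsilon> (K + \<epsilon>)\<^sup>-\<^sup>1 x\<close>, which lies in the range of \<open>K\<close>, monotonicity gives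
  \<open>\<parallel>u\<^sub>\<epsilon> - u\<^sub>\<delta>\<parallel>\<^sup>2 \<le> \<parallel>u\<^sub>\<delta>\<parallel>\<^sup>2 - \<parallel>u\<^sub>\<epsilon>\<parallel>\<^sup>2\<close> for \<open>\<epsilon> \<ge> \<delta>\<close>; so the family converges, and injectivity identifies the limit as \<open>x\<close>.\<close>

lemma dense_range: "closure (range (blinfun_apply K)) = UNIV"
proof -
  have "x \<in> closure (range (blinfun_apply K))" for x
  proof -
    define e where "e n = 1 / (real n + 1)" for n :: nat
    have e: "e n > 0" for n by (simp add: e_def)
    have e_mono: "e n \<le> e m" if "m \<le> n" for m n using that by (simp add: e_def field_simps)
    have elim: "e \<longlonglongrightarrow> 0"
      using LIMSEQ_inverse_real_of_nat by (simp add: e_def[abs_def] divide_inverse add.commute)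
    have "\<exists>y. K y + e n *\<^sub>R y = e n *\<^sub>R x" for n
    proof -
      have "e n * (norm z)\<^sup>2 \<le> inner (Kreg K n z) z" for z
        using Kreg_coercive[OF acc, of n] by (simp add: coercive_def e_def)
      from coercive_inverse[OF e this] obtain R where "inverse_pair (Kreg K n) R" by blast
      then have "Kreg K n (R (e n *\<^sub>R x)) = e n *\<^sub>R x" by (simp add: inverse_pair_def)
      then show ?thesis by (auto simp: Kreg_apply[OF acc] e_def)
    qed
    then obtain y where y: "\<And>n. K (y n) + e n *\<^sub>R y n = e n *\<^sub>R x" by metis
    define u where "u n = x - y n" for n
    have Ky: "K (y n) = e n *\<^sub>R u n" for n
      using y[of n] by (simp add: u_def scaleR_diff_right eq_diff_eq)
    have u_range: "u n \<in> range (blinfun_apply K)" for n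
      using Ky[of n] e[of n] by (intro range_eqI[of _ _ "y n /\<^sub>R e n"]) (simp add: blinfun.scaleR_right)
    \<comment> \<open>Monotonicity of \<open>K\<close> at \<open>y m - y n = u n - u m\<close>,
      where \<open>K (y n) = e n u n\<close>; doubling it and writing
      \<open>2 <u, v> = |u|^2 + |v|^2 - |u - v|^2\<close> gives this form.\<close>
    have key: "(e m + e n) * (norm (u m - u n))\<^sup>2 \<le> (e m - e n) * ((norm (u n))\<^sup>2 - (norm (u m))\<^sup>2)" for m n
    proof -
      have "0 \<le> inner (K (y m - y n)) (y m - y n)" by (rule acc)
      also have "y m - y n = u n - u m" by (simp add: u_def)
      also have "K (u n - u m) = K (y m - y n)" by (simp add: u_def)
      also have "\<dots> = e m *\<^sub>R u m - e n *\<^sub>R u n" by (simp add: blinfun.diff_right Ky)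
      finally have "0 \<le> inner (e m *\<^sub>R u m - e n *\<^sub>R u n) (u n - u m)" .
      then show ?thesis
        unfolding power2_norm_eq_inner
        by (simp add: inner_diff_left inner_diff_right inner_commute algebra_simps)
    qed
    have inc: "(norm (u m))\<^sup>2 \<le> (norm (u n))\<^sup>2 \<and> (norm (u m - u n))\<^sup>2 \<le> (norm (u n))\<^sup>2 - (norm (u m))\<^sup>2" if "m \<le> n" for m n
    proof (cases "e m = e n")
      case True
      then have "(norm (u m - u n))\<^sup>2 = 0" using key[of m n] e[of n] by (simp add: mult_le_0_iff)
      then show ?thesis by simp
    next
      case False
      then have lt: "e n < e m" using e_mono[OF that] by simp
      define d where "d = (norm (u n))\<^sup>2 - (norm (u m))\<^sup>2"
      have "0 \<le> (e m + e n) * (norm (u m - u n))\<^sup>2" using e[of m] e[of n] by simp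
      then have "0 \<le> (e m - e n) * d" using key[of m n] by (simp add: d_def)
      then have d: "0 \<le> d" using lt by (simp add: zero_le_mult_iff)
      have "(e m + e n) * (norm (u m - u n))\<^sup>2 \<le> (e m + e n) * d"
        using key[of m n] e[of n] d mult_right_mono[of "e m - e n" "e m + e n" d] by (simp add: d_def)
      then have "(norm (u m - u n))\<^sup>2 \<le> d" using e[of m] e[of n] by (simp add: mult_le_cancel_left)
      then show ?thesis using d by (simp add: d_def)
    qed
    have yb: "norm (y n) \<le> norm x" for n
    proof -
      have "inner (K (y n) + e n *\<^sub>R y n) (y n) = e n * inner x (y n)" by (simp add: y)
      then have "e n * (norm (y n))\<^sup>2 \<le> e n * inner x (y n)"
        using acc[of "y n"] by (simp add: inner_add_left power2_norm_eq_inner)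
      then have "(norm (y n))\<^sup>2 \<le> inner x (y n)" using e[of n] by simp
      also have "\<dots> \<le> norm x * norm (y n)" by (rule norm_cauchy_schwarz)
      finally show ?thesis by (cases "y n = 0") (auto simp: power2_eq_square)
    qed
    have ub: "(norm (u n))\<^sup>2 \<le> (2 * norm x)\<^sup>2" for n
      using norm_triangle_ineq4[of x "y n"] yb[of n] by (intro power_mono) (auto simp: u_def)
    have "incseq (\<lambda>n. (norm (u n))\<^sup>2)" using inc by (auto simp: incseq_def)
    moreover have "bdd_above (range (\<lambda>n. (norm (u n))\<^sup>2))" using ub by (auto intro!: bdd_aboveI)
    ultimately have "convergent (\<lambda>n. (norm (u n))\<^sup>2)"
      using LIMSEQ_incseq_SUP convergent_def by blast
    then have C: "Cauchy (\<lambda>n. (norm (u n))\<^sup>2)" by (rule convergent_Cauchy)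
    have "Cauchy u"
    proof (rule metric_CauchyI)
      fix r :: real assume r: "r > 0"
      then have "r\<^sup>2 > 0" by simp
      from metric_CauchyD[OF C this] obtain N
        where N: "\<And>m n. m \<ge> N \<Longrightarrow> n \<ge> N \<Longrightarrow> dist ((norm (u m))\<^sup>2) ((norm (u n))\<^sup>2) < r\<^sup>2" by blast
      have main: "dist (u m) (u n) < r" if "N \<le> m" "m \<le> n" for m n
      proof -
        have "(norm (u m - u n))\<^sup>2 < r\<^sup>2"
          using inc[OF that(2)] N[of m n] that by (auto simp: dist_real_def)
        then show ?thesis using r by (simp add: dist_norm power_less_imp_less_base)
      qed
      show "\<exists>M. \<forall>m\<ge>M. \<forall>n\<ge>M. dist (u m) (u n) < r"
      proof (intro exI allI impI)
        fix m n assume "N \<le> m" "N \<le> n"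
        then show "dist (u m) (u n) < r"
          using main[of m n] main[of n m] by (cases "m \<le> n") (auto simp: dist_commute)
      qed
    qed
    then obtain v where v: "u \<longlonglongrightarrow> v" using Cauchy_convergent convergent_def by blast
    have "(\<lambda>n. x - u n) \<longlonglongrightarrow> x - v" by (intro tendsto_intros v)
    then have "(\<lambda>n. K (y n)) \<longlonglongrightarrow> K (x - v)"
      by (intro bounded_linear.tendsto[OF blinfun.bounded_linear_right]) (simp add: u_def)
    moreover have "(\<lambda>n. K (y n)) \<longlonglongrightarrow> 0 *\<^sub>R v" unfolding Ky by (intro tendsto_intros elim v)
    ultimately have "K (x - v) = 0" using LIMSEQ_unique by fastforce
    then have "v = x" using inj[of "x - v"] by simp
    then show ?thesis using u_range v unfolding closure_sequential by blast
  qed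
  then show ?thesis by blast
qed

lemma dense_range_fpow:
  assumes g: "0 < \<gamma>" "\<gamma> < 1"
  shows "closure (range (blinfun_apply (fpow \<gamma> K))) = UNIV"
proof -
  have "range (blinfun_apply K) \<subseteq> range (blinfun_apply (fpow \<gamma> K))"
  proof
    fix z assume "z \<in> range (blinfun_apply K)"
    then obtain x where "z = fpow \<gamma> K (fpow (1 - \<gamma>) K x)"
      using fpow_prod2[of \<gamma> "1 - \<gamma>"] g by auto
    then show "z \<in> range (blinfun_apply (fpow \<gamma> K))" by blast
  qed
  from closure_mono[OF this] show ?thesis using dense_range by auto
qed

end

end

text \<open>\<open>cis (\<sigma> \<tau>)\<close> is a combination of
  \<open>cis (\<sigma> \<phi>)\<close> and 1 with the nonnegative weights
  \<open>sin \<tau> / sin \<phi>\<close> and \<open>sin (\<phi> - \<tau>) / sin \<phi>\<close>. So a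
  sign known at the two ends of an angle holds throughout.\<close>

lemma Re_cis_cone:
  assumes "0 \<le> \<tau>" "\<tau> \<le> \<phi>" "0 < \<phi>" "\<phi> < pi" and "Re w \<ge> 0" "Re (cis (\<sigma> * \<phi>) * w) \<ge> 0" and \<sigma>: "\<sigma> = 1 \<or> \<sigma> = -1"
  shows "Re (cis (\<sigma> * \<tau>) * w) \<ge> 0"
proof -
  have "sin \<phi> * Re (cis (\<sigma> * \<tau>) * w) = sin \<tau> * Re (cis (\<sigma> * \<phi>) * w) + sin (\<phi> - \<tau>) * Re w"
    using \<sigma> by (auto simp: sin_diff algebra_simps)
  moreover have "0 \<le> sin \<tau>" "0 \<le> sin (\<phi> - \<tau>)" using assms by (auto intro!: sin_ge_zero)
  ultimately have "0 \<le> sin \<phi> * Re (cis (\<sigma> * \<tau>) * w)" using assms by simp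
  moreover have "0 < sin \<phi>" using assms by (intro sin_gt_zero) auto
  ultimately show ?thesis by (simp add: zero_le_mult_iff)
qed

section \<open>Exponentials of bounded operators\<close>

primrec opow :: "('h::real_normed_vector \<Rightarrow>\<^sub>L 'h) \<Rightarrow> nat \<Rightarrow> ('h \<Rightarrow>\<^sub>L 'h)" where
  "opow G 0 = id_blinfun"
| "opow G (Suc n) = G o\<^sub>L opow G n"

lemma norm_opow: "norm (opow G n) \<le> norm G ^ n"
proof (induction n)
  case 0
  show ?case by (simp add: norm_blinfun_id_le)
next
  case (Suc n)
  then show ?case
    using order_trans[OF norm_blinfun_compose mult_left_mono[OF Suc, of "norm G"]] by simp
qed

definition eexp :: "('h::banach \<Rightarrow>\<^sub>L 'h) \<Rightarrow> real \<Rightarrow> ('h \<Rightarrow>\<^sub>L 'h)" where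
  "eexp G t = (\<Sum>n. (t ^ n / fact n) *\<^sub>R opow G n)"

lemma summable_exp_real: "summable (\<lambda>n. c ^ n / fact n :: real)"
  using summable_exp[of c] by (simp add: divide_inverse mult.commute)

lemma eexp_term_bound: "\<bar>t\<bar> \<le> R \<Longrightarrow> norm ((t ^ n / fact n) *\<^sub>R opow G n) \<le> (R * norm G) ^ n / fact n"
proof -
  assume "\<bar>t\<bar> \<le> R"
  then have "\<bar>t\<bar> ^ n * norm (opow G n) \<le> R ^ n * norm G ^ n"
    by (intro mult_mono power_mono norm_opow) auto
  then show ?thesis by (simp add: power_abs power_mult_distrib divide_right_mono)
qed

lemma summable_eexp: "summable (\<lambda>n. (t ^ n / fact n) *\<^sub>R opow G n)" for G :: "'h::banach \<Rightarrow>\<^sub>L 'h"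
  by (rule summable_comparison_test'[OF summable_exp_real eexp_term_bound[OF order_refl]])

lemma eexp_0: "eexp G 0 = id_blinfun"
proof -
  have "(\<lambda>n. (0 ^ n / fact n) *\<^sub>R opow G n) sums ((0 ^ 0 / fact 0) *\<^sub>R opow G 0)"
    by (rule sums_single[of 0 "\<lambda>n. (0 ^ n / fact n) *\<^sub>R opow G n", THEN sums_cong[THEN iffD1, rotated]]) auto
  then show ?thesis unfolding eexp_def by (simp add: sums_iff)
qed

lemma eexp_commute:
  fixes U G :: "'h::banach \<Rightarrow>\<^sub>L 'h"
  assumes com: "\<And>x. U (G x) = G (U x)"
  shows "U (eexp G t x) = eexp G t (U x)"
proof -
  have pw: "U (opow G n y) = opow G n (U y)" for n y
    by (induction n arbitrary: y) (auto simp: com)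
  have s: "(\<lambda>n. ((t ^ n / fact n) *\<^sub>R opow G n) y) sums eexp G t y" for y
    unfolding eexp_def
    by (rule bounded_linear.sums[OF blinfun.bounded_linear_left summable_sums[OF summable_eexp]])
  have "(\<lambda>n. U (((t ^ n / fact n) *\<^sub>R opow G n) x)) sums U (eexp G t x)"
    by (rule bounded_linear.sums[OF blinfun.bounded_linear_right s])
  then have "(\<lambda>n. ((t ^ n / fact n) *\<^sub>R opow G n) (U x)) sums U (eexp G t x)"
    by (simp add: blinfun.scaleR_left blinfun.scaleR_right pw)
  then show ?thesis using s sums_unique2 by blast
qed

lemma eexp_has_vector_derivative:
  fixes G :: "'h::banach \<Rightarrow>\<^sub>L 'h"
  shows "(eexp G has_vector_derivative (G o\<^sub>L eexp G t)) (at t)"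
proof -
  define R where "R = \<bar>t\<bar> + 1"
  define S where "S = {-R<..<R}"
  define f where "f n t = (t ^ n / fact n) *\<^sub>R opow G n" for n and t :: real
  define d where "d n t = (real n * t ^ (n - 1) / fact n) *\<^sub>R opow G n" for n and t :: real
  have d_Suc: "d (Suc n) t = G o\<^sub>L f n t" for n t
  proof -
    have "real (Suc n) * t ^ n / fact (Suc n) = t ^ n / fact n" by (simp add: field_simps del: of_nat_Suc)
    then show ?thesis
      by (simp add: d_def f_def bounded_bilinear.scaleR_right[OF bounded_bilinear_blinfun_compose] del: of_nat_Suc fact_Suc)
  qed
  have fder: "(f n has_vector_derivative d n s) (at s within S)" for n s
  proof -
    have "((\<lambda>t. t ^ n / fact n) has_real_derivative real n * s ^ (n - 1) / fact n) (at s within S)"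
      by (auto intro!: derivative_eq_intros)
    then show ?thesis
      unfolding f_def d_def
      using has_vector_derivative_scaleR[of _ _ s S "\<lambda>_. opow G n" 0] by fastforce
  qed
  have sumd: "suminf (\<lambda>i. d i s) = G o\<^sub>L eexp G s" for s
  proof -
    have "(\<lambda>n. G o\<^sub>L f n s) sums (G o\<^sub>L eexp G s)"
      unfolding eexp_def f_def
      by (rule bounded_linear.sums[OF bounded_bilinear.bounded_linear_right[OF bounded_bilinear_blinfun_compose] summable_sums[OF summable_eexp]])
    then have "(\<lambda>n. d (Suc n) s) sums (G o\<^sub>L eexp G s)" by (simp add: d_Suc)
    then have "(\<lambda>n. d n s) sums ((G o\<^sub>L eexp G s) + d 0 s)" by (rule sums_Suc)
    then show ?thesis by (simp add: sums_iff d_def)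
  qed
  have "uniform_limit S (\<lambda>n x. \<Sum>i<n. d i x) (\<lambda>x. suminf (\<lambda>i. d i x)) sequentially"
  proof (rule Weierstrass_m_test)
    \<comment> \<open>The zeroth differentiated term vanishes and term \<open>Suc m\<close> is
      \<open>G\<close> times the original term \<open>m\<close>, hence a majorant shifted by
      one.\<close>
    define M where "M n = (case n of 0 \<Rightarrow> 0 | Suc m \<Rightarrow> norm G * ((R * norm G) ^ m / fact m))" for n
    have "summable (\<lambda>n. M (Suc n))" using summable_mult[OF summable_exp_real, of "norm G" "R * norm G"] by (simp add: M_def)
    then show "summable M" by (subst (asm) summable_Suc_iff)
    show "norm (d n x) \<le> M n" if "x \<in> S" for n x
    proof (cases n)
      case 0 then show ?thesis by (simp add: d_def M_def)
    next
      case (Suc m)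
      have "norm (f m x) \<le> (R * norm G) ^ m / fact m"
        unfolding f_def using that by (intro eexp_term_bound) (auto simp: S_def)
      then have "norm (d n x) \<le> norm G * ((R * norm G) ^ m / fact m)"
        unfolding Suc d_Suc by (intro order_trans[OF norm_blinfun_compose] mult_left_mono) auto
      then show ?thesis by (simp add: M_def Suc)
    qed
  qed
  then have unif: "uniform_limit S (\<lambda>n x. \<Sum>i<n. d i x) (\<lambda>x. G o\<^sub>L eexp G x) sequentially"
    by (simp add: sumd)
  have "\<exists>g. \<forall>x\<in>S. (\<lambda>n. f n x) sums g x \<and> (g has_derivative (\<lambda>h. h *\<^sub>R (G o\<^sub>L eexp G x))) (at x within S)"
  proof (rule has_derivative_series)
    show "convex S" by (simp add: S_def convex_real_interval)
    show "(f n has_derivative (\<lambda>h. h *\<^sub>R d n x)) (at x within S)" for n x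
      using fder unfolding has_vector_derivative_def .
    show "\<forall>\<^sub>F n in sequentially. \<forall>x\<in>S. \<forall>h. norm ((\<Sum>i<n. h *\<^sub>R d i x) - h *\<^sub>R (G o\<^sub>L eexp G x)) \<le> e * norm h"
      if "e > 0" for e
      using uniform_limitD[OF unif that]
    proof eventually_elim
      case (elim n)
      show ?case
      proof (intro ballI allI)
        fix x h assume "x \<in> S"
        then have "norm ((\<Sum>i<n. d i x) - (G o\<^sub>L eexp G x)) \<le> e" using elim by (auto simp: dist_norm less_imp_le)
        then have "\<bar>h\<bar> * norm ((\<Sum>i<n. d i x) - (G o\<^sub>L eexp G x)) \<le> \<bar>h\<bar> * e" by (intro mult_left_mono) auto
        then show "norm ((\<Sum>i<n. h *\<^sub>R d i x) - h *\<^sub>R (G o\<^sub>L eexp G x)) \<le> e * norm h"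
          by (simp add: scaleR_sum_right[symmetric] scaleR_diff_right[symmetric] mult.commute)
      qed
    qed
    show "0 \<in> S" using abs_ge_zero[of t] unfolding S_def R_def greaterThanLessThan_iff by linarith
    show "(\<lambda>n. f n 0) sums eexp G 0" unfolding f_def eexp_def by (rule summable_sums[OF summable_eexp])
  qed
  then obtain g where g: "\<And>x. x \<in> S \<Longrightarrow> (\<lambda>n. f n x) sums g x"
    "\<And>x. x \<in> S \<Longrightarrow> (g has_derivative (\<lambda>h. h *\<^sub>R (G o\<^sub>L eexp G x))) (at x within S)" by blast
  have tS: "t \<in> S" by (auto simp: S_def R_def)
  have geq: "g x = eexp G x" if "x \<in> S" for x
    using g(1)[OF that] unfolding f_def eexp_def by (simp add: sums_iff)
  have "(eexp G has_derivative (\<lambda>h. h *\<^sub>R (G o\<^sub>L eexp G t))) (at t within S)"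
    by (rule has_derivative_transform[OF tS _ g(2)[OF tS]]) (simp add: geq)
  moreover have "at t within S = at t" by (rule at_within_open[OF tS]) (simp add: S_def)
  ultimately show ?thesis by (simp add: has_vector_derivative_def)
qed

lemma eexp_apply_derivative:
  fixes G :: "'h::banach \<Rightarrow>\<^sub>L 'h"
  shows
  "((\<lambda>t. blinfun_apply (eexp G t) x) has_vector_derivative blinfun_apply G (blinfun_apply (eexp G t) x)) (at t within A)"
  using bounded_linear.has_vector_derivative[OF blinfun.bounded_linear_left[of x] eexp_has_vector_derivative[of G t]]
  by (auto intro: has_vector_derivative_at_within)

text \<open>The interpolation between two exponentials: for \<open>H = G\<close> it yields the
  semigroup law, and for two Yosida approximations it yields the estimate behind their
  convergence.\<close>

lemma eexp_product_derivative:
  fixes G H :: "'h::banach \<Rightarrow>\<^sub>L 'h"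
  assumes com: "\<And>x. H (G x) = G (H x)"
  shows "((\<lambda>s. blinfun_apply (eexp G (a - s)) (eexp H s x)) has_vector_derivative
    blinfun_apply (eexp G (a - s)) (blinfun_apply (H - G) (blinfun_apply (eexp H s) x))) (at s within A)"
proof -
  have "((\<lambda>s. a - s) has_vector_derivative -1) (at s within A)" by (auto intro!: derivative_eq_intros)
  from vector_diff_chain_within[OF this has_vector_derivative_at_within[OF eexp_has_vector_derivative]]
  have 1: "((\<lambda>s. eexp G (a - s)) has_vector_derivative (-1) *\<^sub>R (G o\<^sub>L eexp G (a - s))) (at s within A)"
    by (simp add: o_def)
  from bounded_bilinear.has_vector_derivative[OF bounded_bilinear_blinfun_apply 1 eexp_apply_derivative[of H x s A]]
  have "((\<lambda>s. blinfun_apply (eexp G (a - s)) (eexp H s x)) has_vector_derivative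
     eexp G (a - s) (H (eexp H s x)) + ((-1) *\<^sub>R (G o\<^sub>L eexp G (a - s))) (eexp H s x)) (at s within A)" .
  moreover have "G (eexp G (a - s) y) = eexp G (a - s) (G y)" for y by (rule eexp_commute) simp
  ultimately show ?thesis by (simp add: blinfun.minus_left blinfun.diff_left blinfun.diff_right)
qed

lemma eexp_add: "eexp G (s + t) x = eexp G s (eexp G t x)" for G :: "'h::banach \<Rightarrow>\<^sub>L 'h"
proof -
  define a where "a = s + t"
  have "((\<lambda>r. blinfun_apply (eexp G (a - r)) (eexp G r x)) has_vector_derivative 0) (at r within UNIV)" for r
    using eexp_product_derivative[of G G a x r UNIV] by simp
  then obtain c where "\<And>r. eexp G (a - r) (eexp G r x) = c"
    using has_vector_derivative_zero_constant[of UNIV "\<lambda>r. blinfun_apply (eexp G (a - r)) (eexp G r x)"] by auto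
  then have "eexp G (a - t) (eexp G t x) = eexp G (a - 0) (eexp G 0 x)" by metis
  then show ?thesis by (simp add: a_def eexp_0)
qed

lemma norm_vector_derivative_bound:
  fixes f :: "real \<Rightarrow> 'a::real_normed_vector"
  assumes "a \<le> b" and der: "\<And>s. s \<in> {a..b} \<Longrightarrow> (f has_vector_derivative f' s) (at s within {a..b})"
    and bd: "\<And>s. s \<in> {a..b} \<Longrightarrow> norm (f' s) \<le> B"
  shows "norm (f b - f a) \<le> B * (b - a)"
proof (cases "a = b")
  case False
  then have ab: "a < b" using assms(1) by simp
  have "norm (f b - f a) \<le> B * b - B * a"
  proof (rule differentiable_bound_general[OF ab])
    show "continuous_on {a..b} f"
      using der has_vector_derivative_continuous continuous_on_eq_continuous_within by blast
    show "(f has_vector_derivative f' x) (at x)" if "a < x" "x < b" for x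
      using der[of x] that at_within_Icc_at[of a x b] by simp
    show "((*) B has_vector_derivative B) (at x)" for x
      by (auto intro!: derivative_eq_intros simp: has_real_derivative_iff_has_vector_derivative[symmetric])
    show "norm (f' x) \<le> B" if "a < x" "x < b" for x using bd[of x] that by simp
  qed (intro continuous_intros)
  then show ?thesis by (simp add: right_diff_distrib)
qed simp

lemma nonincreasing_of_derivative:
  fixes \<phi> :: "real \<Rightarrow> real"
  assumes "a \<le> b" and "\<And>s. s \<in> {a..b} \<Longrightarrow> (\<phi> has_real_derivative \<phi>' s) (at s within {a..b})"
    and "\<And>s. s \<in> {a..b} \<Longrightarrow> \<phi>' s \<le> 0"
  shows "\<phi> b \<le> \<phi> a"
proof -
  have "\<exists>z\<in>{a..b}. \<phi> b - \<phi> a = (b - a) * \<phi>' z"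
    using mvt_very_simple[of a b \<phi> "\<lambda>s. (*) (\<phi>' s)"] assms by (auto simp: has_field_derivative_def mult.commute[of "b - a"])
  then show ?thesis using assms(1,3) by (smt (verit) mult_nonneg_nonpos)
qed

lemma norm_square_derivative:
  fixes f :: "real \<Rightarrow> 'h::real_inner"
  assumes "(f has_vector_derivative f') (at s within A)"
  shows "((\<lambda>s. (norm (f s))\<^sup>2) has_real_derivative 2 * inner f' (f s)) (at s within A)"
  unfolding power2_norm_eq_inner has_real_derivative_iff_has_vector_derivative
  using bounded_bilinear.has_vector_derivative[OF bounded_bilinear_inner assms assms]
  by (simp add: inner_commute)

lemma eexp_contraction:
  fixes G :: "'h::{real_inner, banach} \<Rightarrow>\<^sub>L 'h"
  assumes G: "\<And>x. 0 \<le> inner (G x) x" and t: "t \<ge> 0"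
  shows "norm (eexp (- G) t x) \<le> norm x"
proof -
  define u where "u t = eexp (- G) t x" for t
  have "(norm (u t))\<^sup>2 \<le> (norm (u 0))\<^sup>2"
  proof (rule nonincreasing_of_derivative[OF t])
    show "((\<lambda>s. (norm (u s))\<^sup>2) has_real_derivative 2 * inner ((- G) (u s)) (u s)) (at s within {0..t})" for s
      unfolding u_def by (rule norm_square_derivative[OF eexp_apply_derivative])
    show "2 * inner ((- G) (u s)) (u s) \<le> 0" for s using G[of "u s"] by (simp add: blinfun.minus_left)
  qed
  then show ?thesis by (simp add: u_def eexp_0)
qed

section \<open>Smoothing for sectorial operators\<close>

text \<open>The inequality \<open>Re (e\<^sup>i\<^sup>\<delta> \<langle>G v, v\<rangle>) \<ge> 0\<close> at \<open>v = u - i r e\<^sup>-\<^sup>i\<^sup>\<delta> G u\<close> and its mirror image are added; the terms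
  with \<open>\<langle>G\<^sup>2 u, u\<rangle>\<close> cancel.\<close>

lemma sectorial_interpolation:
  fixes G :: "'h::complex_hilbert_space \<Rightarrow>\<^sub>L 'h"
  assumes cl: "clinear G" and \<delta>: "0 < \<delta>" "\<delta> < pi / 2"
    and p: "\<And>v. 0 \<le> inner (cis \<delta> *\<^sub>C G v) v" and m: "\<And>v. 0 \<le> inner (cis (- \<delta>) *\<^sub>C G v) v"
  shows "2 * r * sin \<delta> * (norm (G u))\<^sup>2 \<le> inner (G u) u + r\<^sup>2 * inner (G (G u)) (G u)"
proof -
  define a where "a = cinner (G u) u"
  define q where "q = cinner (G (G u)) u"
  define w where "w = cinner (G (G u)) (G u)"
  define n where "n = (norm (G u))\<^sup>2"
  have eq: "cinner (G (u + \<mu> *\<^sub>C G u)) (u + \<mu> *\<^sub>C G u) = a + \<mu> * q + cnj \<mu> * of_real n + \<mu> * cnj \<mu> * w" for \<mu>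
  proof -
    have "G (u + \<mu> *\<^sub>C G u) = G u + \<mu> *\<^sub>C G (G u)" using cl by (simp add: blinfun.add_right clinear_def)
    then show ?thesis
      by (simp add: cinner_add_left cinner_add_right cinner_scaleC_left cinner_scaleC_right cinner_self a_def q_def w_def n_def algebra_simps)
  qed
  \<comment> \<open>Chosen so that \<open>cis \<delta> * \<mu>\<close> and
    \<open>cis (- \<delta>) * \<nu>\<close> are opposite, which cancels \<open>q\<close>. The terms
    with \<open>n\<close> contribute \<open>- r sin (2 \<delta>)\<close> each, so division by
    \<open>2 cos \<delta>\<close> leaves \<open>2 r sin \<delta>\<close>.\<close>
  define \<mu> where "\<mu> = - \<i> * of_real r * cis (- \<delta>)"
  define \<nu> where "\<nu> = \<i> * of_real r * cis \<delta>"
  have unit: "cis \<delta> * cis (- \<delta>) = 1" by (simp add: cis_mult)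
  have P: "0 \<le> Re (cis \<delta> * (a + \<mu> * q + cnj \<mu> * of_real n + \<mu> * cnj \<mu> * w))"
    using p[of "u + \<mu> *\<^sub>C G u"] unfolding Re_cinner_rotate[symmetric] eq .
  have M: "0 \<le> Re (cis (- \<delta>) * (a + \<nu> * q + cnj \<nu> * of_real n + \<nu> * cnj \<nu> * w))"
    using m[of "u + \<nu> *\<^sub>C G u"] unfolding Re_cinner_rotate[symmetric] eq .
  have c1: "cnj (cis \<delta>) = cis (- \<delta>)" "cnj (cis (- \<delta>)) = cis \<delta>" by (simp_all add: cis_cnj)
  have e1: "cis \<delta> * (a + \<mu> * q + cnj \<mu> * of_real n + \<mu> * cnj \<mu> * w) =
     cis \<delta> * a - \<i> * of_real r * (cis \<delta> * cis (- \<delta>)) * q + \<i> * of_real r * (cis \<delta> * cis \<delta>) * of_real n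
     + of_real (r\<^sup>2) * (cis \<delta> * cis (- \<delta>)) * (cis \<delta> * w)"
    unfolding \<mu>_def by (simp add: c1 algebra_simps power2_eq_square)
  have e2: "cis (- \<delta>) * (a + \<nu> * q + cnj \<nu> * of_real n + \<nu> * cnj \<nu> * w) =
     cis (- \<delta>) * a + \<i> * of_real r * (cis \<delta> * cis (- \<delta>)) * q - \<i> * of_real r * (cis (- \<delta>) * cis (- \<delta>)) * of_real n
     + of_real (r\<^sup>2) * (cis \<delta> * cis (- \<delta>)) * (cis (- \<delta>) * w)"
    unfolding \<nu>_def by (simp add: c1 algebra_simps power2_eq_square)
  have "0 \<le> Re (cis \<delta> * (a + \<mu> * q + cnj \<mu> * of_real n + \<mu> * cnj \<mu> * w)) + Re (cis (- \<delta>) * (a + \<nu> * q + cnj \<nu> * of_real n + \<nu> * cnj \<nu> * w))"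
    using P M by simp
  also have "\<dots> = 2 * cos \<delta> * (Re a + r\<^sup>2 * Re w) - 2 * r * (2 * sin \<delta> * cos \<delta>) * n"
    unfolding e1 e2 unit by (simp add: algebra_simps power2_eq_square)
  finally have "0 \<le> 2 * cos \<delta> * (Re a + r\<^sup>2 * Re w - 2 * r * sin \<delta> * n)" by (simp add: algebra_simps)
  moreover have "cos \<delta> > 0" using \<delta> by (intro cos_gt_zero) auto
  ultimately have "0 \<le> Re a + r\<^sup>2 * Re w - 2 * r * sin \<delta> * n" by (simp add: zero_le_mult_iff)
  then show ?thesis by (simp add: a_def w_def n_def inner_eq_Re_cinner)
qed

lemma sectorial_accretive:
  fixes G :: "'h::complex_hilbert_space \<Rightarrow>\<^sub>L 'h"
  assumes \<delta>: "0 < \<delta>" "\<delta> < pi / 2"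
    and p: "0 \<le> inner (cis \<delta> *\<^sub>C G v) v" and m: "0 \<le> inner (cis (- \<delta>) *\<^sub>C G v) v"
  shows "0 \<le> inner (G v) v"
proof -
  have "inner (cis \<delta> *\<^sub>C G v) v + inner (cis (- \<delta>) *\<^sub>C G v) v = 2 * cos \<delta> * inner (G v) v"
    by (simp add: Re_cinner_rotate[symmetric] inner_eq_Re_cinner[of "G v"])
  moreover have "cos \<delta> > 0" using \<delta> by (intro cos_gt_zero) auto
  ultimately show ?thesis using p m by (smt (verit) zero_less_mult_iff mult_neg_pos mult_pos_neg)
qed

text \<open>Lyapunov function: \<open>\<kappa> \<parallel>u\<parallel>\<^sup>2 + s\<^sup>2 \<parallel>G u\<parallel>\<^sup>2\<close> with \<open>\<kappa> = 1 / sin\<^sup>2 \<delta>\<close>.\<close>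

lemma eexp_smoothing:
  fixes G :: "'h::complex_hilbert_space \<Rightarrow>\<^sub>L 'h"
  assumes cl: "clinear G" and \<delta>: "0 < \<delta>" "\<delta> < pi / 2"
    and p: "\<And>v. 0 \<le> inner (cis \<delta> *\<^sub>C G v) v" and m: "\<And>v. 0 \<le> inner (cis (- \<delta>) *\<^sub>C G v) v"
    and t: "t \<ge> 0"
  shows "t * norm (G (eexp (- G) t x)) \<le> norm x / sin \<delta>"
proof -
  define k where "k = 1 / sin \<delta>"
  have sd: "sin \<delta> > 0" using \<delta> by (intro sin_gt_zero) auto
  have k: "k > 0" using sd by (simp add: k_def)
  define u where "u t = eexp (- G) t x" for t
  have du: "(u has_vector_derivative (- G) (u s)) (at s within A)" for s A
    unfolding u_def by (rule eexp_apply_derivative)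
  have dGu: "((\<lambda>s. G (u s)) has_vector_derivative G ((- G) (u s))) (at s within A)" for s A
    by (rule bounded_linear.has_vector_derivative[OF blinfun.bounded_linear_right du])
  define \<phi> where "\<phi> s = k\<^sup>2 * (norm (u s))\<^sup>2 + s\<^sup>2 * (norm (G (u s)))\<^sup>2" for s
  define \<phi>' where "\<phi>' s = k\<^sup>2 * (2 * inner ((- G) (u s)) (u s)) +
     (s\<^sup>2 * (2 * inner (G ((- G) (u s))) (G (u s))) + (2 * s) * (norm (G (u s)))\<^sup>2)" for s
  have "\<phi> t \<le> \<phi> 0"
  proof (rule nonincreasing_of_derivative[OF t])
    fix s assume s: "s \<in> {0..t}"
    show "(\<phi> has_real_derivative \<phi>' s) (at s within {0..t})"
      unfolding \<phi>_def \<phi>'_def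
      by (rule derivative_eq_intros norm_square_derivative[OF du] norm_square_derivative[OF dGu] refl | simp)+
    \<comment> \<open>The parameter \<open>r = s sin \<delta>\<close> is the one for which
      multiplication by \<open>k^2 = 1 / sin^2 \<delta>\<close> produces \<open>2 s\<close> on the
      left and \<open>s^2\<close> on the right, matching the terms of
      \<open>\<phi>'\<close>.\<close>
    have "2 * (s * sin \<delta>) * sin \<delta> * (norm (G (u s)))\<^sup>2 \<le> inner (G (u s)) (u s) + (s * sin \<delta>)\<^sup>2 * inner (G (G (u s))) (G (u s))"
      by (rule sectorial_interpolation[OF cl \<delta> p m])
    then have "k\<^sup>2 * (2 * (s * sin \<delta>) * sin \<delta> * (norm (G (u s)))\<^sup>2) \<le> k\<^sup>2 * (inner (G (u s)) (u s) + (s * sin \<delta>)\<^sup>2 * inner (G (G (u s))) (G (u s)))"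
      by (intro mult_left_mono) auto
    then have main: "2 * s * (norm (G (u s)))\<^sup>2 \<le> k\<^sup>2 * inner (G (u s)) (u s) + s\<^sup>2 * inner (G (G (u s))) (G (u s))"
      using sd by (simp add: k_def power2_eq_square field_simps)
    have "0 \<le> k\<^sup>2 * inner (G (u s)) (u s)" "0 \<le> s\<^sup>2 * inner (G (G (u s))) (G (u s))"
      using sectorial_accretive[OF \<delta> p m] by auto
    then show "\<phi>' s \<le> 0" using main by (simp add: \<phi>'_def blinfun.minus_left blinfun.minus_right)
  qed
  then have "t\<^sup>2 * (norm (G (u t)))\<^sup>2 \<le> k\<^sup>2 * (norm x)\<^sup>2"
    by (simp add: \<phi>_def u_def eexp_0) (smt (verit) zero_le_mult_iff zero_le_power2)
  then have "(t * norm (G (u t)))\<^sup>2 \<le> (k * norm x)\<^sup>2" by (simp add: power_mult_distrib)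
  then have "t * norm (G (u t)) \<le> k * norm x" by (rule power2_le_imp_le) (use k in simp)
  then show ?thesis by (simp add: k_def u_def)
qed

section \<open>Semigroups generated by sectorial operators\<close>

lemma dense_convergence:
  fixes f :: "'i \<Rightarrow> 'h::real_normed_vector \<Rightarrow> 'h"
  assumes ev: "\<forall>\<^sub>F i in F. \<forall>x y. norm (f i x - f i y) \<le> B * norm (x - y)"
    and g: "\<And>x y. norm (g x - g y) \<le> B * norm (x - y)" and B: "B \<ge> 0"
    and D: "closure D = UNIV" and lim: "\<And>x. x \<in> D \<Longrightarrow> ((\<lambda>i. f i x) \<longlongrightarrow> g x) F"
  shows "((\<lambda>i. f i x) \<longlongrightarrow> g x) F"
proof (rule tendstoI)
  fix e :: real assume e: "e > 0"
  define r where "r = e / 3 / (B + 1)"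
  have r: "r > 0" using e B by (simp add: r_def)
  have Br: "B * r \<le> e / 3"
  proof -
    have "B * r \<le> (B + 1) * r" using r by (intro mult_right_mono) auto
    also have "\<dots> = e / 3" using nonzero_mult_div_cancel_left[of "B + 1" "e / 3"] B unfolding r_def by (metis (no_types) add_nonneg_eq_0_iff times_divide_eq_right zero_le_one zero_neq_one)
    finally show ?thesis .
  qed
  have "x \<in> closure D" using D by simp
  then obtain d where d: "d \<in> D" "dist d x < r" using closure_approachable r by blast
  have dx: "B * norm (x - d) \<le> e / 3"
    using order_trans[OF mult_left_mono[of "norm (x - d)" r B] Br] d B by (simp add: dist_norm norm_minus_commute)
  from tendstoD[OF lim[OF d(1)], of "e / 3"] e have "\<forall>\<^sub>F i in F. dist (f i d) (g d) < e / 3" by simp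
  with ev show "\<forall>\<^sub>F i in F. dist (f i x) (g x) < e"
  proof eventually_elim
    case (elim i)
    have 1: "norm (f i x - f i d) \<le> e / 3" using elim(1)[rule_format, of x d] dx by linarith
    have 2: "norm (g d - g x) \<le> e / 3" using g[of d x] dx by (simp add: norm_minus_commute)
    have "f i x - g x = (f i x - f i d) + (f i d - g d) + (g d - g x)" by simp
    then have "norm (f i x - g x) \<le> norm (f i x - f i d) + norm (f i d - g d) + norm (g d - g x)"
      by (metis norm_triangle_le add_mono order_refl norm_triangle_ineq)
    then show ?case using 1 2 elim(2) by (simp add: dist_norm)
  qed
qed

lemma dense_Cauchy:
  fixes A :: "nat \<Rightarrow> 'h::banach \<Rightarrow>\<^sub>L 'h"
  assumes bd: "\<And>n x. norm (A n x) \<le> B * norm x" and B: "B \<ge> 0"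
    and D: "closure D = UNIV" and conv: "\<And>x. x \<in> D \<Longrightarrow> convergent (\<lambda>n. A n x)"
  shows "convergent (\<lambda>n. A n x)"
proof (rule Cauchy_convergent, rule metric_CauchyI)
  fix e :: real assume e: "e > 0"
  define r where "r = e / 3 / (B + 1)"
  have r: "r > 0" using e B by (simp add: r_def)
  have Br: "B * r \<le> e / 3"
  proof -
    have "B * r \<le> (B + 1) * r" using r by (intro mult_right_mono) auto
    also have "\<dots> = e / 3" using nonzero_mult_div_cancel_left[of "B + 1" "e / 3"] B unfolding r_def by (metis (no_types) add_nonneg_eq_0_iff times_divide_eq_right zero_le_one zero_neq_one)
    finally show ?thesis .
  qed
  have "x \<in> closure D" using D by simp
  then obtain d where d: "d \<in> D" "dist d x < r" using closure_approachable r by blast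
  have dx: "B * norm (x - d) \<le> e / 3"
    using order_trans[OF mult_left_mono[of "norm (x - d)" r B] Br] d B by (simp add: dist_norm norm_minus_commute)
  have Ad: "norm (A n x - A n d) \<le> e / 3" for n
    using bd[of n "x - d"] dx by (simp add: blinfun.diff_right)
  from metric_CauchyD[OF convergent_Cauchy[OF conv[OF d(1)]], of "e / 3"] e obtain N
    where N: "\<And>m n. m \<ge> N \<Longrightarrow> n \<ge> N \<Longrightarrow> dist (A m d) (A n d) < e / 3" by auto
  show "\<exists>M. \<forall>m\<ge>M. \<forall>n\<ge>M. dist (A m x) (A n x) < e"
  proof (intro exI allI impI)
    fix m n assume mn: "N \<le> m" "N \<le> n"
    have "A m x - A n x = (A m x - A m d) + (A m d - A n d) + (A n d - A n x)" by simp
    then have "norm (A m x - A n x) \<le> norm (A m x - A m d) + norm (A m d - A n d) + norm (A n d - A n x)"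
      by (metis norm_triangle_le add_mono order_refl norm_triangle_ineq)
    then show "dist (A m x) (A n x) < e"
      using Ad[of m] Ad[of n] N[OF mn] by (simp add: dist_norm norm_minus_commute)
  qed
qed

text \<open>Two Yosida exponentials can be compared, uniformly in their indices, on vectors
  \<open>S (S y)\<close>; these have to be dense.\<close>

lemma dense_range_square:
  fixes S :: "'h::real_normed_vector \<Rightarrow>\<^sub>L 'h"
  assumes "closure (range (blinfun_apply S)) = UNIV"
  shows "closure (range (\<lambda>x. S (S x))) = UNIV"
proof -
  have "blinfun_apply S ` closure (range (blinfun_apply S)) \<subseteq> closure (blinfun_apply S ` range (blinfun_apply S))"
    by (rule continuous_image_closure_subset[of UNIV]) (auto intro!: continuous_intros)
  then have "range (blinfun_apply S) \<subseteq> closure (range (\<lambda>x. S (S x)))"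
    using assms by (simp add: image_image)
  then have "closure (range (blinfun_apply S)) \<subseteq> closure (range (\<lambda>x. S (S x)))"
    by (metis closure_closure closure_mono)
  then show ?thesis using assms by auto
qed

section \<open>Yosida approximation of the generator \<open>- S^-1\<close>\<close>

context
  fixes S :: "'h::{complex_hilbert_space, second_countable_topology} \<Rightarrow>\<^sub>L 'h" and \<delta> :: real
  assumes cl: "clinear S" and \<delta>: "0 < \<delta>" "\<delta> < pi / 2"
    and pS: "\<And>v. 0 \<le> inner (cis \<delta> *\<^sub>C S v) v" and mS: "\<And>v. 0 \<le> inner (cis (- \<delta>) *\<^sub>C S v) v"
    and inj: "\<And>x. S x = 0 \<Longrightarrow> x = 0"
begin

lemma accS: "0 \<le> inner (S v) v"
  by (rule sectorial_accretive[OF \<delta> pS mS])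

lemma denseS: "closure (range (blinfun_apply S)) = UNIV"
  by (rule dense_range[OF accS inj])

text \<open>For \<open>B = S^-1\<close> and \<open>e = 1 / (n + 1)\<close> this is
  \<open>(S + e)^-1 = B (1 + e B)^-1\<close>, the Yosida approximation of \<open>B\<close>.\<close>

definition yos :: "nat \<Rightarrow> 'h \<Rightarrow>\<^sub>L 'h" where
  "yos n = rinv (Kreg S n)"

lemma yos_inverse: "inverse_pair (Kreg S n) (yos n)"
proof -
  have "0 < 1 / (real n + 1)" by simp
  moreover have "(1 / (real n + 1)) * (norm x)\<^sup>2 \<le> inner (Kreg S n x) x" for x
    using Kreg_coercive[OF accS, of n] by (simp add: coercive_def)
  ultimately obtain R where "inverse_pair (Kreg S n) R" using coercive_inverse by blast
  then show ?thesis unfolding yos_def using rinv_eq by metis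
qed

lemma yos1: "S (yos n x) + (1 / (real n + 1)) *\<^sub>R yos n x = x"
  using yos_inverse[of n] by (simp add: inverse_pair_def Kreg_apply[OF accS])

lemma yos2: "yos n (S x + (1 / (real n + 1)) *\<^sub>R x) = x"
  using yos_inverse[of n] by (simp add: inverse_pair_def Kreg_apply[OF accS])

lemma yos_commute:
  fixes U :: "'h \<Rightarrow>\<^sub>L 'h"
  assumes "\<And>x. U (S x) = S (U x)"
  shows "U (yos n x) = yos n (U x)"
proof -
  have "U (yos n x) = yos n (S (U (yos n x)) + (1 / (real n + 1)) *\<^sub>R U (yos n x))" by (simp add: yos2)
  also have "S (U (yos n x)) + (1 / (real n + 1)) *\<^sub>R U (yos n x) = U (S (yos n x) + (1 / (real n + 1)) *\<^sub>R yos n x)"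
    by (simp add: assms blinfun.add_right blinfun.scaleR_right)
  finally show ?thesis by (simp add: yos1)
qed

lemma yos_S: "yos n (S x) = S (yos n x)"
  using yos_commute[of S n x] by simp

lemma yos_yos: "yos n (yos m x) = yos m (yos n x)"
  by (rule yos_commute) (rule yos_S)

lemma clinear_yos: "clinear (yos n)"
  unfolding clinear_def
proof (intro allI)
  fix c x
  have "scal c (yos n x) = yos n (scal c x)"
    by (rule yos_commute) (use cl in \<open>simp add: clinear_def\<close>)
  then show "yos n (c *\<^sub>C x) = c *\<^sub>C yos n x" by simp
qed

text \<open>In \<open>|x|^2 = |S z + e z|^2\<close> with \<open>z = yos n x\<close> the cross term
  is nonnegative by accretivity, so each square is at most \<open>|x|^2\<close>.\<close>

lemma yos_norms: "norm (S (yos n x)) \<le> norm x" "norm ((1 / (real n + 1)) *\<^sub>R yos n x) \<le> norm x"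
proof -
  define e where "e = 1 / (real n + 1)"
  define z where "z = yos n x"
  have e: "e > 0" by (simp add: e_def)
  have "(norm x)\<^sup>2 = (norm (S z + e *\<^sub>R z))\<^sup>2" by (simp add: z_def e_def yos1)
  also have "\<dots> = (norm (S z))\<^sup>2 + 2 * (e * inner (S z) z) + (norm (e *\<^sub>R z))\<^sup>2"
    unfolding power2_norm_eq_inner by (simp add: inner_add_left inner_add_right inner_commute)
  finally have "(norm (S z))\<^sup>2 \<le> (norm x)\<^sup>2" "(norm (e *\<^sub>R z))\<^sup>2 \<le> (norm x)\<^sup>2"
    using accS[of z] e by (simp_all add: add_nonneg_nonneg)
  then show "norm (S (yos n x)) \<le> norm x" "norm ((1 / (real n + 1)) *\<^sub>R yos n x) \<le> norm x"
    unfolding z_def e_def by (auto dest!: power2_le_imp_le)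
qed

text \<open>Inversion conjugates the numerical range, hence the change of sign of \<open>s\<close>:
  with \<open>v = S y + e y\<close>, the pairing of \<open>cis s y\<close> with \<open>S y\<close>
  is that of \<open>cis (- s) S y\<close> with \<open>y\<close>.\<close>

lemma yos_rotated:
  assumes "\<And>v. 0 \<le> inner (cis (- s) *\<^sub>C S v) v" "cos s \<ge> 0"
  shows "0 \<le> inner (cis s *\<^sub>C yos n v) v"
proof -
  define e where "e = 1 / (real n + 1)"
  define y where "y = yos n v"
  have v: "v = S y + e *\<^sub>R y" by (simp add: y_def e_def yos1)
  have "inner (cis s *\<^sub>C y) (S y) = inner (cis (- s) *\<^sub>C S y) y"
    using cinner_commute[of y "S y"] by (simp add: Re_cinner_rotate[symmetric])
  moreover have "inner (cis s *\<^sub>C y) y = cos s * (norm y)\<^sup>2"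
    by (simp add: Re_cinner_rotate[symmetric] cinner_self)
  ultimately have "inner (cis s *\<^sub>C y) (S y + e *\<^sub>R y) = inner (cis (- s) *\<^sub>C S y) y + e * (cos s * (norm y)\<^sup>2)"
    by (simp add: inner_add_right)
  also have "\<dots> \<ge> 0" using assms(1)[of y] assms(2) by (simp add: e_def)
  finally have "0 \<le> inner (cis s *\<^sub>C y) (S y + e *\<^sub>R y)" .
  then show ?thesis unfolding v[symmetric] unfolding y_def .
qed

lemma yos_sector: "0 \<le> inner (cis \<delta> *\<^sub>C yos n v) v" "0 \<le> inner (cis (- \<delta>) *\<^sub>C yos n v) v"
proof -
  have "cos \<delta> \<ge> 0" using \<delta> by (intro cos_ge_zero) auto
  then show "0 \<le> inner (cis \<delta> *\<^sub>C yos n v) v" "0 \<le> inner (cis (- \<delta>) *\<^sub>C yos n v) v"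
    using yos_rotated[of \<delta>] yos_rotated[of "-\<delta>"] pS mS by auto
qed

lemma yos_accretive: "0 \<le> inner (yos n v) v"
  by (rule sectorial_accretive[OF \<delta> yos_sector])

lemma inverse_Suc_tendsto: "(\<lambda>n. 1 / (real n + 1)) \<longlonglongrightarrow> 0"
  using LIMSEQ_inverse_real_of_nat by (simp add: divide_inverse add.commute)

lemma yos_S_tendsto: "(\<lambda>n. yos n (S y)) \<longlonglongrightarrow> y"
proof (rule dense_convergence[where B = 1 and D = "range (blinfun_apply S)" and g = "\<lambda>y. y"])
  show "\<forall>\<^sub>F n in sequentially. \<forall>x y. norm (yos n (S x) - yos n (S y)) \<le> 1 * norm (x - y)"
    using yos_norms(1) by (simp add: yos_S flip: blinfun.diff_right)
  show "closure (range (blinfun_apply S)) = UNIV" by (rule denseS)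
  fix y assume "y \<in> range (blinfun_apply S)"
  then obtain z where y: "y = S z" by blast
  have b: "norm (yos n (S y) - y) \<le> (1 / (real n + 1)) * norm z" for n
  proof -
    have "S (yos n y) - y = - ((1 / (real n + 1)) *\<^sub>R yos n y)" using yos1[of n y] by (simp add: algebra_simps)
    then have "norm (yos n (S y) - y) = (1 / (real n + 1)) * norm (yos n y)" by (simp add: yos_S)
    also have "\<dots> \<le> (1 / (real n + 1)) * norm z"
      using yos_norms(1)[of n z] by (intro mult_left_mono) (auto simp: y yos_S)
    finally show ?thesis .
  qed
  have lim: "(\<lambda>n. (1 / (real n + 1)) * norm z) \<longlonglongrightarrow> 0"
    using tendsto_mult_left_zero[OF inverse_Suc_tendsto] by simp
  have "(\<lambda>n. yos n (S y) - y) \<longlonglongrightarrow> 0"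
    by (rule Lim_null_comparison[OF always_eventually lim]) (use b in blast)
  then show "(\<lambda>n. yos n (S y)) \<longlonglongrightarrow> y" by (rule LIM_zero_cancel)
qed auto

definition yexp :: "nat \<Rightarrow> real \<Rightarrow> 'h \<Rightarrow>\<^sub>L 'h" where
  "yexp n t = eexp (- yos n) t"

lemma yexp_contraction: "t \<ge> 0 \<Longrightarrow> norm (yexp n t x) \<le> norm x"
  unfolding yexp_def by (rule eexp_contraction[OF yos_accretive])

lemma yexp_commute:
  fixes U :: "'h \<Rightarrow>\<^sub>L 'h"
  assumes "\<And>x. U (S x) = S (U x)"
  shows "U (yexp n t x) = yexp n t (U x)"
  unfolding yexp_def by (rule eexp_commute) (simp add: blinfun.minus_left blinfun.minus_right yos_commute[OF assms])

lemma yexp_S: "yexp n t (S x) = S (yexp n t x)"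
  using yexp_commute[of S n t x] by simp

lemma yexp_yos: "yexp n t (yos m x) = yos m (yexp n t x)"
  using yexp_commute[of "yos m" n t x] yos_S by simp

text \<open>Since \<open>yos m - yos n\<close> is \<open>1/(n+1) - 1/(m+1)\<close> times
  \<open>yos m o yos n\<close>, the derivative of the interpolation carries two factors that are not
  bounded in the indices. The two factors \<open>S\<close> of the vector absorb them, because
  \<open>S o yos n\<close> is a contraction.\<close>

lemma yexp_difference:
  assumes t: "t \<ge> 0"
  shows "norm (yexp n t (S (S y)) - yexp m t (S (S y))) \<le> (\<bar>1 / (real n + 1) - 1 / (real m + 1)\<bar> * norm y) * t"
proof -
  define d where "d = 1 / (real n + 1) - 1 / (real m + 1)"
  define x where "x = S (S y)"
  define f where "f s = yexp m (t - s) (yexp n s x)" for s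
  have com: "(- yos n) ((- yos m) x) = (- yos m) ((- yos n) x)" for x
    by (simp add: blinfun.minus_left blinfun.minus_right yos_yos)
  have diff: "(yos m - yos n) z = d *\<^sub>R yos m (yos n z)" for z
  proof -
    have "yos m z - yos n z = yos m (S (yos n z) + (1 / (real n + 1)) *\<^sub>R yos n z) - yos m (S (yos n z) + (1 / (real m + 1)) *\<^sub>R yos n z)"
      by (simp only: yos1 yos2)
    also have "\<dots> = d *\<^sub>R yos m (yos n z)"
      by (simp add: blinfun.add_right blinfun.scaleR_right d_def scaleR_diff_left)
    finally show ?thesis by (simp add: blinfun.diff_left)
  qed
  have "norm (f t - f 0) \<le> (\<bar>d\<bar> * norm y) * (t - 0)"
  proof (rule norm_vector_derivative_bound[OF t])
    fix s assume s: "s \<in> {0..t}"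
    show "(f has_vector_derivative yexp m (t - s) ((- yos n - - yos m) (yexp n s x))) (at s within {0..t})"
      unfolding f_def yexp_def by (rule eexp_product_derivative[OF com])
    have "(- yos n - - yos m) (yexp n s x) = d *\<^sub>R yexp n s (yos m (S (yos n (S y))))"
      using diff[of "yexp n s x"] by (simp add: blinfun.diff_left blinfun.minus_left x_def yexp_yos yexp_S yos_S)
    then have "norm (yexp m (t - s) ((- yos n - - yos m) (yexp n s x))) \<le> \<bar>d\<bar> * norm (yexp n s (yos m (S (yos n (S y)))))"
      using yexp_contraction[of "t - s" m "(- yos n - - yos m) (yexp n s x)"] s by simp
    also have "\<dots> \<le> \<bar>d\<bar> * norm y"
      using s by (intro mult_left_mono order_trans[OF yexp_contraction] order_trans[OF eq_refl[OF arg_cong[OF yos_S, of norm]] order_trans[OF yos_norms(1)]])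
        (auto simp: yos_S yos_norms)
    finally show "norm (yexp m (t - s) ((- yos n - - yos m) (yexp n s x))) \<le> \<bar>d\<bar> * norm y" .
  qed
  then show ?thesis by (simp add: f_def yexp_def eexp_0 x_def d_def)
qed

lemma yexp_convergent:
  assumes t: "t \<ge> 0"
  shows "convergent (\<lambda>n. yexp n t x)"
proof (rule dense_Cauchy[where B = 1 and D = "range (\<lambda>x. S (S x))"])
  show "norm (yexp n t x) \<le> 1 * norm x" for n x using yexp_contraction[OF t] by simp
  show "closure (range (\<lambda>x. S (S x))) = UNIV" by (rule dense_range_square[OF denseS])
  fix x assume "x \<in> range (\<lambda>x. S (S x))"
  then obtain y where x: "x = S (S y)" by blast
  show "convergent (\<lambda>n. yexp n t x)"
  proof (rule Cauchy_convergent, rule metric_CauchyI)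
    fix e :: real assume e: "e > 0"
    define c where "c = norm y * t + 1"
    have c: "c > 0" using t by (simp add: c_def add_nonneg_pos)
    have "Cauchy (\<lambda>n. 1 / (real n + 1))" using inverse_Suc_tendsto LIMSEQ_imp_Cauchy by blast
    from metric_CauchyD[OF this, of "e / c"] obtain N
      where N: "\<And>m n. m \<ge> N \<Longrightarrow> n \<ge> N \<Longrightarrow> \<bar>1 / (real m + 1) - 1 / (real n + 1)\<bar> < e / c"
      using e c by (auto simp: dist_real_def)
    show "\<exists>M. \<forall>m\<ge>M. \<forall>n\<ge>M. dist (yexp m t x) (yexp n t x) < e"
    proof (intro exI allI impI)
      fix m n assume mn: "N \<le> m" "N \<le> n"
      have "dist (yexp m t x) (yexp n t x) \<le> \<bar>1 / (real m + 1) - 1 / (real n + 1)\<bar> * (norm y * t)"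
        using yexp_difference[OF t, of m y n] by (simp add: dist_norm x mult.assoc)
      also have "\<dots> \<le> \<bar>1 / (real m + 1) - 1 / (real n + 1)\<bar> * c" by (intro mult_left_mono) (auto simp: c_def)
      also have "\<dots> < e" using N[OF mn] c by (simp add: pos_less_divide_eq)
      finally show "dist (yexp m t x) (yexp n t x) < e" .
    qed
  qed
qed simp

section \<open>The limit semigroup: derivative, generator, smoothing\<close>

definition sgrp :: "real \<Rightarrow> 'h \<Rightarrow> 'h" where
  "sgrp t x = lim (\<lambda>n. yexp n t x)"

lemma yexp_tendsto: "t \<ge> 0 \<Longrightarrow> (\<lambda>n. yexp n t x) \<longlonglongrightarrow> sgrp t x"
  unfolding sgrp_def using yexp_convergent convergent_LIMSEQ_iff by blast

lemma sgrp_contraction: "t \<ge> 0 \<Longrightarrow> norm (sgrp t x) \<le> norm x"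
  by (rule LIMSEQ_le_const2[OF tendsto_norm[OF yexp_tendsto]]) (auto intro: yexp_contraction)

lemma sgrp_add: "t \<ge> 0 \<Longrightarrow> sgrp t (x + y) = sgrp t x + sgrp t y"
  using tendsto_add[OF yexp_tendsto[of t x] yexp_tendsto[of t y]] yexp_tendsto[of t "x + y"] LIMSEQ_unique
  by (fastforce simp: blinfun.add_right)

lemma sgrp_commute:
  fixes U :: "'h \<Rightarrow>\<^sub>L 'h"
  assumes t: "t \<ge> 0" and "\<And>x. U (S x) = S (U x)"
  shows "U (sgrp t x) = sgrp t (U x)"
proof -
  have "(\<lambda>n. U (yexp n t x)) \<longlonglongrightarrow> U (sgrp t x)"
    by (rule bounded_linear.tendsto[OF blinfun.bounded_linear_right yexp_tendsto[OF t]])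
  then have "(\<lambda>n. yexp n t (U x)) \<longlonglongrightarrow> U (sgrp t x)" by (simp add: yexp_commute[OF assms(2)])
  then show ?thesis using yexp_tendsto[OF t] LIMSEQ_unique by blast
qed

lemma sgrp_scaleC: "t \<ge> 0 \<Longrightarrow> sgrp t (c *\<^sub>C x) = c *\<^sub>C sgrp t x"
  using sgrp_commute[of t "scal c" x] cl by (simp add: clinear_def)

lemma bounded_linear_sgrp: "t \<ge> 0 \<Longrightarrow> bounded_linear (sgrp t)"
  by (rule bounded_linear_intro[where K = 1])
    (auto simp: sgrp_add sgrp_scaleC scaleR_scaleC sgrp_contraction)

lemma sgrp_S: "t \<ge> 0 \<Longrightarrow> sgrp t (S x) = S (sgrp t x)"
  using sgrp_commute[of t S x] by simp

lemma sgrp_diff: "t \<ge> 0 \<Longrightarrow> sgrp t (x - y) = sgrp t x - sgrp t y"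
  by (rule linear_diff[OF bounded_linear.linear[OF bounded_linear_sgrp]])

lemma sgrp_scaleR: "t \<ge> 0 \<Longrightarrow> sgrp t (r *\<^sub>R x) = r *\<^sub>R sgrp t x"
  by (rule linear_scale[OF bounded_linear.linear[OF bounded_linear_sgrp]])

lemma sgrp_0: "sgrp 0 x = x"
  using yexp_tendsto[of 0 x] by (simp add: yexp_def eexp_0 LIMSEQ_const_iff)

lemma norm_yexp: "t \<ge> 0 \<Longrightarrow> norm (yexp n t) \<le> 1"
  by (rule norm_blinfun_bound) (auto simp: yexp_contraction)

lemma sgrp_semigroup:
  assumes "s \<ge> 0" "t \<ge> 0"
  shows "sgrp (s + t) x = sgrp s (sgrp t x)"
proof -
  interpret L: bounded_linear "sgrp s" by (rule bounded_linear_sgrp[OF assms(1)])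
  have "(\<lambda>n. yexp n s (yexp n t x)) \<longlonglongrightarrow> Blinfun (sgrp s) (sgrp t x)"
    using yexp_tendsto[OF assms(1)] bounded_linear_Blinfun_apply[OF bounded_linear_sgrp[OF assms(1)]]
    by (intro strong_tendsto_compose[OF _ norm_yexp[OF assms(1)] yexp_tendsto[OF assms(2)]]) auto
  moreover have "yexp n s (yexp n t x) = yexp n (s + t) x" for n
    by (simp add: yexp_def eexp_add)
  ultimately show ?thesis
    using yexp_tendsto[of "s + t" x] assms LIMSEQ_unique bounded_linear_Blinfun_apply[OF bounded_linear_sgrp[OF assms(1)]]
    by fastforce
qed

lemma yexp_lipschitz:
  assumes "h \<ge> 0"
  shows "norm (yexp n h w - w) \<le> norm (yos n w) * h"
proof -
  have "norm (yexp n h w - yexp n 0 w) \<le> norm (yos n w) * (h - 0)"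
  proof (rule norm_vector_derivative_bound[OF assms])
    fix s assume s: "s \<in> {0..h}"
    show "((\<lambda>s. yexp n s w) has_vector_derivative (- yos n) (yexp n s w)) (at s within {0..h})"
      unfolding yexp_def by (rule eexp_apply_derivative)
    show "norm ((- yos n) (yexp n s w)) \<le> norm (yos n w)"
      using yexp_contraction[of s n "yos n w"] s by (simp add: blinfun.minus_left yexp_yos)
  qed
  then show ?thesis by (simp add: yexp_def eexp_0)
qed

text \<open>The remainder is governed by \<open>yos n (yos n w)\<close>, whose norm for
  \<open>w = S (S z)\<close> is at most \<open>norm z\<close> whatever \<open>n\<close> is; so the
  estimate survives the limit.\<close>

lemma yexp_taylor:
  assumes h: "h \<ge> 0"
  shows "norm (yexp n h (S (S z)) - S (S z) + h *\<^sub>R yos n (S (S z))) \<le> norm z * h\<^sup>2"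
proof -
  define w where "w = S (S z)"
  have zb: "norm (yos n (yos n w)) \<le> norm z"
  proof -
    have "yos n (yos n w) = S (yos n (S (yos n z)))" by (simp add: w_def yos_S)
    then show ?thesis using order_trans[OF yos_norms(1) yos_norms(1)] by simp
  qed
  define f where "f s = yexp n s w + s *\<^sub>R yos n w" for s
  have "norm (f h - f 0) \<le> (norm z * h) * (h - 0)"
  proof (rule norm_vector_derivative_bound[OF h])
    fix s assume s: "s \<in> {0..h}"
    have d1: "((\<lambda>s. yexp n s w) has_vector_derivative (- yos n) (yexp n s w)) (at s within {0..h})"
      unfolding yexp_def by (rule eexp_apply_derivative)
    have d2: "((\<lambda>s. s *\<^sub>R yos n w) has_vector_derivative yos n w) (at s within {0..h})"
      by (auto intro!: derivative_eq_intros)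
    show "(f has_vector_derivative (- yos n) (yexp n s w) + yos n w) (at s within {0..h})"
      unfolding f_def by (rule has_vector_derivative_add[OF d1 d2])
    have "(- yos n) (yexp n s w) + yos n w = - (yexp n s (yos n w) - yos n w)"
      by (simp add: blinfun.minus_left yexp_yos)
    then have "norm ((- yos n) (yexp n s w) + yos n w) \<le> norm (yos n (yos n w)) * s"
      using yexp_lipschitz[of s n "yos n w"] s by (simp only: norm_minus_cancel) simp
    also have "\<dots> \<le> norm z * h" using s zb by (intro mult_mono) auto
    finally show "norm ((- yos n) (yexp n s w) + yos n w) \<le> norm z * h" .
  qed
  then show ?thesis by (simp add: f_def yexp_def eexp_0 w_def power2_eq_square algebra_simps)
qed

lemma sgrp_lipschitz:
  assumes h: "h \<ge> 0"
  shows "norm (sgrp h (S y) - S y) \<le> norm y * h"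
proof (rule LIMSEQ_le_const2)
  show "(\<lambda>n. norm (yexp n h (S y) - S y)) \<longlonglongrightarrow> norm (sgrp h (S y) - S y)"
    by (intro tendsto_intros yexp_tendsto h)
  have "norm (yexp n h (S y) - S y) \<le> norm y * h" for n
    using order_trans[OF yexp_lipschitz[OF h, of n "S y"] mult_right_mono[of _ "norm y" h]] yos_norms(1)[of n y] h
    by (simp add: yos_S)
  then show "\<exists>N. \<forall>n\<ge>N. norm (yexp n h (S y) - S y) \<le> norm y * h" by blast
qed

lemma sgrp_taylor:
  assumes h: "h \<ge> 0"
  shows "norm (sgrp h (S (S z)) - S (S z) + h *\<^sub>R S z) \<le> norm z * h\<^sup>2"
proof (rule LIMSEQ_le_const2)
  show "(\<lambda>n. norm (yexp n h (S (S z)) - S (S z) + h *\<^sub>R yos n (S (S z)))) \<longlonglongrightarrow> norm (sgrp h (S (S z)) - S (S z) + h *\<^sub>R S z)"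
    by (intro tendsto_intros yexp_tendsto h yos_S_tendsto)
qed (use yexp_taylor[OF h] in blast)

lemma sgrp_increment:
  assumes "s \<ge> 0" "t \<ge> 0"
  shows "norm (sgrp s (S y) - sgrp t (S y)) \<le> norm y * \<bar>s - t\<bar>"
proof -
  have main: "norm (sgrp s (S y) - sgrp t (S y)) \<le> norm y * (s - t)" if "0 \<le> t" "t \<le> s" for s t
  proof -
    have "sgrp s (S y) = sgrp t (sgrp (s - t) (S y))"
      using sgrp_semigroup[of t "s - t" "S y"] that by simp
    then have "sgrp s (S y) - sgrp t (S y) = sgrp t (sgrp (s - t) (S y) - S y)"
      using that by (simp add: sgrp_diff)
    then show ?thesis
      using order_trans[OF sgrp_contraction sgrp_lipschitz] that by simp
  qed
  show ?thesis
    using main[of s t] main[of t s] assms by (cases "t \<le> s") (auto simp: norm_minus_commute)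
qed

text \<open>For \<open>y\<close> in the range of \<open>S\<close> the Taylor estimate gives the
  derivative with a quadratic remainder. The difference quotients depend on \<open>y\<close> with
  Lipschitz constant 1, uniformly in \<open>s\<close>, so density of the range extends this to every
  \<open>y\<close>.\<close>

lemma sgrp_derivative:
  assumes t: "t \<ge> 0"
  shows "((\<lambda>s. sgrp s (S y)) has_vector_derivative - sgrp t y) (at t within {0..})"
proof -
  define q where "q s y = (sgrp s (S y) - sgrp t (S y)) /\<^sub>R (s - t)" for s y
  have "((\<lambda>s. q s y) \<longlongrightarrow> - sgrp t y) (at t within {0..})"
  proof (rule dense_convergence[where B = 1 and D = "range (blinfun_apply S)" and g = "\<lambda>y. - sgrp t y"])
    have "norm (q s x - q s y) \<le> 1 * norm (x - y)" if "s \<ge> 0" "s \<noteq> t" for s x y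
    proof -
      have "q s x - q s y = (sgrp s (S (x - y)) - sgrp t (S (x - y))) /\<^sub>R (s - t)"
        using that t by (simp add: q_def blinfun.diff_right sgrp_diff scaleR_diff_right)
      then have "norm (q s x - q s y) = norm (sgrp s (S (x - y)) - sgrp t (S (x - y))) / \<bar>s - t\<bar>"
        by (simp add: divide_inverse mult.commute)
      also have "\<dots> \<le> norm (x - y)"
        using sgrp_increment[OF that(1) t, of "x - y"] that by (simp add: divide_le_eq)
      finally show ?thesis by simp
    qed
    then show "\<forall>\<^sub>F s in at t within {0..}. \<forall>x y. norm (q s x - q s y) \<le> 1 * norm (x - y)"
      by (auto simp: eventually_at_filter)
    show "norm (- sgrp t x - - sgrp t y) \<le> 1 * norm (x - y)" for x y
      using sgrp_contraction[OF t, of "y - x"] t by (simp add: sgrp_diff norm_minus_commute)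
    show "closure (range (blinfun_apply S)) = UNIV" by (rule denseS)
    fix y assume "y \<in> range (blinfun_apply S)"
    then obtain z where y: "y = S z" by blast
    have "((\<lambda>s. sgrp s (S y)) has_vector_derivative - sgrp t y) (at t within {0..})"
    proof (rule has_vector_derivative_quadraticI)
      fix s :: real assume "s \<in> {0..}"
      then have s: "s \<ge> 0" by simp
      show "norm (sgrp s (S y) - sgrp t (S y) - (s - t) *\<^sub>R (- sgrp t y)) \<le> (2 * norm z) * (s - t)\<^sup>2"
      proof (cases "t \<le> s")
        case True
        have "sgrp s (S y) = sgrp t (sgrp (s - t) (S y))"
          using sgrp_semigroup[of t "s - t" "S y"] True t by simp
        then have "sgrp s (S y) - sgrp t (S y) - (s - t) *\<^sub>R (- sgrp t y) = sgrp t (sgrp (s - t) (S y) - S y + (s - t) *\<^sub>R y)"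
          using t by (simp add: sgrp_diff sgrp_add sgrp_scaleR)
        also have "norm \<dots> \<le> norm z * (s - t)\<^sup>2"
          using order_trans[OF sgrp_contraction[OF t] sgrp_taylor[of "s - t" z]] True by (simp add: y)
        also have "\<dots> \<le> (2 * norm z) * (s - t)\<^sup>2" by (intro mult_right_mono) auto
        finally show ?thesis .
      next
        case False
        \<comment> \<open>Left of \<open>t\<close> the semigroup law has to start from the smaller
          time \<open>s\<close>. Replacing \<open>sgrp s y\<close> by \<open>sgrp t y\<close>
          afterwards costs a second quadratic term, whence the factor 2.\<close>
        have st: "sgrp s (sgrp (t - s) (S y)) = sgrp t (S y)"
          using sgrp_semigroup[of s "t - s" "S y"] False s by simp
        have eq: "sgrp s (sgrp (t - s) (S y) - S y + (t - s) *\<^sub>R y) = sgrp t (S y) - sgrp s (S y) + (t - s) *\<^sub>R sgrp s y"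
          using s by (simp add: sgrp_diff sgrp_add sgrp_scaleR st)
        have aux: "a - b - (s - t) *\<^sub>R (- v) = - (b - a + (t - s) *\<^sub>R u) + (t - s) *\<^sub>R (u - v)" for a b u v :: 'h
          by (simp add: algebra_simps)
        have "sgrp s (S y) - sgrp t (S y) - (s - t) *\<^sub>R (- sgrp t y) =
          - sgrp s (sgrp (t - s) (S y) - S y + (t - s) *\<^sub>R y) + (t - s) *\<^sub>R (sgrp s y - sgrp t y)"
          unfolding eq by (rule aux)
        also have "norm \<dots> \<le> norm z * (t - s)\<^sup>2 + (t - s) * (norm z * (t - s))"
        proof (intro norm_triangle_mono)
          show "norm (- sgrp s (sgrp (t - s) (S y) - S y + (t - s) *\<^sub>R y)) \<le> norm z * (t - s)\<^sup>2"
            using order_trans[OF sgrp_contraction[OF s] sgrp_taylor[of "t - s" z]] False by (simp add: y)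
          show "norm ((t - s) *\<^sub>R (sgrp s y - sgrp t y)) \<le> (t - s) * (norm z * (t - s))"
            using sgrp_increment[OF s t, of z] False by (simp add: y mult_left_mono)
        qed
        also have "\<dots> = (2 * norm z) * (s - t)\<^sup>2" by (simp add: power2_eq_square algebra_simps)
        finally show ?thesis .
      qed
    qed
    then show "((\<lambda>s. q s y) \<longlongrightarrow> - sgrp t y) (at t within {0..})"
      by (simp add: has_vector_derivative_iff_tendsto q_def)
  qed simp
  then show ?thesis by (simp add: has_vector_derivative_iff_tendsto q_def)
qed

lemma sgrp_tendsto_0: "((\<lambda>t. sgrp t x) \<longlongrightarrow> x) (at_right 0)"
proof (rule dense_convergence[where B = 1 and D = "range (blinfun_apply S)" and g = "\<lambda>y. y"])
  have "norm (sgrp t x - sgrp t y) \<le> 1 * norm (x - y)" if "t > 0" for t x y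
    using sgrp_contraction[of t "x - y"] that by (simp add: sgrp_diff)
  then show "\<forall>\<^sub>F t in at_right 0. \<forall>x y. norm (sgrp t x - sgrp t y) \<le> 1 * norm (x - y)"
    by (auto simp: eventually_at_filter)
  show "closure (range (blinfun_apply S)) = UNIV" by (rule denseS)
  fix x assume "x \<in> range (blinfun_apply S)"
  then obtain y where x: "x = S y" by blast
  have "((\<lambda>s. sgrp s (S y)) \<longlongrightarrow> sgrp 0 (S y)) (at 0 within {0..})"
    using has_vector_derivative_continuous[OF sgrp_derivative[of 0 y]] by (simp add: continuous_within)
  then show "((\<lambda>t. sgrp t x) \<longlongrightarrow> x) (at_right 0)"
    unfolding x sgrp_0 by (rule tendsto_within_subset) auto
qed auto

lemma C0_semigroup_sgrp: "C0_semigroup sgrp"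
  unfolding C0_semigroup_def
  using bounded_linear_sgrp sgrp_scaleC sgrp_0 sgrp_semigroup sgrp_tendsto_0 by auto

text \<open>One inclusion is the derivative at 0. For the other, \<open>S\<close> is applied to the
  difference quotient: it commutes with the semigroup, and \<open>S x\<close> is already known to
  lie in the domain with image \<open>- x\<close>, so the two limits give
  \<open>S y = - x\<close>.\<close>

lemma generator_sgrp: "generator sgrp = {(x, y). x = - S y}"
proof -
  have 1: "(x, y) \<in> generator sgrp" if "x = - S y" for x y
  proof -
    have x: "x = S (- y)" using that by (simp add: blinfun.minus_right)
    have "((\<lambda>s. (sgrp s x - sgrp 0 x) /\<^sub>R (s - 0)) \<longlongrightarrow> - sgrp 0 (- y)) (at 0 within {0..})"
      using sgrp_derivative[of 0 "- y"] unfolding has_vector_derivative_iff_tendsto x by simp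
    then have "((\<lambda>s. (sgrp s x - x) /\<^sub>R s) \<longlongrightarrow> y) (at 0 within {0..})" by (simp add: sgrp_0)
    then have "((\<lambda>s. (sgrp s x - x) /\<^sub>R s) \<longlongrightarrow> y) (at_right 0)" by (rule tendsto_within_subset) auto
    then show ?thesis by (simp add: generator_def)
  qed
  have 2: "x = - S y" if "(x, y) \<in> generator sgrp" for x y
  proof -
    have "((\<lambda>h. (sgrp h x - x) /\<^sub>R h) \<longlongrightarrow> y) (at_right 0)" using that by (simp add: generator_def)
    from bounded_linear.tendsto[OF blinfun.bounded_linear_right this, of S]
    have a: "((\<lambda>h. S ((sgrp h x - x) /\<^sub>R h)) \<longlongrightarrow> S y) (at_right 0)" .
    have "((\<lambda>h. (sgrp h (S x) - S x) /\<^sub>R h) \<longlongrightarrow> - x) (at_right 0)"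
      using 1[of "S x" "- x"] by (simp add: generator_def blinfun.minus_right)
    moreover have "\<forall>\<^sub>F h in at_right 0. S ((sgrp h x - x) /\<^sub>R h) = (sgrp h (S x) - S x) /\<^sub>R h"
      by (auto simp: eventually_at_filter sgrp_S blinfun.scaleR_right blinfun.diff_right)
    ultimately have "((\<lambda>h. S ((sgrp h x - x) /\<^sub>R h)) \<longlongrightarrow> - x) (at_right 0)"
      using tendsto_cong by fast
    from tendsto_unique[OF _ a this] have "S y = - x" by simp
    then show ?thesis by simp
  qed
  show ?thesis using 1 2 by auto
qed

text \<open>The operators \<open>yos n o yexp n t\<close> are bounded by
  \<open>1 / (t sin \<delta>)\<close> independently of \<open>n\<close> and converge on the dense
  range of \<open>S\<close>, hence everywhere. Their limit \<open>w\<close> satisfies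
  \<open>S w = sgrp t x\<close>, since \<open>S + 1/(n+1)\<close> undoes
  \<open>yos n\<close>.\<close>

lemma sgrp_smoothing:
  assumes t: "t > 0"
  shows "\<exists>w. sgrp t x = S w"
proof -
  define A where "A n = yos n o\<^sub>L yexp n t" for n
  have sd: "sin \<delta> > 0" using \<delta> by (intro sin_gt_zero) auto
  have bd: "norm (A n x) \<le> (1 / (t * sin \<delta>)) * norm x" for n x
    using eexp_smoothing[OF clinear_yos \<delta> yos_sector, of t n x] t sd
    by (simp add: A_def yexp_def pos_le_divide_eq mult_ac)
  have "convergent (\<lambda>n. A n x)"
  proof (rule dense_Cauchy[OF bd _ denseS])
    show "0 \<le> 1 / (t * sin \<delta>)" using t sd by simp
    fix x assume "x \<in> range (blinfun_apply S)"
    then obtain y where x: "x = S y" by blast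
    have "(\<lambda>n. yexp n t (yos n (S y))) \<longlonglongrightarrow> Blinfun (sgrp t) y"
      using yexp_tendsto[of t] bounded_linear_Blinfun_apply[OF bounded_linear_sgrp[of t]] t
      by (intro strong_tendsto_compose[OF _ norm_yexp yos_S_tendsto]) auto
    then show "convergent (\<lambda>n. A n x)"
      unfolding convergent_def by (auto simp: A_def x yexp_yos)
  qed
  then obtain w where w: "(\<lambda>n. A n x) \<longlonglongrightarrow> w" by (auto simp: convergent_def)
  have "(\<lambda>n. S (A n x) + (1 / (real n + 1)) *\<^sub>R A n x) \<longlonglongrightarrow> S w + 0 *\<^sub>R w"
    by (intro tendsto_intros bounded_linear.tendsto[OF blinfun.bounded_linear_right] w inverse_Suc_tendsto)
  then have "(\<lambda>n. yexp n t x) \<longlonglongrightarrow> S w" by (simp add: A_def yos1)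
  then show ?thesis using yexp_tendsto[of t x] t LIMSEQ_unique by (metis less_imp_le)
qed

end

section \<open>Uniqueness of the semigroup with a given generator\<close>

lemma C0_semigroup_D:
  assumes "C0_semigroup T"
  shows "t \<ge> 0 \<Longrightarrow> bounded_linear (T t)" "t \<ge> 0 \<Longrightarrow> T t (c *\<^sub>C x) = c *\<^sub>C T t x" "T 0 x = x"
    "s \<ge> 0 \<Longrightarrow> t \<ge> 0 \<Longrightarrow> T (s + t) x = T s (T t x)" "((\<lambda>t. T t x) \<longlongrightarrow> x) (at_right 0)"
  using assms unfolding C0_semigroup_def by auto

text \<open>The uniform boundedness principle by Baire category: otherwise there are times
  \<open>\<tau> n\<close> tending to 0 with operator norms beyond \<open>n + 1\<close>, although the
  orbits converge along \<open>\<tau>\<close> and are thus bounded for each vector.\<close>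

lemma C0_semigroup_bounded_near_0:
  fixes T :: "real \<Rightarrow> 'h::complex_hilbert_space \<Rightarrow> 'h"
  assumes T: "C0_semigroup T"
  shows "\<exists>d>0. \<exists>M\<ge>1. \<forall>t\<in>{0..d}. \<forall>x. norm (T t x) \<le> M * norm x"
proof (rule ccontr)
  assume neg: "\<not> ?thesis"
  note T' = C0_semigroup_D[OF T]
  have "\<exists>t\<in>{0..d}. \<exists>x. M * norm x < norm (T t x)" if "d > 0" "M \<ge> 1" for d M
    using neg that by (meson linorder_not_le)
  then have "\<exists>t\<in>{0..1 / (real n + 1)}. \<exists>x. (real n + 1) * norm x < norm (T t x)" for n
    by simp
  then obtain \<tau> where \<tau>: "\<And>n. \<tau> n \<in> {0..1 / (real n + 1)}" "\<And>n. \<exists>x. (real n + 1) * norm x < norm (T (\<tau> n) x)"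
    by metis
  have \<tau>0: "\<tau> \<longlonglongrightarrow> 0"
    by (rule real_tendsto_sandwich[of "\<lambda>_. 0" _ _ "\<lambda>n. 1 / (real n + 1)"])
      (use \<tau>(1) LIMSEQ_inverse_real_of_nat in \<open>auto simp: divide_inverse add.commute\<close>)
  \<comment> \<open>The time 0 is included because some \<open>\<tau> n\<close> may be 0.\<close>
  have at0: "((\<lambda>t. T t x) \<longlongrightarrow> T 0 x) (at 0 within {0..})" for x
  proof -
    have "((\<lambda>t. T t x) \<longlongrightarrow> x) (at 0 within {0<..})" by (rule T'(5))
    moreover have "at 0 within {0..} = at (0::real) within {0<..}"
      by (rule at_within_nhd[of _ UNIV]) auto
    ultimately show ?thesis by (simp add: T'(3))
  qed
  have conv: "(\<lambda>n. T (\<tau> n) x) \<longlonglongrightarrow> T 0 x" for x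
  proof (rule continuous_within_tendsto_compose'[of 0 "{0..}" "\<lambda>t. T t x" \<tau>])
    show "continuous (at 0 within {0..}) (\<lambda>t. T t x)" using at0[of x] by (simp add: continuous_within)
    show "\<tau> n \<in> {0..}" for n using \<tau>(1)[of n] by simp
  qed (rule \<tau>0)
  \<comment> \<open>Closed sets that cover the space; one of them contains a ball, and on a ball a
    bound for the values is a bound for the operators.\<close>
  define A where "A k = {x. \<forall>n. norm (T (\<tau> n) x) \<le> real k}" for k :: nat
  have contT: "continuous_on UNIV (\<lambda>x. T (\<tau> n) x)" for n
    using \<tau>(1)[of n] T'(1) by (auto intro: linear_continuous_on)
  have closedA: "closed (A k)" for k
  proof -
    have "A k = (\<Inter>n. {x. norm (T (\<tau> n) x) \<le> real k})" by (auto simp: A_def)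
    moreover have "closed {x. norm (T (\<tau> n) x) \<le> real k}" for n
      by (intro closed_Collect_le continuous_on_norm contT continuous_on_const)
    ultimately show ?thesis by auto
  qed
  have cover: "(\<Union>k. A k) = UNIV"
  proof -
    have "\<exists>k. x \<in> A k" for x
    proof -
      have "Bseq (\<lambda>n. T (\<tau> n) x)" using conv convergent_def convergent_imp_Bseq by blast
      then obtain K where "\<And>n. norm (T (\<tau> n) x) \<le> K" by (auto simp: Bseq_def)
      moreover obtain k where "K \<le> real k" using real_arch_simple by blast
      ultimately have "norm (T (\<tau> n) x) \<le> real k" for n by (meson order_trans)
      then show ?thesis by (auto simp: A_def)
    qed
    then show ?thesis by blast
  qed
  have "\<exists>k. interior (A k) \<noteq> {}"
  proof (rule ccontr)
    assume none: "\<not> ?thesis"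
    have "Met_TC.mtopology interior_of \<Union>(range A) = {}"
      by (rule Met_TC.metric_Baire_category_alt) (use none closedA in \<open>auto simp: Met_TC.mcomplete_def intro: Cauchy_convergent[unfolded convergent_def]\<close>)
    then show False using cover by simp
  qed
  then obtain k x0 where "x0 \<in> interior (A k)" by blast
  then obtain r where r: "r > 0" "cball x0 r \<subseteq> A k" using mem_interior_cball by blast
  have bound: "norm (T (\<tau> n) x) \<le> (2 * real k / r) * norm x" for n x
  proof (cases "x = 0")
    case True
    have "bounded_linear (T (\<tau> n))" using \<tau>(1)[of n] T'(1) by simp
    then show ?thesis using True by (simp add: linear_simps)
  next
    case False
    interpret L: bounded_linear "T (\<tau> n)" using \<tau>(1)[of n] T'(1) by simp
    define c where "c = r / norm x"
    have c: "c > 0" using r False by (simp add: c_def)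
    have "x0 + c *\<^sub>R x \<in> cball x0 r" "x0 \<in> cball x0 r" using r False by (auto simp: dist_norm c_def)
    then have "x0 + c *\<^sub>R x \<in> A k" "x0 \<in> A k" using r(2) by blast+
    then have k: "norm (T (\<tau> n) (x0 + c *\<^sub>R x)) \<le> k" "norm (T (\<tau> n) x0) \<le> k" by (auto simp: A_def)
    have "c *\<^sub>R T (\<tau> n) x = T (\<tau> n) (x0 + c *\<^sub>R x) - T (\<tau> n) x0" by (simp add: L.add L.scaleR)
    then have "c * norm (T (\<tau> n) x) \<le> 2 * real k"
      using k norm_triangle_ineq4[of "T (\<tau> n) (x0 + c *\<^sub>R x)" "T (\<tau> n) x0"] c by (metis (no_types, lifting) abs_of_pos add_mono mult_2 norm_scaleR order_trans)
    then show ?thesis using c r False by (simp add: c_def field_simps)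
  qed
  obtain n where n: "2 * real k / r \<le> real n" using real_arch_simple by blast
  obtain x where x: "(real n + 1) * norm x < norm (T (\<tau> n) x)" using \<tau>(2) by blast
  have "(2 * real k / r) * norm x \<le> (real n + 1) * norm x" using n by (intro mult_right_mono) auto
  then show False using bound[of n x] x by linarith
qed

lemma C0_semigroup_bounded:
  fixes T :: "real \<Rightarrow> 'h::complex_hilbert_space \<Rightarrow> 'h"
  assumes T: "C0_semigroup T"
  shows "\<exists>B\<ge>0. \<forall>t\<in>{0..a}. \<forall>x. norm (T t x) \<le> B * norm x"
proof -
  note T' = C0_semigroup_D[OF T]
  obtain d M where d: "d > 0" and M: "M \<ge> 1" and bd: "\<And>t x. t \<in> {0..d} \<Longrightarrow> norm (T t x) \<le> M * norm x"
    using C0_semigroup_bounded_near_0[OF T] by blast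
  have step: "norm (T t x) \<le> M ^ n * norm x" if "0 \<le> t" "t \<le> real n * d" for n t x
    using that
  proof (induction n arbitrary: t x)
    case 0
    then show ?case by (simp add: T'(3))
  next
    case (Suc n)
    show ?case
    proof (cases "t \<le> d")
      case True
      have "norm (T t x) \<le> M * norm x" using bd Suc.prems True by simp
      also have "\<dots> \<le> M ^ Suc n * norm x"
        using M power_increasing[of 1 "Suc n" M] by (intro mult_right_mono) auto
      finally show ?thesis .
    next
      case False
      have "T t x = T (t - d) (T d x)" using T'(4)[of "t - d" d x] False d by simp
      also have "norm \<dots> \<le> M ^ n * norm (T d x)"
        using Suc.prems False by (intro Suc.IH) (auto simp: algebra_simps)
      also have "\<dots> \<le> M ^ n * (M * norm x)" using bd[of d x] d M by (intro mult_left_mono) auto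
      finally show ?thesis by (simp add: mult_ac)
    qed
  qed
  obtain n where "a / d \<le> real n" using real_arch_simple by blast
  then have "a \<le> real n * d" using d by (simp add: field_simps)
  then show ?thesis using step[of _ n] M by (intro exI[of _ "M ^ n"]) auto
qed

lemma norm_nonincreasing_eq_0:
  fixes f :: "real \<Rightarrow> 'h::real_inner"
  assumes a: "0 \<le> a" and der: "\<And>s. s \<in> {0..a} \<Longrightarrow> (f has_vector_derivative f' s) (at s within {0..a})"
    and diss: "\<And>s. s \<in> {0..a} \<Longrightarrow> inner (f' s) (f s) \<le> 0" and "f 0 = 0"
  shows "f a = 0"
proof -
  have "(norm (f a))\<^sup>2 \<le> (norm (f 0))\<^sup>2"
    by (rule nonincreasing_of_derivative[OF a norm_square_derivative[OF der]]) (use diss in auto)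
  then show ?thesis using assms(4) by simp
qed

context
  fixes S :: "'h::{complex_hilbert_space, second_countable_topology} \<Rightarrow>\<^sub>L 'h" and \<delta> :: real
  assumes cl: "clinear S" and \<delta>: "0 < \<delta>" "\<delta> < pi / 2"
    and pS: "\<And>v. 0 \<le> inner (cis \<delta> *\<^sub>C S v) v" and mS: "\<And>v. 0 \<le> inner (cis (- \<delta>) *\<^sub>C S v) v"
    and inj: "\<And>x. S x = 0 \<Longrightarrow> x = 0"
begin

text \<open>For a vector \<open>S y\<close> the difference of the two orbits is
  \<open>f = S g\<close> with \<open>f' = - g\<close>, where \<open>g\<close> is the difference of
  the orbits of \<open>y\<close>. So the derivative of \<open>|f|^2\<close> is
  \<open>- 2 <g, S g> \<le> 0\<close>, and \<open>f\<close> starts at 0. Density of the range and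
  continuity give the rest.\<close>

lemma semigroup_unique:
  assumes T: "C0_semigroup T" and gen: "generator T = {(x, y). x = - S y}" and t: "t \<ge> 0"
  shows "T t x = sgrp S t x"
proof -
  note T' = C0_semigroup_D[OF T]
  note hyps = cl \<delta> pS mS inj
  obtain B where B: "B \<ge> 0" and bd: "\<And>s x. s \<in> {0..t} \<Longrightarrow> norm (T s x) \<le> B * norm x"
    using C0_semigroup_bounded[OF T] by blast
  have sub: "s \<ge> 0 \<Longrightarrow> T s (x - y) = T s x - T s y" for s x y
    using T'(1)[of s] by (rule linear_diff[OF bounded_linear.linear])
  have scR: "s \<ge> 0 \<Longrightarrow> T s (r *\<^sub>R x) = r *\<^sub>R T s x" for s r x
    using T'(1)[of s] by (rule linear_scale[OF bounded_linear.linear])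
  have genD: "((\<lambda>h. (T h (S y) - S y) /\<^sub>R h) \<longlongrightarrow> - y) (at_right 0)" for y
  proof -
    have "(S y, - y) \<in> generator T" unfolding gen by (simp add: blinfun.minus_right)
    then show ?thesis by (simp add: generator_def)
  qed
  have TS: "T s (S y) = S (T s y)" if s: "s \<ge> 0" for s y
  proof -
    interpret L: bounded_linear "T s" by (rule T'(1)[OF s])
    have "((\<lambda>h. T s ((T h (S y) - S y) /\<^sub>R h)) \<longlongrightarrow> T s (- y)) (at_right 0)"
      by (rule L.tendsto[OF genD])
    moreover have "\<forall>\<^sub>F h in at_right 0. T s ((T h (S y) - S y) /\<^sub>R h) = (T h (T s (S y)) - T s (S y)) /\<^sub>R h"
      using T'(4)[of s _ "S y"] T'(4)[of _ s "S y"] s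
      by (auto simp: eventually_at_filter L.scaleR L.diff add.commute intro!: always_eventually)
    ultimately have "((\<lambda>h. (T h (T s (S y)) - T s (S y)) /\<^sub>R h) \<longlongrightarrow> T s (- y)) (at_right 0)"
      using tendsto_cong by fast
    then have "(T s (S y), T s (- y)) \<in> generator T" by (simp add: generator_def)
    then show ?thesis unfolding gen by (simp add: L.neg blinfun.minus_right)
  qed
  have der: "((\<lambda>s. T s (S y)) has_vector_derivative - T s0 y) (at s0 within {0..t})" if s0: "s0 \<in> {0..t}" for y s0
  proof -
    define q where "q h = (T h (S y) - S y) /\<^sub>R h - (- y)" for h
    have q0: "(q \<longlongrightarrow> 0) (at_right 0)" unfolding q_def by (rule LIM_zero[OF genD])
    define g where "g h = B * (norm (q h) + norm (T h y - y))" for h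
    have "(g \<longlongrightarrow> B * (norm (0::'h) + norm (y - y))) (at_right 0)"
      unfolding g_def by (intro tendsto_intros q0 T'(5))
    then have g0: "(g \<longlongrightarrow> 0) (at_right 0)" by simp
    have "filterlim (\<lambda>s. \<bar>s - s0\<bar>) (at_right 0) (at s0 within {0..t})"
      unfolding filterlim_at
    proof
      have "((\<lambda>s. \<bar>s - s0\<bar>) \<longlongrightarrow> \<bar>s0 - s0\<bar>) (at s0 within {0..t})" by (intro tendsto_intros)
      then show "((\<lambda>s. \<bar>s - s0\<bar>) \<longlongrightarrow> 0) (at s0 within {0..t})" by simp
      show "\<forall>\<^sub>F s in at s0 within {0..t}. \<bar>s - s0\<bar> \<in> {0<..} \<and> \<bar>s - s0\<bar> \<noteq> 0"
        by (auto simp: eventually_at_filter)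
    qed
    from filterlim_compose[OF g0 this] have lim: "((\<lambda>s. g \<bar>s - s0\<bar>) \<longlongrightarrow> 0) (at s0 within {0..t})" .
    have est: "norm ((T s (S y) - T s0 (S y)) /\<^sub>R (s - s0) - (- T s0 y)) \<le> g \<bar>s - s0\<bar>" if s: "s \<in> {0..t}" "s \<noteq> s0" for s
    proof -
      \<comment> \<open>The quotients on both sides of \<open>s0\<close> are brought to the form
        \<open>T m\<close> applied to the right quotient at 0 with step \<open>h\<close>; the local
        bound \<open>B\<close> then controls them by the convergence at 0.\<close>
      define m where "m = min s s0"
      define h where "h = \<bar>s - s0\<bar>"
      have m: "m \<in> {0..t}" "m \<ge> 0" using s s0 by (auto simp: m_def)
      have h: "h > 0" using s by (simp add: h_def)
      have mx: "T (m + h) z = T m (T h z)" for z using T'(4)[of m h z] m h by simp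
      have "(T s (S y) - T s0 (S y)) /\<^sub>R (s - s0) = (T (m + h) (S y) - T m (S y)) /\<^sub>R h"
      proof (cases "s0 \<le> s")
        case True
        then show ?thesis by (simp add: m_def h_def)
      next
        case False
        then have "m = s" "h = s0 - s" "m + h = s0" by (auto simp: m_def h_def)
        then have "(T (m + h) (S y) - T m (S y)) /\<^sub>R h = inverse (s0 - s) *\<^sub>R (T s0 (S y) - T s (S y))"
          by simp
        also have "inverse (s0 - s) = - inverse (s - s0)" by (simp flip: inverse_minus_eq)
        also have "(- inverse (s - s0)) *\<^sub>R (T s0 (S y) - T s (S y)) = (T s (S y) - T s0 (S y)) /\<^sub>R (s - s0)"
          by (simp add: scaleR_diff_right)
        finally show ?thesis by simp
      qed
      also have "\<dots> = T m (q h - y)"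
        using m by (simp add: mx q_def sub scR)
      finally have eq: "(T s (S y) - T s0 (S y)) /\<^sub>R (s - s0) - (- T s0 y) = T m (q h) - (T m y - T s0 y)"
        using m by (simp add: sub)
      have 1: "norm (T m (q h)) \<le> B * norm (q h)" by (rule bd[OF m(1)])
      have 2: "norm (T m y - T s0 y) \<le> B * norm (T h y - y)"
      proof (cases "s0 \<le> s")
        case True
        then show ?thesis using B by (simp add: m_def)
      next
        case False
        then have "s0 = m + h" by (auto simp: m_def h_def)
        then have "T m y - T s0 y = T m (y - T h y)" using m by (simp add: mx sub)
        then show ?thesis using bd[OF m(1), of "y - T h y"] by (simp add: norm_minus_commute)
      qed
      show ?thesis
        unfolding eq using 1 2 norm_triangle_ineq4[of "T m (q h)" "T m y - T s0 y"]
        by (simp add: g_def h_def[symmetric] distrib_left)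
    qed
    have "((\<lambda>s. (T s (S y) - T s0 (S y)) /\<^sub>R (s - s0) - (- T s0 y)) \<longlongrightarrow> 0) (at s0 within {0..t})"
      by (rule Lim_null_comparison[OF _ lim]) (use est in \<open>auto simp: eventually_at_filter\<close>)
    then show ?thesis unfolding has_vector_derivative_iff_tendsto by (rule LIM_zero_cancel)
  qed
  have eqS: "T t (S y) = sgrp S t (S y)" for y
  proof -
    have "T t (S y) - sgrp S t (S y) = 0"
    proof (rule norm_nonincreasing_eq_0[OF t])
      fix s assume s: "s \<in> {0..t}"
      have "((\<lambda>s. sgrp S s (S y)) has_vector_derivative - sgrp S s y) (at s within {0..t})"
        using has_vector_derivative_within_subset[OF sgrp_derivative[OF hyps]] s by auto
      from has_vector_derivative_diff[OF der[OF s] this]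
      show "((\<lambda>s. T s (S y) - sgrp S s (S y)) has_vector_derivative - T s y - - sgrp S s y) (at s within {0..t})" .
      have s0: "s \<ge> 0" using s by simp
      have "T s (S y) - sgrp S s (S y) = S (T s y - sgrp S s y)"
        by (simp add: TS[OF s0] sgrp_S[OF hyps s0] blinfun.diff_right)
      moreover have "0 \<le> inner (S (T s y - sgrp S s y)) (T s y - sgrp S s y)" by (rule accS[OF hyps])
      ultimately show "inner (- T s y - - sgrp S s y) (T s (S y) - sgrp S s (S y)) \<le> 0"
        by (simp add: inner_commute inner_diff_left inner_diff_right inner_minus_left)
    next
      show "T 0 (S y) - sgrp S 0 (S y) = 0" by (simp add: T'(3) sgrp_0[OF hyps])
    qed
    then show ?thesis by simp
  qed
  have "(\<lambda>x. T t x - sgrp S t x) x = 0"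
  proof (rule continuous_constant_on_closure[of "range (blinfun_apply S)" "\<lambda>x. T t x - sgrp S t x"])
    show "continuous_on (closure (range (blinfun_apply S))) (\<lambda>x. T t x - sgrp S t x)"
      by (intro continuous_on_diff linear_continuous_on T'(1)[OF t] bounded_linear_sgrp[OF hyps t])
    show "x \<in> closure (range (blinfun_apply S))" using denseS[OF hyps] by simp
  qed (use eqS in auto)
  then show ?thesis by simp
qed

text \<open>\<open>exp_op\<close> picks some semigroup with generator \<open>G\<close>: existence
  makes the choice meaningful, uniqueness identifies what was chosen.\<close>

lemma exp_op_eq:
  assumes G: "G = {(x, y). x = - S y}" and t: "t \<ge> 0"
  shows "exp_op t G x = sgrp S t x"
proof -
  note hyps = cl \<delta> pS mS inj
  define T where "T = (SOME T. C0_semigroup T \<and> generator T = G)"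
  have "C0_semigroup (sgrp S) \<and> generator (sgrp S) = G"
    unfolding G using C0_semigroup_sgrp[OF hyps] generator_sgrp[OF hyps] by blast
  then have "C0_semigroup T \<and> generator T = G" unfolding T_def by (rule someI[of "\<lambda>T. C0_semigroup T \<and> generator T = G" "sgrp S"])
  then show ?thesis using semigroup_unique[of T t x] t by (simp add: exp_op_def T_def G)
qed

text \<open>The orbit of \<open>x\<close>: \<open>F k\<close> is the orbit followed by the \<open>k\<close>-th power of \<open>S\<^sup>-\<^sup>1\<close>.\<close>

lemma sgrp_orbit:
  "\<exists>F :: nat \<Rightarrow> real \<Rightarrow> 'h. \<forall>t>0. F 0 t = sgrp S t x \<and>
     (\<forall>k. F k t = S (F (Suc k) t) \<and> (F k has_vector_derivative - F (Suc k) t) (at t))"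
proof -
  note hyps = cl \<delta> pS mS inj
  have Sinj: "S y = S z \<Longrightarrow> y = z" for y z using inj[of "y - z"] by (simp add: blinfun.diff_right)
  \<comment> \<open>One half of the time supplies \<open>k\<close> factors \<open>S\<close> by
    induction, the other half one more.\<close>
  have ex: "\<exists>w. sgrp S t x = (blinfun_apply S ^^ k) w" if "t > 0" for k t x
    using that
  proof (induction k arbitrary: t x)
    case (Suc k)
    obtain w where w: "sgrp S (t / 2) x = (blinfun_apply S ^^ k) w" using Suc.IH[of "t / 2" x] Suc.prems by auto
    have t2: "t / 2 > 0" using Suc.prems by simp
    have comm: "sgrp S s ((blinfun_apply S ^^ k) w) = (blinfun_apply S ^^ k) (sgrp S s w)" if "s \<ge> 0" for s w and k
      by (induction k) (simp_all add: sgrp_S[OF hyps that])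
    obtain v where v: "sgrp S (t / 2) w = S v" using sgrp_smoothing[OF hyps t2] by blast
    have "sgrp S t x = sgrp S (t / 2) (sgrp S (t / 2) x)"
      using sgrp_semigroup[OF hyps, of "t / 2" "t / 2" x] t2 by simp
    also have "\<dots> = (blinfun_apply S ^^ k) (S v)" using t2 by (simp add: w comm v)
    also have "\<dots> = (blinfun_apply S ^^ Suc k) v" by (simp add: funpow_swap1)
    finally show ?case by blast
  qed simp
  define F where "F k t = (SOME w. sgrp S t x = (blinfun_apply S ^^ k) w)" for k t
  have F: "sgrp S t x = (blinfun_apply S ^^ k) (F k t)" if "t > 0" for k t
    unfolding F_def by (rule someI_ex[OF ex[OF that]])
  have powinj: "(blinfun_apply S ^^ k) y = (blinfun_apply S ^^ k) z \<Longrightarrow> y = z" for k y z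
    by (induction k) (auto dest: Sinj)
  have FS: "F k t = S (F (Suc k) t)" if "t > 0" for k t
  proof (rule powinj)
    show "(blinfun_apply S ^^ k) (F k t) = (blinfun_apply S ^^ k) (S (F (Suc k) t))"
      using F[OF that, of k] F[OF that, of "Suc k"] by (simp add: funpow_swap1)
  qed
  have comm: "sgrp S s ((blinfun_apply S ^^ k) w) = (blinfun_apply S ^^ k) (sgrp S s w)" if "s \<ge> 0" for s w and k
    by (induction k) (simp_all add: sgrp_S[OF hyps that])
  have Fshift: "F k t = sgrp S (t - r) (F k r)" if "0 < r" "r \<le> t" for k r t
  proof (rule powinj)
    have "sgrp S t x = sgrp S (t - r) (sgrp S r x)" using sgrp_semigroup[OF hyps, of "t - r" r x] that by simp
    then show "(blinfun_apply S ^^ k) (F k t) = (blinfun_apply S ^^ k) (sgrp S (t - r) (F k r))"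
      using F[of t k] F[of r k] that comm[of "t - r"] by simp
  qed
  have der: "(F k has_vector_derivative - F (Suc k) t) (at t)" if t: "t > 0" for k t
  proof -
    \<comment> \<open>Restarting at a positive time: \<open>F k r = S (F (Suc k) r)\<close> lies in
      the range of \<open>S\<close>, where orbits are differentiable, and \<open>r < t\<close> makes
      the derivative at \<open>t\<close> two-sided.\<close>
    define r where "r = t / 2"
    have r: "0 < r" "r < t" using t by (auto simp: r_def)
    have d1: "((\<lambda>s. s - r) has_vector_derivative 1) (at t within {r..})" by (auto intro!: derivative_eq_intros)
    have "((\<lambda>s. sgrp S s (S (F (Suc k) r))) has_vector_derivative - sgrp S (t - r) (F (Suc k) r)) (at (t - r) within (\<lambda>s. s - r) ` {r..})"
    proof (rule has_vector_derivative_within_subset[OF sgrp_derivative[OF hyps]])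
      show "0 \<le> t - r" using r by simp
    qed auto
    from vector_diff_chain_within[OF d1 this]
    have "((\<lambda>s. sgrp S (s - r) (F k r)) has_vector_derivative - F (Suc k) t) (at t within {r..})"
      using Fshift[of r t "Suc k"] FS[OF r(1), of k] r by (simp add: o_def)
    then have "((\<lambda>s. sgrp S (s - r) (F k r)) has_vector_derivative - F (Suc k) t) (at t)"
      using r at_within_interior[of t "{r..}"] by simp
    then show ?thesis
    proof (rule has_vector_derivative_transform_within_open)
      show "open {r<..}" "t \<in> {r<..}" using r by auto
      show "sgrp S (s - r) (F k r) = F k s" if "s \<in> {r<..}" for s
        using Fshift[of r s k] r that by simp
    qed
  qed
  have "F 0 t = sgrp S t x" if "t > 0" for t using F[OF that, of 0] by simp
  then show ?thesis using FS der by blast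
qed

end

section \<open>Fractional powers of the unbounded operator\<close>

definition inv_graph :: "('h::real_normed_vector \<Rightarrow>\<^sub>L 'h) \<Rightarrow> 'h op" where
  "inv_graph C = {(C w, w) |w. True}"

lemma inv_graph_iff: "(x, y) \<in> inv_graph C \<longleftrightarrow> x = C y"
  by (auto simp: inv_graph_def)

lemma app_eqI: "(x, y) \<in> A \<Longrightarrow> (\<And>z. (x, z) \<in> A \<Longrightarrow> z = y) \<Longrightarrow> app A x = y"
  unfolding app_def by (rule the_equality)

lemma app_inv_graph:
  fixes C :: "'h::real_normed_vector \<Rightarrow>\<^sub>L 'h"
  assumes "\<And>x. C x = 0 \<Longrightarrow> x = 0"
  shows "app (inv_graph C) (C w) = w"
proof (rule app_eqI)
  fix z assume "(C w, z) \<in> inv_graph C"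
  then have "C (z - w) = 0" by (simp add: inv_graph_iff blinfun.diff_right)
  then show "z = w" using assms by fastforce
qed (simp add: inv_graph_iff)

lemma app_inv_graph_converse: "app ((inv_graph C)\<inverse>) x = C x"
  by (rule app_eqI) (auto simp: inv_graph_iff)

lemma Domain_inv_graph: "Domain (inv_graph C) = range (blinfun_apply C)"
  by (auto simp: inv_graph_def)

lemma bounded_inverse_of_resolvent:
  fixes A :: "'h::{complex_hilbert_space, second_countable_topology} op"
  assumes lin: "linear_op A" and res: "0 \<in> resolvent_set A"
  obtains K :: "'h \<Rightarrow>\<^sub>L 'h" where "A = inv_graph K" "clinear K" "\<And>x. K x = 0 \<Longrightarrow> x = 0"
proof -
  define R where "R = (shift_op 0 (scale_op (-1) A))\<inverse>"
  \<comment> \<open>The resolvent at 0 is \<open>(0 - A)^-1\<close>, so \<open>R\<close> is the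
    negative of the inverse of \<open>A\<close>.\<close>
  have R_iff: "(z, x) \<in> R \<longleftrightarrow> (x, - z) \<in> A" for x z
  proof
    assume "(z, x) \<in> R"
    then show "(x, - z) \<in> A" by (auto simp: R_def shift_op_def scale_op_def scaleC_zero_left scaleC_minus_left scaleC_one)
  next
    assume "(x, - z) \<in> A"
    then have "(x, (-1) *\<^sub>C (- z)) \<in> scale_op (-1) A" by (auto simp: scale_op_def)
    then have "(x, 0 *\<^sub>C x + (-1) *\<^sub>C (- z)) \<in> shift_op 0 (scale_op (-1) A)" by (auto simp: shift_op_def)
    then show "(z, x) \<in> R" by (simp add: R_def scaleC_zero_left scaleC_minus_left scaleC_one)
  qed
  have R: "everywhere_bounded_op R" using res by (simp add: resolvent_set_def R_def)
  then obtain B where B: "\<And>z x. (z, x) \<in> R \<Longrightarrow> norm x \<le> B * norm z" by (auto simp: everywhere_bounded_op_def)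
  have ex: "\<exists>x. (x, y) \<in> A" for y
  proof -
    have "- y \<in> Domain R" using R by (simp add: everywhere_bounded_op_def)
    then show ?thesis by (auto simp: R_iff)
  qed
  have uniq: "x = x'" if "(x, y) \<in> A" "(x', y) \<in> A" for x x' y
  proof -
    have "single_valued R" using R by (simp add: everywhere_bounded_op_def linear_op_def)
    moreover have "(- y, x) \<in> R" "(- y, x') \<in> R" using that by (simp_all add: R_iff)
    ultimately show ?thesis by (rule single_valuedD)
  qed
  define k where "k y = (SOME x. (x, y) \<in> A)" for y
  have k: "(k y, y) \<in> A" for y unfolding k_def by (rule someI_ex[OF ex])
  have kI: "(x, y) \<in> A \<longleftrightarrow> x = k y" for x y using k uniq by blast
  have kadd: "k (y + y') = k y + k y'" for y y'
    using lin k[of y] k[of y'] kI[of "k y + k y'" "y + y'"] by (auto simp: linear_op_def)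
  have kC: "k (c *\<^sub>C y) = c *\<^sub>C k y" for c y
    using lin k[of y] kI[of "c *\<^sub>C k y" "c *\<^sub>C y"] by (auto simp: linear_op_def)
  have "bounded_linear k"
  proof (rule bounded_linear_intro[OF kadd])
    show "k (r *\<^sub>R x) = r *\<^sub>R k x" for r x by (simp add: scaleR_scaleC kC)
    show "norm (k x) \<le> norm x * B" for x
      using B[of "- x" "k x"] k[of x] by (simp add: R_iff mult.commute)
  qed
  then have K: "blinfun_apply (Blinfun k) = k" by (rule bounded_linear_Blinfun_apply)
  show thesis
  proof
    show "A = inv_graph (Blinfun k)" using kI by (auto simp: inv_graph_iff K)
    show "clinear (Blinfun k)" by (simp add: clinear_def K kC)
    fix x assume "Blinfun k x = 0"
    then have "(0, x) \<in> A" using k[of x] by (simp add: K)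
    moreover have "(0, 0) \<in> A" "single_valued A" using lin by (auto simp: linear_op_def)
    ultimately show "x = 0" by (auto simp: single_valued_def)
  qed
qed

text \<open>For \<open>v = K y\<close> one has \<open><A v, v> = <y, K y>\<close>, the conjugate of
  \<open><K y, y>\<close>; the angle changes sign and the sector is symmetric. The alternative
  \<open>r = 0\<close> covers the value 0, which has no direction.\<close>

lemma numerical_range_inverse:
  fixes K :: "'h::complex_hilbert_space \<Rightarrow>\<^sub>L 'h"
  assumes ang: "angle_accretive \<omega> (inv_graph K)" and cl: "clinear K"
  obtains r \<theta> where "r \<ge> 0" "\<bar>\<theta>\<bar> \<le> \<omega> \<or> r = 0" "cinner (K y) y = of_real r * cis \<theta>"
proof (cases "K y = 0")
  case True
  then have "cinner (K y) y = 0" using cinner_scaleC_left[of 0 0 y] by (simp add: scaleC_zero_left)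
  then show thesis using that[of 0 0] by simp
next
  case False
  define n where "n = norm (K y)"
  have n: "n > 0" using False by (simp add: n_def)
  define y' where "y' = of_real (1 / n) *\<^sub>C y"
  have Ky': "K y' = of_real (1 / n) *\<^sub>C K y" using cl by (simp add: y'_def clinear_def)
  have "norm (K y') = 1" using n unfolding Ky' norm_scaleC by (simp add: n_def norm_divide)
  then have "cinner y' (K y') \<in> numerical_range (inv_graph K)"
    unfolding numerical_range_def by (auto simp: inv_graph_iff)
  then have z: "cinner y' (K y') = 0 \<or> \<bar>Arg (cinner y' (K y'))\<bar> \<le> \<omega>"
    using ang by (auto simp: angle_accretive_def)
  define z where "z = cinner y' (K y')"
  have "z = of_real (1 / n\<^sup>2) * cinner y (K y)"
    by (simp add: z_def Ky' cinner_scaleC_right) (simp add: y'_def cinner_scaleC_left power2_eq_square)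
  then have "cinner y (K y) = of_real (n\<^sup>2) * z" using n by (simp add: field_simps)
  then have w: "cinner (K y) y = of_real (n\<^sup>2) * cnj z" using cinner_commute[of "K y" y] by simp
  have zeq: "z = of_real (cmod z) * cis (Arg z)" by (simp add: rcis_cmod_Arg flip: rcis_def)
  have "cnj z = of_real (cmod z) * cis (- Arg z)"
    by (subst zeq) (simp add: cis_cnj)
  then have "cinner (K y) y = of_real (n\<^sup>2 * cmod z) * cis (- Arg z)" by (simp add: w)
  moreover have "\<bar>- Arg z\<bar> \<le> \<omega> \<or> n\<^sup>2 * cmod z = 0" using z by (auto simp: z_def)
  ultimately show thesis using that[of "n\<^sup>2 * cmod z" "- Arg z"] by simp
qed

context
  fixes K :: "'h::{complex_hilbert_space, second_countable_topology} \<Rightarrow>\<^sub>L 'h" and \<omega> :: real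
  assumes cl: "clinear K" and inj: "\<And>x. K x = 0 \<Longrightarrow> x = 0"
    and ang: "angle_accretive \<omega> (inv_graph K)" and \<omega>: "0 \<le> \<omega>" "\<omega> \<le> pi / 2"
begin

lemma inner_cis_K: "\<exists>r \<theta>. r \<ge> 0 \<and> (\<bar>\<theta>\<bar> \<le> \<omega> \<or> r = 0) \<and> inner (c *\<^sub>C K y) y = r * Re (c * cis \<theta>)"
proof -
  obtain r \<theta> where r: "r \<ge> 0" "\<bar>\<theta>\<bar> \<le> \<omega> \<or> r = 0" and eq: "cinner (K y) y = of_real r * cis \<theta>"
    by (rule numerical_range_inverse[OF ang cl])
  have "inner (c *\<^sub>C K y) y = Re (of_real r * (c * cis \<theta>))"
    unfolding Re_cinner_rotate[symmetric] eq by (simp only: mult_ac)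
  then show ?thesis using r by auto
qed

lemma accK: "0 \<le> inner (K y) y"
proof -
  obtain r \<theta> where "r \<ge> 0" "\<bar>\<theta>\<bar> \<le> \<omega> \<or> r = 0" "inner (K y) y = r * Re (1 * cis \<theta>)"
    using inner_cis_K[of 1 y] by (auto simp: scaleC_one)
  moreover have "\<bar>\<theta>\<bar> \<le> \<omega> \<Longrightarrow> 0 \<le> cos \<theta>" using \<omega> by (intro cos_ge_zero) auto
  ultimately show ?thesis by auto
qed

text \<open>The extreme directions come from \<open>fpow_sector\<close> with
  \<open>c = \<i>, s = \<omega>\<close> and \<open>c = - \<i>, s = - \<omega>\<close>, because
  \<open>\<i> cis (- \<gamma> \<omega>) = cis (pi/2 - \<gamma> \<omega>)\<close>. Accretivity gives
  direction 0, and \<open>Re_cis_cone\<close> fills in what lies between.\<close>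

lemma fpow_numerical_sector:
  assumes g: "0 < \<gamma>" "\<gamma> < 1" and \<tau>: "\<bar>\<tau>\<bar> \<le> pi / 2 - \<gamma> * \<omega>"
  shows "0 \<le> inner (cis \<tau> *\<^sub>C fpow \<gamma> K x) x"
proof -
  define \<phi> where "\<phi> = pi / 2 - \<gamma> * \<omega>"
  have "\<gamma> * \<omega> \<le> \<gamma> * (pi / 2)" using g \<omega> by (intro mult_left_mono) auto
  also have "\<dots> < 1 * (pi / 2)" using g by (intro mult_strict_right_mono) auto
  finally have "\<gamma> * \<omega> < pi / 2" by simp
  moreover have "0 \<le> \<gamma> * \<omega>" using g \<omega> by simp
  ultimately have \<phi>: "0 < \<phi>" "\<phi> < pi" using pi_gt_zero unfolding \<phi>_def by linarith+
  have sinpos: "0 \<le> r * sin (\<omega> + \<theta>)" if "r \<ge> 0" "\<bar>\<theta>\<bar> \<le> \<omega> \<or> r = 0" for r \<theta>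
  proof (cases "r = 0")
    case False
    then have "0 \<le> sin (\<omega> + \<theta>)" using that \<omega> by (intro sin_ge_zero) auto
    then show ?thesis using that by simp
  qed simp
  have n1: "0 \<le> inner ((\<i> * cis (- \<omega>)) *\<^sub>C K y) y" for y
  proof -
    obtain r \<theta> where r: "r \<ge> 0" "\<bar>\<theta>\<bar> \<le> \<omega> \<or> r = 0" and eq: "inner ((\<i> * cis (- \<omega>)) *\<^sub>C K y) y = r * Re (\<i> * cis (- \<omega>) * cis \<theta>)"
      using inner_cis_K[of "\<i> * cis (- \<omega>)" y] by auto
    have "Re (\<i> * cis (- \<omega>) * cis \<theta>) = sin (\<omega> - \<theta>)" by (simp add: sin_diff algebra_simps)
    then show ?thesis unfolding eq using sinpos[of r "- \<theta>"] r by simp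
  qed
  have n2: "0 \<le> inner ((- \<i> * cis (- (- \<omega>))) *\<^sub>C K y) y" for y
  proof -
    obtain r \<theta> where r: "r \<ge> 0" "\<bar>\<theta>\<bar> \<le> \<omega> \<or> r = 0" and eq: "inner ((- \<i> * cis (- (- \<omega>))) *\<^sub>C K y) y = r * Re (- \<i> * cis (- (- \<omega>)) * cis \<theta>)"
      using inner_cis_K[of "- \<i> * cis (- (- \<omega>))" y] by auto
    have "Re (- \<i> * cis (- (- \<omega>)) * cis \<theta>) = sin (\<omega> + \<theta>)" by (simp add: sin_add algebra_simps)
    then show ?thesis unfolding eq using sinpos[of r \<theta>] r by simp
  qed
  have so: "0 \<le> sin \<omega>" using \<omega> by (intro sin_ge_zero) auto
  define w where "w = cinner (fpow \<gamma> K x) x"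
  have w0: "Re w \<ge> 0"
    using fpow_accretive[OF accK g, of x] by (simp add: w_def inner_eq_Re_cinner)
  have "0 \<le> inner ((\<i> * cis (- (\<gamma> * \<omega>))) *\<^sub>C fpow \<gamma> K x) x"
    by (rule fpow_sector[OF accK cl g _ _ _ n1]) (use \<omega> so in auto)
  moreover have "\<i> * cis (- (\<gamma> * \<omega>)) = cis \<phi>"
    by (simp add: complex_eq_iff \<phi>_def sin_diff cos_diff)
  ultimately have "0 \<le> inner (cis \<phi> *\<^sub>C fpow \<gamma> K x) x" by simp
  then have w1: "Re (cis (1 * \<phi>) * w) \<ge> 0" by (simp only: Re_cinner_rotate w_def mult_1)
  have "0 \<le> inner ((- \<i> * cis (- (\<gamma> * (- \<omega>)))) *\<^sub>C fpow \<gamma> K x) x"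
    by (rule fpow_sector[OF accK cl g _ _ _ n2]) (use \<omega> so in auto)
  moreover have "- \<i> * cis (- (\<gamma> * (- \<omega>))) = cis (- \<phi>)"
    by (simp add: complex_eq_iff \<phi>_def sin_diff cos_diff)
  ultimately have "0 \<le> inner (cis (- \<phi>) *\<^sub>C fpow \<gamma> K x) x" by simp
  then have w2: "Re (cis (- 1 * \<phi>) * w) \<ge> 0" by (simp only: Re_cinner_rotate w_def mult_minus1)
  have "Re (cis \<tau> * w) \<ge> 0"
  proof (cases "0 \<le> \<tau>")
    case True
    have "Re (cis (1 * \<tau>) * w) \<ge> 0"
      by (rule Re_cis_cone[where \<phi> = \<phi>]) (use True \<tau> \<phi> w0 w1 in \<open>auto simp: \<phi>_def\<close>)
    then show ?thesis by simp
  next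
    case False
    have "Re (cis (- 1 * (- \<tau>)) * w) \<ge> 0"
      by (rule Re_cis_cone[where \<phi> = \<phi>]) (use False \<tau> \<phi> w0 w2 in \<open>auto simp: \<phi>_def\<close>)
    then show ?thesis by simp
  qed
  then show ?thesis by (simp only: Re_cinner_rotate w_def)
qed

text \<open>The resolvent is \<open>(l + A)^-1 = K rho\<close>, so at \<open>x = K y\<close> the
  integrand \<open>A (l + A)^-1 x\<close> is \<open>rho K y = K rho y\<close>. The weight
  \<open>l powr (\<beta> - 1)\<close> belongs to the exponent \<open>1 - \<beta>\<close>, with the
  same sine factor.\<close>

lemma balakrishnan_eq:
  assumes g: "0 < \<beta>" "\<beta> < 1"
  shows "balakrishnan (inv_graph K) \<beta> = (\<lambda>y. (K y, fpow (1 - \<beta>) K y)) ` UNIV"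
proof -
  note res = res_bound_accretive[OF accK]
  have g': "0 < 1 - \<beta>" "1 - \<beta> < 1" using g by auto
  have app1: "app ((shift_op (complex_of_real l) (inv_graph K))\<inverse>) x = K (rho K l x)" if l: "l > 0" for l x
  proof (rule app_eqI)
    have "(K (rho K l x), of_real l *\<^sub>C K (rho K l x) + rho K l x) \<in> shift_op (complex_of_real l) (inv_graph K)"
      by (auto simp: shift_op_def inv_graph_iff)
    moreover have "of_real l *\<^sub>C K (rho K l x) + rho K l x = x"
      using rho_right[OF res, of l x] l by (simp add: add.commute flip: scaleR_scaleC)
    ultimately show "(x, K (rho K l x)) \<in> (shift_op (complex_of_real l) (inv_graph K))\<inverse>" by simp
    fix z assume "(x, z) \<in> (shift_op (complex_of_real l) (inv_graph K))\<inverse>"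
    then obtain v where v: "z = K v" "x = of_real l *\<^sub>C z + v" by (auto simp: shift_op_def inv_graph_iff)
    have "rho K l x = v"
      by (rule rho_eqI[OF res]) (use l v in \<open>simp_all add: scaleR_scaleC add.commute\<close>)
    then show "z = K (rho K l x)" using v by simp
  qed
  have val: "(sin (pi * \<beta>) / pi) *\<^sub>R (LINT l:{0<..}|lborel. l powr (\<beta> - 1) *\<^sub>R
      app (inv_graph K) (app ((shift_op (complex_of_real l) (inv_graph K))\<inverse>) (K y))) = fpow (1 - \<beta>) K y" for y
  proof -
    have "(LINT l:{0<..}|lborel. l powr (\<beta> - 1) *\<^sub>R
      app (inv_graph K) (app ((shift_op (complex_of_real l) (inv_graph K))\<inverse>) (K y))) =
      (LINT l:{0<..}|lborel. l powr (- (1 - \<beta>)) *\<^sub>R (K o\<^sub>L rho K l) y)"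
      by (rule set_lebesgue_integral_cong) (auto simp: app1 app_inv_graph[OF inj] rho_L[OF res])
    moreover have "sin (pi * (1 - \<beta>)) = sin (pi * \<beta>)" by (simp add: right_diff_distrib sin_diff)
    ultimately show ?thesis by (simp add: fpow_def wint_apply[OF g' wfam_L_rho[OF res]])
  qed
  show ?thesis
    unfolding balakrishnan_def Domain_inv_graph by (auto simp: val image_iff)
qed

text \<open>As \<open>K = K^\<beta> K^(1-\<beta>)\<close>, the Balakrishnan graph consists of the
  pairs \<open>(K^\<beta> w, w)\<close> with \<open>w\<close> in the range of
  \<open>K^(1-\<beta>)\<close>. That range is dense and \<open>K^\<beta>\<close> is continuous, so
  the closure admits every \<open>w\<close>.\<close>

lemma closure_balakrishnan:
  assumes g: "0 < \<beta>" "\<beta> < 1"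
  shows "closure (balakrishnan (inv_graph K) \<beta>) = inv_graph (fpow \<beta> K)"
proof
  have g': "0 < 1 - \<beta>" "1 - \<beta> < 1" using g by auto
  define P where "P = fpow \<beta> K"
  define Q where "Q = fpow (1 - \<beta>) K"
  have PQ: "P (Q y) = K y" for y unfolding P_def Q_def by (rule fpow_prod2[OF accK]) (use g in auto)
  have bal: "balakrishnan (inv_graph K) \<beta> = (\<lambda>w. (P w, w)) ` range (blinfun_apply Q)"
    unfolding balakrishnan_eq[OF g] Q_def[symmetric] by (auto simp: PQ image_iff)
  have "closed (inv_graph P)"
  proof -
    have "inv_graph P = {p. fst p = P (snd p)}" by (auto simp: inv_graph_def)
    moreover have "closed {p :: 'h \<times> 'h. fst p = P (snd p)}"
      by (intro closed_Collect_eq continuous_intros)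
    ultimately show ?thesis by simp
  qed
  moreover have "balakrishnan (inv_graph K) \<beta> \<subseteq> inv_graph P" unfolding bal by (auto simp: inv_graph_iff)
  ultimately show "closure (balakrishnan (inv_graph K) \<beta>) \<subseteq> inv_graph (fpow \<beta> K)"
    unfolding P_def[symmetric] by (intro closure_minimal)
  have "(\<lambda>w. (P w, w)) ` closure (range (blinfun_apply Q)) \<subseteq> closure ((\<lambda>w. (P w, w)) ` range (blinfun_apply Q))"
    by (rule continuous_image_closure_subset[of UNIV]) (auto intro!: continuous_intros)
  moreover have "closure (range (blinfun_apply Q)) = UNIV"
    unfolding Q_def by (rule dense_range_fpow[OF accK inj g'])
  ultimately have "(\<lambda>w. (P w, w)) ` UNIV \<subseteq> closure (balakrishnan (inv_graph K) \<beta>)" by (simp add: bal)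
  then show "inv_graph (fpow \<beta> K) \<subseteq> closure (balakrishnan (inv_graph K) \<beta>)"
    by (auto simp: inv_graph_def P_def)
qed

lemma frac_pow_pos:
  assumes g: "0 < \<beta>" "\<beta> < 1"
  shows "frac_pow (inv_graph K) \<beta> = inv_graph (fpow \<beta> K)"
  using g closure_balakrishnan[OF g] by (simp add: frac_pow_def)

lemma frac_pow_neg:
  assumes g: "0 < \<beta>" "\<beta> < 1"
  shows "frac_pow (inv_graph K) (- \<beta>) = (inv_graph (fpow \<beta> K))\<inverse>"
  using g closure_balakrishnan[OF g] by (simp add: frac_pow_def)

end

text \<open>Puts exponent 0 into the shape used for the other spaces, with the identity as
  inverse.\<close>

lemma frac_pow_zero: "frac_pow A 0 = inv_graph id_blinfun"
  by (auto simp: frac_pow_def inv_graph_iff)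

section \<open>The spaces of continuously differentiable functions\<close>

context
  fixes A :: "'h::{complex_hilbert_space, second_countable_topology} op" and \<beta> :: real
    and P :: "'h \<Rightarrow>\<^sub>L 'h"
  assumes P: "frac_pow A \<beta> = inv_graph P" and inj: "\<And>x. P x = 0 \<Longrightarrow> x = 0"
begin

lemma frac_norm_image: "frac_norm A \<beta> (P w) = norm w"
  by (simp add: frac_norm_def P app_inv_graph[OF inj])

lemma frac_space_eq: "frac_space A \<beta> = range (blinfun_apply P)"
  by (simp add: frac_space_def P Domain_inv_graph)

text \<open>\<open>P\<close> is an isometry from the Hilbert space onto the fractional space, so
  differentiability of \<open>u\<close> there is ordinary differentiability of
  \<open>P^-1 u\<close>; the sequence \<open>e\<close> holds its derivatives.\<close>

lemma Ck_fracI: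
  assumes u: "\<And>t. t > 0 \<Longrightarrow> u t = P (e 0 t)"
    and e: "\<And>j t. t > 0 \<Longrightarrow> (e j has_vector_derivative e (Suc j) t) (at t)"
  shows "Ck_frac A k \<beta> u"
  unfolding Ck_frac_def
proof (intro exI[of _ "\<lambda>j t. P (e j t)"] conjI allI impI)
  fix t :: real assume t: "t > 0"
  show "P (e 0 t) = u t" using u[OF t] by simp
  show "P (e j t) \<in> frac_space A \<beta>" for j by (simp add: frac_space_eq)
  show "((\<lambda>s. frac_norm A \<beta> ((P (e j s) - P (e j t)) /\<^sub>R (s - t) - P (e (Suc j) t))) \<longlongrightarrow> 0) (at t)" for j
  proof -
    have "((\<lambda>s. (e j s - e j t) /\<^sub>R (s - t) - e (Suc j) t) \<longlongrightarrow> 0) (at t)"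
      using e[OF t, of j] by (simp add: has_vector_derivative_iff_tendsto LIM_zero_iff)
    then have "((\<lambda>s. norm ((e j s - e j t) /\<^sub>R (s - t) - e (Suc j) t)) \<longlongrightarrow> 0) (at t)" by (rule tendsto_norm_zero)
    then show ?thesis
      by (simp add: frac_norm_image flip: blinfun.diff_right blinfun.scaleR_right)
  qed
  have "(e k \<longlongrightarrow> e k t) (at t)"
    using has_vector_derivative_continuous[OF e[OF t]] by (simp add: continuous_at)
  then have "((\<lambda>s. norm (e k s - e k t)) \<longlongrightarrow> 0) (at t)" by (intro tendsto_norm_zero LIM_zero)
  then show "((\<lambda>s. frac_norm A \<beta> (P (e k s) - P (e k t))) \<longlongrightarrow> 0) (at t)"
    by (simp add: frac_norm_image flip: blinfun.diff_right)
qed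

text \<open>On the range of \<open>P\<close> the ambient norm is at most \<open>norm P\<close> times
  the fractional one. The latter is meaningful on that range only, so the difference quotients must
  first be seen to lie in it.\<close>

lemma Ck_fracE:
  assumes "Ck_frac A k \<beta> u"
  obtains d where "\<And>t. t > 0 \<Longrightarrow> d 0 t = u t" "\<And>j t. j \<le> k \<Longrightarrow> t > 0 \<Longrightarrow> d j t \<in> range (blinfun_apply P)"
    "\<And>j t. j < k \<Longrightarrow> t > 0 \<Longrightarrow> (d j has_vector_derivative d (Suc j) t) (at t)"
proof -
  obtain d where D: "(\<forall>t>0. d 0 t = u t) \<and> (\<forall>j\<le>k. \<forall>t>0. d j t \<in> frac_space A \<beta>) \<and>
     (\<forall>j<k. \<forall>t>0. ((\<lambda>s. frac_norm A \<beta> ((d j s - d j t) /\<^sub>R (s - t) - d (Suc j) t)) \<longlongrightarrow> 0) (at t)) \<and>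
     (\<forall>t>0. ((\<lambda>s. frac_norm A \<beta> (d k s - d k t)) \<longlongrightarrow> 0) (at t))"
    using assms unfolding Ck_frac_def by (elim exE)
  then have d0: "\<And>t. t > 0 \<Longrightarrow> d 0 t = u t"
    and dr: "\<And>j t. j \<le> k \<Longrightarrow> t > 0 \<Longrightarrow> d j t \<in> frac_space A \<beta>"
    and dd: "\<And>j t. j < k \<Longrightarrow> t > 0 \<Longrightarrow> ((\<lambda>s. frac_norm A \<beta> ((d j s - d j t) /\<^sub>R (s - t) - d (Suc j) t)) \<longlongrightarrow> 0) (at t)"
    by simp_all
  have "(d j has_vector_derivative d (Suc j) t) (at t)" if j: "j < k" and t: "t > 0" for j t
  proof -
    define q where "q s = (d j s - d j t) /\<^sub>R (s - t) - d (Suc j) t" for s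
    have le: "norm (q s) \<le> norm P * frac_norm A \<beta> (q s)" if s: "s > 0" for s
    proof -
      obtain y1 y2 y3 where y: "d j s = P y1" "d j t = P y2" "d (Suc j) t = P y3"
        using dr[of j s] dr[of j t] dr[of "Suc j" t] j s t by (auto simp: frac_space_eq)
      have "q s = P ((y1 - y2) /\<^sub>R (s - t) - y3)" by (simp add: q_def y blinfun.diff_right blinfun.scaleR_right)
      then show ?thesis by (simp add: frac_norm_image norm_blinfun)
    qed
    have ev: "\<forall>\<^sub>F s in at t. norm (q s) \<le> norm P * frac_norm A \<beta> (q s)"
    proof -
      have "\<forall>\<^sub>F s in at t. s \<in> {0<..}" by (rule eventually_at_in_open') (use t in auto)
      then show ?thesis by eventually_elim (use le in auto)
    qed
    have lim: "((\<lambda>s. norm P * frac_norm A \<beta> (q s)) \<longlongrightarrow> 0) (at t)"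
      using tendsto_mult_right_zero[OF dd[OF j t]] by (simp add: q_def)
    have "(q \<longlongrightarrow> 0) (at t)" by (rule Lim_null_comparison[OF ev lim])
    then show ?thesis unfolding has_vector_derivative_iff_tendsto q_def by (rule LIM_zero_cancel)
  qed
  then show thesis using that d0 dr frac_space_eq by blast
qed

end

lemma vderiv_eq:
  assumes d0: "\<And>t. t > 0 \<Longrightarrow> d 0 t = u t"
    and dd: "\<And>j t. j < k \<Longrightarrow> t > 0 \<Longrightarrow> (d j has_vector_derivative d (Suc j) t) (at t)"
  shows "j \<le> k \<Longrightarrow> t > 0 \<Longrightarrow> vderiv j u t = d j t"
proof (induction j arbitrary: t)
  case 0
  then show ?case by (simp add: vderiv_def d0)
next
  case (Suc j)
  have "(d j has_vector_derivative d (Suc j) t) (at t)" using dd Suc.prems by simp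
  then have "(vderiv j u has_vector_derivative d (Suc j) t) (at t)"
    by (rule has_vector_derivative_transform_within_open[of _ _ _ "{0<..}"]) (use Suc in auto)
  then have "vector_derivative (vderiv j u) (at t) = d (Suc j) t" by (rule vector_derivative_at)
  then show ?case by (simp add: vderiv_def)
qed

section \<open>The third order equation\<close>

context
  fixes C :: "'h::{complex_hilbert_space, second_countable_topology} \<Rightarrow>\<^sub>L 'h" and \<theta> \<delta> :: real
  assumes cl: "clinear C" and inj: "\<And>x. C x = 0 \<Longrightarrow> x = 0"
    and \<theta>: "0 < \<theta>" and \<delta>: "0 < \<delta>" "\<delta> < pi / 2"
    and sec: "\<And>\<tau> v. \<bar>\<tau>\<bar> \<le> \<theta> + \<delta> \<Longrightarrow> 0 \<le> inner (cis \<tau> *\<^sub>C C v) v"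
begin

text \<open>The operator \<open>S = - C / c\<close> for \<open>c = - cis (- \<tau>)\<close>, so that
  \<open>- S^-1 = c C^-1\<close>. The angles \<open>\<theta>\<close>, \<open>- \<theta>\<close>, 0
  correspond to \<open>a\<close>, \<open>b\<close>, \<open>-1\<close>.\<close>

definition rot :: "real \<Rightarrow> 'h \<Rightarrow>\<^sub>L 'h" where
  "rot \<tau> = scal (cis \<tau>) o\<^sub>L C"

lemma C_scaleC: "C (c *\<^sub>C x) = c *\<^sub>C C x"
  using cl by (simp add: clinear_def)

lemma rot_hyps:
  assumes "\<bar>\<tau>\<bar> \<le> \<theta>"
  shows "clinear (rot \<tau>)" "0 \<le> inner (cis \<delta> *\<^sub>C rot \<tau> v) v" "0 \<le> inner (cis (- \<delta>) *\<^sub>C rot \<tau> v) v"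
    "rot \<tau> x = 0 \<Longrightarrow> x = 0"
proof -
  show "clinear (rot \<tau>)" unfolding rot_def by (rule clinear_compose[OF clinear_scal cl])
  show "0 \<le> inner (cis \<delta> *\<^sub>C rot \<tau> v) v"
    using sec[of "\<delta> + \<tau>" v] assms \<delta> by (simp add: rot_def scaleC_scaleC cis_mult)
  show "0 \<le> inner (cis (- \<delta>) *\<^sub>C rot \<tau> v) v"
    using sec[of "- \<delta> + \<tau>" v] assms \<delta> by (simp add: rot_def scaleC_scaleC cis_mult)
  assume "rot \<tau> x = 0"
  then have "norm (rot \<tau> x) = 0" by simp
  then have "C x = 0" by (simp add: rot_def norm_scaleC)
  then show "x = 0" by (rule inj)
qed

text \<open>The equation says \<open>p = - cis \<tau> C p'\<close>, so the derivative of
  \<open>|p|^2\<close> is \<open>- 2 <p', cis \<tau> C p'> \<le> 0\<close>. As \<open>p\<close> is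
  given only for positive times, the norm is compared with its limit at 0 instead of a value
  there.\<close>

lemma decay_unique:
  assumes der: "\<And>t. t > 0 \<Longrightarrow> (p has_vector_derivative p' t) (at t)"
    and eq: "\<And>t. t > 0 \<Longrightarrow> C (p' t) = (- cis (- \<tau>)) *\<^sub>C p t"
    and \<tau>: "\<bar>\<tau>\<bar> \<le> \<theta>" and lim: "(p \<longlongrightarrow> 0) (at_right 0)" and t: "t > 0"
  shows "p t = 0"
proof -
  have diss: "2 * inner (p' s) (p s) \<le> 0" if "s > 0" for s
  proof -
    have "cis \<tau> *\<^sub>C C (p' s) = - p s"
      using that by (simp add: eq scaleC_scaleC scaleC_minus_left cis_mult scaleC_one scaleC_minus_right)
    then show ?thesis
      using sec[of \<tau> "p' s"] \<tau> \<delta> by (simp add: inner_commute)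
  qed
  have mono: "norm (p t) \<le> norm (p s)" if s: "s > 0" "s \<le> t" for s
  proof -
    have "(norm (p t))\<^sup>2 \<le> (norm (p s))\<^sup>2"
    proof (rule nonincreasing_of_derivative[OF s(2)])
      fix r assume "r \<in> {s..t}"
      then have r: "r > 0" using s by simp
      show "((\<lambda>r. (norm (p r))\<^sup>2) has_real_derivative 2 * inner (p' r) (p r)) (at r within {s..t})"
        by (rule norm_square_derivative[OF has_vector_derivative_at_within[OF der[OF r]]])
      show "2 * inner (p' r) (p r) \<le> 0" by (rule diss[OF r])
    qed
    then show ?thesis by (rule power2_le_imp_le) simp
  qed
  have "norm (p t) \<le> 0"
  proof (rule tendsto_lowerbound[OF tendsto_norm_zero[OF lim]])
    show "\<forall>\<^sub>F s in at_right 0. norm (p t) \<le> norm (p s)"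
      by (rule eventually_at_rightI[OF mono]) (use t in auto)
  qed simp
  then show ?thesis by simp
qed

text \<open>The equation factors as \<open>(C D + 1) (C D - a) (C D - b) w = 0\<close> with \<open>D\<close> the time derivative.\<close>

lemma third_order_unique:
  fixes w :: "nat \<Rightarrow> real \<Rightarrow> 'h"
  assumes a: "a = - cis (- \<theta>)" and b: "b = - cis \<theta>"
    and der: "\<And>j t. j < 3 \<Longrightarrow> t > 0 \<Longrightarrow> (w j has_vector_derivative w (Suc j) t) (at t)"
    and eq: "\<And>t. t > 0 \<Longrightarrow> C (C (C (w 3 t))) + (1 - (a + b)) *\<^sub>C C (C (w 2 t)) + (1 - (a + b)) *\<^sub>C C (w 1 t) + w 0 t = 0"
    and lim: "\<And>j. j < 3 \<Longrightarrow> (w j \<longlongrightarrow> 0) (at_right 0)" and t: "t > 0"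
  shows "w 0 t = 0"
proof -
  have ab: "a * b = 1" by (simp add: a b cis_mult)
  have d0: "(w 0 has_vector_derivative w 1 t) (at t)" and d1: "(w 1 has_vector_derivative w 2 t) (at t)"
    and d2: "(w 2 has_vector_derivative w 3 t) (at t)" if "t > 0" for t
    using der[of 0 t] der[of 1 t] der[of 2 t] that by (simp_all add: numeral_2_eq_2 numeral_3_eq_3)
  have l0: "(w 0 \<longlongrightarrow> 0) (at_right 0)" and l1: "(w 1 \<longlongrightarrow> 0) (at_right 0)" and l2: "(w 2 \<longlongrightarrow> 0) (at_right 0)"
    using lim by simp_all
  note dC = bounded_linear.has_vector_derivative[OF blinfun.bounded_linear_right[of C]]
  note ds = bounded_linear.has_vector_derivative[OF bounded_linear_scaleC]
  note lC = bounded_linear.tendsto_zero[OF blinfun.bounded_linear_right[of C]]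
  note ls = bounded_linear.tendsto_zero[OF bounded_linear_scaleC]
  define p where "p t = C (C (w 2 t)) - (a + b) *\<^sub>C C (w 1 t) + w 0 t" for t
  define p' where "p' t = C (C (w 3 t)) - (a + b) *\<^sub>C C (w 2 t) + w 1 t" for t
  have p0: "p t = 0" if t: "t > 0" for t
  proof (rule decay_unique[where \<tau> = 0 and p' = p'])
    show "(p has_vector_derivative p' t) (at t)" if "t > 0" for t
      unfolding p_def p'_def
      by (intro has_vector_derivative_add has_vector_derivative_diff dC ds d0 d1 d2 that)
    show "C (p' t) = (- cis (- 0)) *\<^sub>C p t" if "t > 0" for t
    proof -
      have "C (p' t) + p t = C (C (C (w 3 t))) + (1 - (a + b)) *\<^sub>C C (C (w 2 t)) + (1 - (a + b)) *\<^sub>C C (w 1 t) + w 0 t"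
        by (simp add: p_def p'_def blinfun.add_right blinfun.diff_right C_scaleC scaleC_diff_left scaleC_one)
      then have "C (p' t) = - p t" using eq[OF that] by (simp add: eq_neg_iff_add_eq_0)
      then show ?thesis by (simp add: scaleC_minus_left scaleC_one)
    qed
    have "(p \<longlongrightarrow> 0 - 0 + 0) (at_right 0)"
      unfolding p_def by (intro tendsto_add tendsto_diff lC ls l0 l1 l2)
    then show "(p \<longlongrightarrow> 0) (at_right 0)" by simp
  qed (use t \<theta> in auto)
  define q where "q t = C (w 1 t) - a *\<^sub>C w 0 t" for t
  define q' where "q' t = C (w 2 t) - a *\<^sub>C w 1 t" for t
  have q0: "q t = 0" if t: "t > 0" for t
  proof (rule decay_unique[where \<tau> = "- \<theta>" and p' = q'])
    show "(q has_vector_derivative q' t) (at t)" if "t > 0" for t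
      unfolding q_def q'_def
      by (intro has_vector_derivative_diff dC ds d0 d1 that)
    show "C (q' t) = (- cis (- (- \<theta>))) *\<^sub>C q t" if "t > 0" for t
    proof -
      have "C (q' t) - b *\<^sub>C q t = p t"
        using ab by (simp add: p_def q_def q'_def blinfun.diff_right C_scaleC scaleC_diff_right scaleC_add_left scaleC_scaleC
          mult.commute scaleC_one)
      then show ?thesis using p0[OF that] by (simp add: b)
    qed
    have "(q \<longlongrightarrow> 0 - 0) (at_right 0)"
      unfolding q_def by (intro tendsto_diff lC ls l0 l1)
    then show "(q \<longlongrightarrow> 0) (at_right 0)" by simp
  qed (use t \<theta> in auto)
  show ?thesis
  proof (rule decay_unique[where \<tau> = \<theta> and p' = "w 1"])
    show "C (w 1 t) = (- cis (- \<theta>)) *\<^sub>C w 0 t" if "t > 0" for t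
      using q0[OF that] by (simp add: q_def a)
  qed (use t \<theta> d0 l0 in auto)
qed

lemma exp_op_rot:
  assumes \<tau>: "\<bar>\<tau>\<bar> \<le> \<theta>" and t: "t \<ge> 0"
  shows "exp_op t (scale_op (- cis (- \<tau>)) (inv_graph C)) x = sgrp (rot \<tau>) t x"
proof (rule exp_op_eq[OF rot_hyps(1)[OF \<tau>] \<delta> rot_hyps(2,3,4)[OF \<tau>] _ t])
  show "scale_op (- cis (- \<tau>)) (inv_graph C) = {(x, y). x = - rot \<tau> y}"
  proof (intro set_eqI iffI; clarify)
    fix x y assume "(x, y) \<in> scale_op (- cis (- \<tau>)) (inv_graph C)"
    then show "x = - rot \<tau> y"
      by (auto simp: scale_op_def inv_graph_iff rot_def C_scaleC scaleC_minus_left scaleC_minus_right blinfun.minus_right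
          scaleC_scaleC cis_mult scaleC_one)
  next
    fix y
    have "(- rot \<tau> y, - (cis \<tau> *\<^sub>C y)) \<in> inv_graph C"
      by (simp add: inv_graph_iff rot_def C_scaleC blinfun.minus_right)
    then have "(- rot \<tau> y, (- cis (- \<tau>)) *\<^sub>C (- (cis \<tau> *\<^sub>C y))) \<in> scale_op (- cis (- \<tau>)) (inv_graph C)"
      by (auto simp: scale_op_def)
    then show "(- rot \<tau> y, y) \<in> scale_op (- cis (- \<tau>)) (inv_graph C)"
      by (simp add: scaleC_minus_left scaleC_minus_right scaleC_scaleC cis_mult scaleC_one)
  qed
qed

lemma sgrp_rot_linear:
  assumes \<tau>: "\<bar>\<tau>\<bar> \<le> \<theta>" and t: "t \<ge> 0"
  shows "sgrp (rot \<tau>) t (x + y) = sgrp (rot \<tau>) t x + sgrp (rot \<tau>) t y"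
    "sgrp (rot \<tau>) t (c *\<^sub>C x) = c *\<^sub>C sgrp (rot \<tau>) t x"
    "C (sgrp (rot \<tau>) t x) = sgrp (rot \<tau>) t (C x)"
proof -
  note h = rot_hyps(1)[OF \<tau>] \<delta> rot_hyps(2,3,4)[OF \<tau>]
  show "sgrp (rot \<tau>) t (x + y) = sgrp (rot \<tau>) t x + sgrp (rot \<tau>) t y" by (rule sgrp_add[OF h t])
  show "sgrp (rot \<tau>) t (c *\<^sub>C x) = c *\<^sub>C sgrp (rot \<tau>) t x" by (rule sgrp_scaleC[OF h t])
  show "C (sgrp (rot \<tau>) t x) = sgrp (rot \<tau>) t (C x)"
  proof (rule sgrp_commute[OF h t])
    fix x
    show "C (rot \<tau> x) = rot \<tau> (C x)" unfolding rot_def by (simp add: C_scaleC)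
  qed
qed

text \<open>The factor \<open>cis \<tau> ^ k\<close> converts powers of the inverse of
  \<open>rot \<tau>\<close> into powers of \<open>C^-1\<close>, which are common to all three angles
  and can therefore be added up.\<close>

lemma rot_orbit:
  assumes \<tau>: "\<bar>\<tau>\<bar> \<le> \<theta>"
  shows "\<exists>G :: nat \<Rightarrow> real \<Rightarrow> 'h. \<forall>t>0. G 0 t = sgrp (rot \<tau>) t x \<and>
    (\<forall>k. C (G (Suc k) t) = G k t \<and> (G k has_vector_derivative (- cis (- \<tau>)) *\<^sub>C G (Suc k) t) (at t))"
proof -
  note h = rot_hyps(1)[OF \<tau>] \<delta> rot_hyps(2,3,4)[OF \<tau>]
  obtain F :: "nat \<Rightarrow> real \<Rightarrow> 'h" where F: "\<forall>t>0. F 0 t = sgrp (rot \<tau>) t x \<and>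
     (\<forall>k. F k t = rot \<tau> (F (Suc k) t) \<and> (F k has_vector_derivative - F (Suc k) t) (at t))"
    using sgrp_orbit[OF h, of x] by blast
  define G where "G k t = cis \<tau> ^ k *\<^sub>C F k t" for k t
  have "G 0 t = sgrp (rot \<tau>) t x" if "t > 0" for t
    unfolding G_def power_0 scaleC_one by (rule F[rule_format, OF that, THEN conjunct1])
  moreover have "C (G (Suc k) t) = G k t" if "t > 0" for k t
  proof -
    have "F k t = rot \<tau> (F (Suc k) t)" by (rule F[rule_format, OF that, THEN conjunct2, THEN spec, THEN conjunct1])
    also have "\<dots> = cis \<tau> *\<^sub>C C (F (Suc k) t)" by (simp add: rot_def)
    finally have eq: "F k t = cis \<tau> *\<^sub>C C (F (Suc k) t)" .
    have "C (G (Suc k) t) = cis \<tau> ^ k *\<^sub>C (cis \<tau> *\<^sub>C C (F (Suc k) t))"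
      by (simp add: G_def C_scaleC scaleC_scaleC mult.commute)
    also have "\<dots> = G k t" unfolding G_def eq[symmetric] ..
    finally show ?thesis .
  qed
  moreover have "(G k has_vector_derivative (- cis (- \<tau>)) *\<^sub>C G (Suc k) t) (at t)" if "t > 0" for k t
  proof -
    have "(F k has_vector_derivative - F (Suc k) t) (at t)" by (rule F[rule_format, OF that, THEN conjunct2, THEN spec, THEN conjunct2])
    from bounded_linear.has_vector_derivative[OF bounded_linear_scaleC this]
    have "(G k has_vector_derivative cis \<tau> ^ k *\<^sub>C (- F (Suc k) t)) (at t)" by (simp add: G_def[abs_def])
    moreover have "(- cis (- \<tau>)) *\<^sub>C G (Suc k) t = cis \<tau> ^ k *\<^sub>C (- F (Suc k) t)"
    proof -
      have "cis (- \<tau>) * cis \<tau> ^ Suc k = (cis (- \<tau>) * cis \<tau>) * cis \<tau> ^ k" by simp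
      also have "\<dots> = cis \<tau> ^ k" by (simp only: cis_mult) simp
      finally have "cis (- \<tau>) * cis \<tau> ^ Suc k = cis \<tau> ^ k" .
      then show ?thesis by (simp only: G_def scaleC_minus_left scaleC_minus_right scaleC_scaleC mult_minus_left)
    qed
    ultimately show ?thesis by simp
  qed
  ultimately show ?thesis by blast
qed

text \<open>\<open>D k m\<close> stands for the \<open>k\<close>-th derivative of the solution followed by the \<open>m\<close>-th power of \<open>C\<^sup>-\<^sup>1\<close>.\<close>

lemma orbit_sum:
  fixes z :: "real \<Rightarrow> 'h"
  defines "c \<equiv> \<lambda>\<tau>. - cis (- \<tau>)"
  shows "\<exists>D :: nat \<Rightarrow> nat \<Rightarrow> real \<Rightarrow> 'h.
    (\<forall>k m. \<forall>t>0. C (D k (Suc m) t) = D k m t) \<and>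
    (\<forall>k m. \<forall>t>0. (D k m has_vector_derivative D (Suc k) (Suc m) t) (at t)) \<and>
    (\<forall>t>0. D 0 0 t = (\<Sum>\<tau>\<in>{\<theta>, - \<theta>, 0}. sgrp (rot \<tau>) t (C (C (z \<tau>))))) \<and>
    (D 0 0 \<longlongrightarrow> C (C (\<Sum>\<tau>\<in>{\<theta>, - \<theta>, 0}. z \<tau>))) (at_right 0) \<and>
    (D 1 1 \<longlongrightarrow> C (\<Sum>\<tau>\<in>{\<theta>, - \<theta>, 0}. c \<tau> *\<^sub>C z \<tau>)) (at_right 0) \<and>
    (D 2 2 \<longlongrightarrow> (\<Sum>\<tau>\<in>{\<theta>, - \<theta>, 0}. (c \<tau>)\<^sup>2 *\<^sub>C z \<tau>)) (at_right 0) \<and>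
    (\<forall>m. \<forall>t>0. D 3 m t + (1 - (c \<theta> + c (- \<theta>))) *\<^sub>C D 2 m t + (1 - (c \<theta> + c (- \<theta>))) *\<^sub>C D 1 m t + D 0 m t = 0)"
proof -
  define T where "T = {\<theta>, - \<theta>, 0}"
  have T: "\<bar>\<tau>\<bar> \<le> \<theta>" if "\<tau> \<in> T" for \<tau> using that \<theta> by (auto simp: T_def)
  have "\<exists>G :: nat \<Rightarrow> real \<Rightarrow> 'h. \<tau> \<in> T \<longrightarrow> (\<forall>t>0. G 0 t = sgrp (rot \<tau>) t (C (C (z \<tau>))) \<and>
    (\<forall>k. C (G (Suc k) t) = G k t \<and> (G k has_vector_derivative c \<tau> *\<^sub>C G (Suc k) t) (at t)))" for \<tau>
    unfolding c_def using rot_orbit[OF T] by blast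
  then obtain G :: "real \<Rightarrow> nat \<Rightarrow> real \<Rightarrow> 'h" where
    G: "\<And>\<tau>. \<tau> \<in> T \<Longrightarrow> (\<forall>t>0. G \<tau> 0 t = sgrp (rot \<tau>) t (C (C (z \<tau>))) \<and>
    (\<forall>k. C (G \<tau> (Suc k) t) = G \<tau> k t \<and> (G \<tau> k has_vector_derivative c \<tau> *\<^sub>C G \<tau> (Suc k) t) (at t)))"
    by metis
  have G0: "G \<tau> 0 t = sgrp (rot \<tau>) t (C (C (z \<tau>)))" and GC: "C (G \<tau> (Suc k) t) = G \<tau> k t"
    and Gd: "(G \<tau> k has_vector_derivative c \<tau> *\<^sub>C G \<tau> (Suc k) t) (at t)" if "\<tau> \<in> T" "t > 0" for \<tau> k t
    using G[OF that(1)] that(2) by auto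
  have Cinj: "x = y" if "C x = C y" for x y
    using inj[of "x - y"] that by (simp add: blinfun.diff_right)
  \<comment> \<open>The initial vector \<open>C (C (z \<tau>))\<close> loses one factor
    \<open>C\<close> at each step, so for \<open>m \<le> 2\<close> the function
    \<open>G \<tau> m\<close> is again a semigroup orbit. This is what the limits at 0 rest
    on.\<close>
  have G1: "G \<tau> 1 t = sgrp (rot \<tau>) t (C (z \<tau>))" if "\<tau> \<in> T" "t > 0" for \<tau> t
  proof (rule Cinj)
    show "C (G \<tau> 1 t) = C (sgrp (rot \<tau>) t (C (z \<tau>)))"
      using GC[OF that, of 0] G0[OF that] that(2) sgrp_rot_linear(3)[OF T[OF that(1)], of t] by simp
  qed
  have G2: "G \<tau> 2 t = sgrp (rot \<tau>) t (z \<tau>)" if "\<tau> \<in> T" "t > 0" for \<tau> t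
  proof (rule Cinj)
    show "C (G \<tau> 2 t) = C (sgrp (rot \<tau>) t (z \<tau>))"
      using GC[OF that, of 1] G1[OF that] that(2) sgrp_rot_linear(3)[OF T[OF that(1)], of t] by (simp add: numeral_2_eq_2)
  qed
  have slim: "((\<lambda>t. sgrp (rot \<tau>) t x) \<longlongrightarrow> x) (at_right 0)" if "\<tau> \<in> T" for \<tau> x
    by (rule sgrp_tendsto_0[OF rot_hyps(1)[OF T[OF that]] \<delta> rot_hyps(2,3,4)[OF T[OF that]]])
  have evpos: "\<forall>\<^sub>F t in at_right (0::real). t > 0" by (simp add: eventually_at_filter)
  have Glim0: "(G \<tau> 0 \<longlongrightarrow> C (C (z \<tau>))) (at_right 0)" if "\<tau> \<in> T" for \<tau>
    by (rule Lim_transform_eventually[OF slim[OF that, of "C (C (z \<tau>))"]])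
      (use evpos in \<open>eventually_elim, simp add: G0[OF that]\<close>)
  have Glim1: "(G \<tau> 1 \<longlongrightarrow> C (z \<tau>)) (at_right 0)" if "\<tau> \<in> T" for \<tau>
    by (rule Lim_transform_eventually[OF slim[OF that, of "C (z \<tau>)"]])
      (use evpos in \<open>eventually_elim, simp add: G1[OF that, simplified]\<close>)
  have Glim2: "(G \<tau> 2 \<longlongrightarrow> z \<tau>) (at_right 0)" if "\<tau> \<in> T" for \<tau>
    by (rule Lim_transform_eventually[OF slim[OF that, of "z \<tau>"]])
      (use evpos in \<open>eventually_elim, simp add: G2[OF that]\<close>)
  define D where "D k m t = (\<Sum>\<tau>\<in>T. c \<tau> ^ k *\<^sub>C G \<tau> m t)" for k m t
  note lims = bounded_linear.tendsto[OF bounded_linear_scaleC]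
  show ?thesis
    unfolding T_def[symmetric]
  proof (intro exI[of _ D] conjI allI impI)
    fix k m :: nat and t :: real assume t: "t > 0"
    show "C (D k (Suc m) t) = D k m t"
      unfolding D_def blinfun.sum_right C_scaleC by (rule sum.cong) (simp_all add: GC t)
    have "((\<lambda>t. c \<tau> ^ k *\<^sub>C G \<tau> m t) has_vector_derivative c \<tau> ^ Suc k *\<^sub>C G \<tau> (Suc m) t) (at t)" if "\<tau> \<in> T" for \<tau>
      using bounded_linear.has_vector_derivative[OF bounded_linear_scaleC Gd[OF that t], of "c \<tau> ^ k" m]
      by (simp add: scaleC_scaleC mult.commute)
    then show "(D k m has_vector_derivative D (Suc k) (Suc m) t) (at t)"
      unfolding D_def by (intro has_vector_derivative_sum)
  next
    fix t :: real assume t: "t > 0"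
    show "D 0 0 t = (\<Sum>\<tau>\<in>T. sgrp (rot \<tau>) t (C (C (z \<tau>))))"
      unfolding D_def by (rule sum.cong) (simp_all add: G0 t scaleC_one)
  next
    have "(D 0 0 \<longlongrightarrow> (\<Sum>\<tau>\<in>T. c \<tau> ^ 0 *\<^sub>C C (C (z \<tau>)))) (at_right 0)"
      unfolding D_def by (intro tendsto_sum lims Glim0)
    then show "(D 0 0 \<longlongrightarrow> C (C (\<Sum>\<tau>\<in>T. z \<tau>))) (at_right 0)" by (simp add: scaleC_one blinfun.sum_right)
    have "(D 1 1 \<longlongrightarrow> (\<Sum>\<tau>\<in>T. c \<tau> ^ 1 *\<^sub>C C (z \<tau>))) (at_right 0)"
      unfolding D_def by (intro tendsto_sum lims Glim1)
    then show "(D 1 1 \<longlongrightarrow> C (\<Sum>\<tau>\<in>T. c \<tau> *\<^sub>C z \<tau>)) (at_right 0)" by (simp add: blinfun.sum_right C_scaleC)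
    show "(D 2 2 \<longlongrightarrow> (\<Sum>\<tau>\<in>T. (c \<tau>)\<^sup>2 *\<^sub>C z \<tau>)) (at_right 0)"
      unfolding D_def by (intro tendsto_sum lims Glim2)
  next
    fix m :: nat and t :: real
    define Y where "Y = 1 - (c \<theta> + c (- \<theta>))"
    have cc: "c \<theta> * c (- \<theta>) = 1" by (simp add: c_def cis_mult)
    have char: "c \<tau> ^ 3 + Y * c \<tau> ^ 2 + Y * c \<tau> + 1 = 0" if "\<tau> \<in> T" for \<tau>
    proof -
      have fac: "x ^ 3 + Y * x ^ 2 + Y * x + 1 = (x + 1) * (x - c \<theta>) * (x - c (- \<theta>))" for x
      proof -
        have "(x + 1) * (x - c \<theta>) * (x - c (- \<theta>)) = (x + 1) * (x ^ 2 - (c \<theta> + c (- \<theta>)) * x + c \<theta> * c (- \<theta>))"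
          by (simp add: algebra_simps power2_eq_square)
        also have "\<dots> = x ^ 3 + Y * x ^ 2 + Y * x + 1"
          unfolding cc by (simp add: Y_def algebra_simps power2_eq_square power3_eq_cube)
        finally show ?thesis by simp
      qed
      have "c 0 = - 1" by (simp add: c_def)
      then show ?thesis using that unfolding fac by (auto simp: T_def)
    qed
    have "D 3 m t + Y *\<^sub>C D 2 m t + Y *\<^sub>C D 1 m t + D 0 m t =
      (\<Sum>\<tau>\<in>T. (c \<tau> ^ 3 + Y * c \<tau> ^ 2 + Y * c \<tau> + 1) *\<^sub>C G \<tau> m t)"
    proof -
      have sc: "Y *\<^sub>C (\<Sum>\<tau>\<in>T. f \<tau>) = (\<Sum>\<tau>\<in>T. Y *\<^sub>C f \<tau>)" for f :: "real \<Rightarrow> 'h"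
        by (rule linear_sum[OF bounded_linear.linear[OF bounded_linear_scaleC]])
      show ?thesis
        unfolding D_def sc by (simp add: scaleC_add_left scaleC_scaleC sum.distrib)
    qed
    also have "\<dots> = 0" by (rule sum.neutral) (simp add: char scaleC_zero_left)
    finally show "D 3 m t + (1 - (c \<theta> + c (- \<theta>))) *\<^sub>C D 2 m t + (1 - (c \<theta> + c (- \<theta>))) *\<^sub>C D 1 m t + D 0 m t = 0"
      by (simp add: Y_def)
  qed
qed

end

text \<open>Divided by \<open>1 + b\<close>, the numbers \<open>jb\<close>, \<open>- ja\<close>,
  \<open>jm\<close> are the weights of the second divided difference at the nodes \<open>b\<close>,
  \<open>a\<close>, \<open>-1\<close>. It annihilates 1 and x and maps x^2 to 1.\<close>

lemma coefficient_identities: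
  fixes a b :: complex
  assumes "1 + a \<noteq> 0" "1 + b \<noteq> 0" "b - a \<noteq> 0"
  defines "ja \<equiv> (1 + b) / ((1 + a) * (b - a))" and "jb \<equiv> 1 / (b - a)" and "jm \<equiv> 1 / (1 + a)"
  shows "jb - ja + jm = 0" "b * jb - a * ja - jm = 0" "b\<^sup>2 * jb - a\<^sup>2 * ja + jm = 1 + b"
proof -
  define d e f where "d = 1 + a" and "e = 1 + b" and "f = b - a"
  have nz: "d \<noteq> 0" "f \<noteq> 0" using assms by (auto simp: d_def f_def)
  have j: "ja = e / (d * f)" "jb = d / (d * f)" "jm = f / (d * f)"
    using nz by (simp_all add: ja_def jb_def jm_def d_def e_def f_def)
  have "jb - ja + jm = (d - e + f) / (d * f)" by (simp only: j diff_divide_distrib add_divide_distrib)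
  also have "d - e + f = 0" by (simp add: d_def e_def f_def)
  finally show "jb - ja + jm = 0" by simp
  have "b * jb - a * ja - jm = (b * d - a * e - f) / (d * f)"
    by (simp only: j diff_divide_distrib add_divide_distrib times_divide_eq_right)
  also have "b * d - a * e - f = 0" by (simp add: d_def e_def f_def algebra_simps)
  finally show "b * jb - a * ja - jm = 0" by simp
  have "b\<^sup>2 * jb - a\<^sup>2 * ja + jm = (b\<^sup>2 * d - a\<^sup>2 * e + f) / (d * f)"
    by (simp only: j diff_divide_distrib add_divide_distrib times_divide_eq_right)
  also have "b\<^sup>2 * d - a\<^sup>2 * e + f = (1 + b) * (d * f)"
    by (simp add: d_def e_def f_def algebra_simps power2_eq_square)
  finally show "b\<^sup>2 * jb - a\<^sup>2 * ja + jm = 1 + b" using nz by simp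
qed

text \<open>Regroups a sum ordered by nodes, one bracket per semigroup, into the Newton form ordered
  by data.\<close>

lemma scaleC_formula:
  fixes fa fb fm pa pb pm qa qb qm :: "'h::complex_hilbert_space"
  shows "((1 + r1 - r2 * ja) *\<^sub>C fa + (r4 * ja - r3) *\<^sub>C pa + (- (r5 * ja)) *\<^sub>C qa)
      + (((r2 * jb - r1) *\<^sub>C fb + (r3 - r4 * jb) *\<^sub>C pb + (r5 * jb) *\<^sub>C qb)
      + ((r2 * jm) *\<^sub>C fm + (- (r4 * jm)) *\<^sub>C pm + (r5 * jm) *\<^sub>C qm))
    = fa - r1 *\<^sub>C (fb - fa) + r2 *\<^sub>C (jb *\<^sub>C fb - ja *\<^sub>C fa + jm *\<^sub>C fm)
      + r3 *\<^sub>C (pb - pa) - r4 *\<^sub>C (jb *\<^sub>C pb - ja *\<^sub>C pa + jm *\<^sub>C pm)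
      + r5 *\<^sub>C (jb *\<^sub>C qb - ja *\<^sub>C qa + jm *\<^sub>C qm)"
  by (simp add: scaleC_add_left scaleC_diff_left scaleC_minus_left scaleC_add_right scaleC_diff_right
      scaleC_scaleC scaleC_one)

lemma scaleC_collect:
  fixes f p q :: "'h::complex_hilbert_space"
  shows "ca *\<^sub>C (a1 *\<^sub>C f + a2 *\<^sub>C p + a3 *\<^sub>C q) + (cb *\<^sub>C (b1 *\<^sub>C f + b2 *\<^sub>C p + b3 *\<^sub>C q) + cm *\<^sub>C (m1 *\<^sub>C f + m2 *\<^sub>C p + m3 *\<^sub>C q))
    = (ca * a1 + cb * b1 + cm * m1) *\<^sub>C f + (ca * a2 + cb * b2 + cm * m2) *\<^sub>C p + (ca * a3 + cb * b3 + cm * m3) *\<^sub>C q"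
  by (simp add: scaleC_add_left scaleC_add_right scaleC_scaleC)

theorem theorem3p1:
  fixes A :: "'h::{complex_hilbert_space, second_countable_topology} op"
    and \<omega> \<alpha> :: real
    and \<phi> \<psi> \<xi> :: 'h
    and a b :: complex
    and E :: "complex \<Rightarrow> real \<Rightarrow> 'h \<Rightarrow> 'h"
    and J :: "real \<Rightarrow> 'h \<Rightarrow> 'h"
  assumes "0 \<le> \<omega>" "\<omega> \<le> pi / 2"
    and "m_angle_accretive \<omega> A"
    and "0 \<in> resolvent_set A"
    and "0 < \<alpha>" "\<alpha> < 3 * pi / (4 * pi + 2 * \<omega>)"
    and "\<phi> \<in> frac_space A (2 / 3)"
    and "\<psi> \<in> frac_space A ((2 - \<alpha>) / 3)"
    and "\<xi> \<in> frac_space A ((2 - 2 * \<alpha>) / 3)"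
    and "a = exp (\<i> * complex_of_real (pi * ((3 - 2 * \<alpha>) / 3)))"
    and "b = exp (\<i> * complex_of_real (pi * ((3 + 2 * \<alpha>) / 3)))"
    and "\<And>c t. E c t = exp_op t (scale_op c (frac_pow A (\<alpha> / 3)))"
    and "\<And>t x. J t x = (1 / (b - a)) *\<^sub>C E b t x
                      - ((1 + b) / ((1 + a) * (b - a))) *\<^sub>C E a t x
                      + (1 / (1 + a)) *\<^sub>C E (-1) t x"
  shows "\<exists>u. is_solution A \<alpha> \<phi> \<psi> \<xi> u
           \<and> (\<forall>v. is_solution A \<alpha> \<phi> \<psi> \<xi> v \<longrightarrow> (\<forall>t>0. v t = u t))
           \<and> (\<forall>t>0. u t =
                 E a t \<phi>
               - (a / (b - a)) *\<^sub>C (E b t \<phi> - E a t \<phi>)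
               + (a * b / (1 + b)) *\<^sub>C J t \<phi>
               + (1 / (b - a)) *\<^sub>C app (frac_pow A (- (\<alpha> / 3))) (E b t \<psi> - E a t \<psi>)
               - ((a + b) / (1 + b)) *\<^sub>C app (frac_pow A (- (\<alpha> / 3))) (J t \<psi>)
               + (1 / (1 + b)) *\<^sub>C app (frac_pow A (- (2 * \<alpha> / 3))) (J t \<xi>))"
proof -

  \<comment> \<open>Reduction to the bounded inverse and the size of the exponents\<close>
  note \<omega> = assms(1,2) and \<alpha>0 = assms(5) and E = assms(12) and J = assms(13)
  have ang: "angle_accretive \<omega> A" and lin: "linear_op A"
    using assms(3) by (auto simp: m_angle_accretive_def angle_accretive_def)
  obtain K :: "'h \<Rightarrow>\<^sub>L 'h" where A: "A = inv_graph K" and clK: "clinear K" and injK: "\<And>x. K x = 0 \<Longrightarrow> x = 0"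
    by (rule bounded_inverse_of_resolvent[OF lin assms(4)]) blast
  note hK = clK injK ang[unfolded A] \<omega>
  have accK: "\<And>y. 0 \<le> inner (K y) y" by (rule accK[OF hK])
  have "0 < 4 * pi + 2 * \<omega>" using \<omega> pi_gt_zero by linarith
  then have \<alpha>1: "\<alpha> * (4 * pi + 2 * \<omega>) < 3 * pi" using assms(6) by (simp add: pos_less_divide_eq)
  have "\<alpha> * (4 * pi) \<le> \<alpha> * (4 * pi + 2 * \<omega>)" using \<alpha>0 \<omega> by (intro mult_left_mono) auto
  then have "\<alpha> * (4 * pi) < 3 * pi" using \<alpha>1 by linarith
  then have "(\<alpha> * 4) * pi < 3 * pi" by (simp only: mult.assoc)
  \<comment> \<open>The value of the bound at \<open>\<omega> = 0\<close>. It puts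
    \<open>\<alpha>\<close>, \<open>2 \<alpha> / 3\<close> and the exponents of the data spaces into
    the open unit interval and \<open>\<theta>\<close> below \<open>pi\<close>.\<close>
  then have \<alpha>2: "\<alpha> < 3 / 4" using pi_gt_zero by (simp add: mult_less_cancel_right)

  \<comment> \<open>Powers of \<open>C\<close> and the sector margin\<close>
  define C where "C = fpow (\<alpha> / 3) K"
  define P2 where "P2 = fpow (2 * \<alpha> / 3) K"
  define P3 where "P3 = fpow \<alpha> K"
  define \<theta> where "\<theta> = 2 * pi * \<alpha> / 3"
  \<comment> \<open>Here \<open>6 \<delta> = 3 pi - \<alpha> (4 pi + 2 \<omega>)\<close>, so
    positivity of this margin is the bound on \<open>\<alpha>\<close> itself.\<close>
  define \<delta> where "\<delta> = pi / 2 - \<alpha> / 3 * \<omega> - \<theta>"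
  have clC: "clinear C" unfolding C_def by (rule clinear_fpow[OF accK clK]) (use \<alpha>0 \<alpha>2 in auto)
  have injC: "\<And>x. C x = 0 \<Longrightarrow> x = 0" unfolding C_def by (rule fpow_eq_0[OF accK injK]) (use \<alpha>0 \<alpha>2 in auto)
  have injP2: "\<And>x. P2 x = 0 \<Longrightarrow> x = 0" unfolding P2_def by (rule fpow_eq_0[OF accK injK]) (use \<alpha>0 \<alpha>2 in auto)
  have injP3: "\<And>x. P3 x = 0 \<Longrightarrow> x = 0" unfolding P3_def by (rule fpow_eq_0[OF accK injK]) (use \<alpha>0 \<alpha>2 in auto)
  have appC: "app (inv_graph C) (C w) = w" for w by (rule app_inv_graph[OF injC])
  have appP2: "app (inv_graph P2) (P2 w) = w" for w by (rule app_inv_graph[OF injP2])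
  have appP3: "app (inv_graph P3) (P3 w) = w" for w by (rule app_inv_graph[OF injP3])
  have CC: "C (C x) = P2 x" for x
    unfolding C_def P2_def using fpow_add[OF accK injK, of "\<alpha> / 3" "\<alpha> / 3" x] \<alpha>0 \<alpha>2 by simp
  have CP2: "C (P2 x) = P3 x" for x
    unfolding C_def P2_def P3_def using fpow_add[OF accK injK, of "\<alpha> / 3" "2 * \<alpha> / 3" x] \<alpha>0 \<alpha>2 by (simp add: add_divide_distrib[symmetric])
  have fp: "frac_pow A (\<alpha> / 3) = inv_graph C" "frac_pow A (2 * \<alpha> / 3) = inv_graph P2" "frac_pow A \<alpha> = inv_graph P3"
    unfolding A C_def P2_def P3_def by (rule frac_pow_pos[OF hK]; use \<alpha>0 \<alpha>2 in simp)+
  have fn: "frac_pow A (- (\<alpha> / 3)) = (inv_graph C)\<inverse>" "frac_pow A (- (2 * \<alpha> / 3)) = (inv_graph P2)\<inverse>"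
    unfolding A C_def P2_def by (rule frac_pow_neg[OF hK]; use \<alpha>0 \<alpha>2 in simp)+

  have \<theta>0: "0 < \<theta>" using \<alpha>0 by (simp add: \<theta>_def)
  have "\<alpha> * pi < 3 / 4 * pi" using \<alpha>2 by (intro mult_strict_right_mono) auto
  then have \<theta>1: "\<theta> < pi" using pi_gt_zero unfolding \<theta>_def by (simp add: mult.commute)
  have \<delta>: "0 < \<delta>" "\<delta> < pi / 2"
  proof -
    show "0 < \<delta>" using \<alpha>1 by (simp add: \<delta>_def \<theta>_def field_simps)
    have "0 \<le> \<alpha> / 3 * \<omega>" using \<alpha>0 \<omega> by simp
    then show "\<delta> < pi / 2" using \<theta>0 unfolding \<delta>_def by linarith
  qed
  have sec: "0 \<le> inner (cis \<tau> *\<^sub>C C v) v" if "\<bar>\<tau>\<bar> \<le> \<theta> + \<delta>" for \<tau> v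
    unfolding C_def by (rule fpow_numerical_sector[OF hK]) (use that \<alpha>0 \<alpha>2 in \<open>auto simp: \<delta>_def\<close>)
  note hC = clC injC \<theta>0 \<delta> sec

  \<comment> \<open>The characteristic roots\<close>
  have exp_cis: "exp (\<i> * complex_of_real r) = cis r" for r by (simp add: cis_conv_exp)
  have cis_pi: "cis (pi + r) = - cis r" for r by (simp add: complex_eq_iff)
  have "a = cis (pi + - \<theta>)" unfolding assms(10) exp_cis by (rule arg_cong[of _ _ cis]) (simp add: \<theta>_def field_simps)
  then have a: "a = - cis (- \<theta>)" unfolding cis_pi .
  have "b = cis (pi + \<theta>)" unfolding assms(11) exp_cis by (rule arg_cong[of _ _ cis]) (simp add: \<theta>_def field_simps)
  then have b: "b = - cis \<theta>" unfolding cis_pi .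
  have sin\<theta>: "sin \<theta> > 0" using \<theta>0 \<theta>1 by (rule sin_gt_zero)
  \<comment> \<open>The three imaginary parts are \<open>sin \<theta>\<close>,
    \<open>- sin \<theta>\<close> and \<open>- 2 sin \<theta>\<close>; so the three roots are
    distinct.\<close>
  have "Im (1 + a) \<noteq> 0" "Im (1 + b) \<noteq> 0" "Im (b - a) \<noteq> 0" using sin\<theta> by (auto simp: a b)
  then have nz: "1 + a \<noteq> 0" "1 + b \<noteq> 0" "b - a \<noteq> 0" by (metis zero_complex.simps(2))+
  have Ups: "r *\<^sub>R x = (1 - (a + b)) *\<^sub>C x" if "r = Upsilon0 \<alpha>" for r and x :: 'h
  proof -
    have "complex_of_real r = 1 - (a + b)" by (simp add: that Upsilon0_def a b \<theta>_def complex_eq_iff)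
    then show ?thesis by (simp add: scaleR_scaleC)
  qed

  \<comment> \<open>The three semigroups and the initial data\<close>
  define S where "S \<tau> t = sgrp (rot C \<tau>) t" for \<tau> t
  have Eeq: "E a t x = S \<theta> t x" "E b t x = S (- \<theta>) t x" "E (-1) t x = S 0 t x" if "t > 0" for t x
    using exp_op_rot[OF hC, of \<theta> t x] exp_op_rot[OF hC, of "- \<theta>" t x] exp_op_rot[OF hC, of 0 t x] that \<theta>0
    by (simp_all add: E fp a b S_def)
  have Slin: "S \<tau> t (x + y) = S \<tau> t x + S \<tau> t y" "S \<tau> t (c *\<^sub>C x) = c *\<^sub>C S \<tau> t x" "C (S \<tau> t x) = S \<tau> t (C x)"
    if "\<tau> \<in> {\<theta>, - \<theta>, 0}" "t > 0" for \<tau> t x y c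
    unfolding S_def by (rule sgrp_rot_linear[OF hC]; use that \<theta>0 in auto)+

  \<comment> \<open>The exponent \<open>2 / 3\<close> is split as \<open>2 \<alpha> / 3\<close> plus
    a positive remainder, which makes two factors \<open>C\<close> available; likewise one factor
    for \<open>\<psi>\<close> below.\<close>
  obtain z\<phi> where z\<phi>: "\<phi> = C (C z\<phi>)"
  proof -
    have "\<phi> \<in> range (blinfun_apply (fpow (2 / 3) K))"
      using assms(7) frac_pow_pos[OF hK, of "2/3"] by (simp add: frac_space_def A Domain_inv_graph)
    then obtain w where "\<phi> = fpow (2 / 3) K w" by blast
    also have "\<dots> = P2 (fpow (2 / 3 - 2 * \<alpha> / 3) K w)"
      unfolding P2_def using fpow_add[OF accK injK, of "2 * \<alpha> / 3" "2 / 3 - 2 * \<alpha> / 3" w] \<alpha>0 \<alpha>2 by simp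
    finally show thesis using that CC by metis
  qed
  obtain z\<psi> where z\<psi>: "\<psi> = C z\<psi>"
  proof -
    have "\<psi> \<in> range (blinfun_apply (fpow ((2 - \<alpha>) / 3) K))"
      using assms(8) frac_pow_pos[OF hK, of "(2 - \<alpha>) / 3"] \<alpha>0 \<alpha>2 by (simp add: frac_space_def A Domain_inv_graph)
    then obtain w where "\<psi> = fpow ((2 - \<alpha>) / 3) K w" by blast
    also have "(2 - \<alpha>) / 3 = \<alpha> / 3 + (2 - 2 * \<alpha>) / 3" by (simp add: field_simps)
    also have "fpow (\<alpha> / 3 + (2 - 2 * \<alpha>) / 3) K w = C (fpow ((2 - 2 * \<alpha>) / 3) K w)"
      unfolding C_def by (rule fpow_add[OF accK injK, symmetric]) (use \<alpha>0 \<alpha>2 in \<open>auto simp: field_simps\<close>)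
    finally show thesis using that by metis
  qed

  \<comment> \<open>Coefficients of the three orbits\<close>
  define jb ja jm where "jb = 1 / (b - a)" and "ja = (1 + b) / ((1 + a) * (b - a))" and "jm = 1 / (1 + a)"
  define r1 r2 r3 r4 r5 where "r1 = a / (b - a)" and "r2 = a * b / (1 + b)" and "r3 = 1 / (b - a)"
    and "r4 = (a + b) / (1 + b)" and "r5 = 1 / (1 + b)"
  \<comment> \<open>\<open>za\<close>, \<open>zb\<close>, \<open>zm\<close> collect what the closed
    formula applies to the semigroups of \<open>a\<close>, \<open>b\<close>, \<open>-1\<close>, with
    two factors \<open>C\<close> taken out of \<open>\<phi>\<close>, \<open>C \<psi>\<close> and
    \<open>C^2 \<xi>\<close>.\<close>
  define za where "za = (1 + r1 - r2 * ja) *\<^sub>C z\<phi> + (r4 * ja - r3) *\<^sub>C z\<psi> + (- (r5 * ja)) *\<^sub>C \<xi>"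
  define zb where "zb = (r2 * jb - r1) *\<^sub>C z\<phi> + (r3 - r4 * jb) *\<^sub>C z\<psi> + (r5 * jb) *\<^sub>C \<xi>"
  define zm where "zm = (r2 * jm) *\<^sub>C z\<phi> + (- (r4 * jm)) *\<^sub>C z\<psi> + (r5 * jm) *\<^sub>C \<xi>"
  define z where "z \<tau> = (if \<tau> = \<theta> then za else if \<tau> = - \<theta> then zb else zm)" for \<tau>
  have zval: "z \<theta> = za" "z (- \<theta>) = zb" "z 0 = zm" using \<theta>0 by (auto simp: z_def)
  have sum3: "(\<Sum>\<tau>\<in>{\<theta>, - \<theta>, 0}. f \<tau>) = f \<theta> + (f (- \<theta>) + f 0)" for f :: "real \<Rightarrow> 'h" using \<theta>0 by simp
  have cval: "- cis (- \<theta>) = a" "- cis (- (- \<theta>)) = b" "- cis (- 0) = -1" by (simp_all add: a b)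
  note ci = coefficient_identities[OF nz, folded ja_def jb_def jm_def]
  have r1f: "r1 * (b - a) = a" "r3 * (b - a) = 1" "r5 * (1 + b) = 1" "r2 * (1 + b) = a * b" "r4 * (1 + b) = a + b"
    using nz by (simp_all add: r1_def r2_def r3_def r4_def r5_def)

  \<comment> \<open>A Vandermonde system with nodes \<open>a\<close>, \<open>b\<close>,
    \<open>-1\<close>: its right-hand sides are the initial values of the solution, its first and
    its second derivative, up to the factors \<open>C^2\<close>, \<open>C\<close> and 1.\<close>
  have sums: "za + (zb + zm) = z\<phi>" "a *\<^sub>C za + (b *\<^sub>C zb + (-1) *\<^sub>C zm) = z\<psi>"
    "a\<^sup>2 *\<^sub>C za + (b\<^sup>2 *\<^sub>C zb + (-1)\<^sup>2 *\<^sub>C zm) = \<xi>"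
  proof -
    have 1: "1 * (1 + r1 - r2 * ja) + 1 * (r2 * jb - r1) + 1 * (r2 * jm) = 1 + r2 * (jb - ja + jm)"
      "1 * (r4 * ja - r3) + 1 * (r3 - r4 * jb) + 1 * (- (r4 * jm)) = - (r4 * (jb - ja + jm))"
      "1 * (- (r5 * ja)) + 1 * (r5 * jb) + 1 * (r5 * jm) = r5 * (jb - ja + jm)"
      by (simp_all add: algebra_simps)
    have "1 *\<^sub>C za + (1 *\<^sub>C zb + 1 *\<^sub>C zm) = z\<phi>"
      unfolding za_def zb_def zm_def scaleC_collect 1 ci by (simp add: scaleC_one scaleC_zero_left)
    then show "za + (zb + zm) = z\<phi>" by (simp add: scaleC_one)
    have 2: "a * (1 + r1 - r2 * ja) + b * (r2 * jb - r1) + (-1) * (r2 * jm) = (a - r1 * (b - a)) + r2 * (b * jb - a * ja - jm)"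
      "a * (r4 * ja - r3) + b * (r3 - r4 * jb) + (-1) * (- (r4 * jm)) = r3 * (b - a) - r4 * (b * jb - a * ja - jm)"
      "a * (- (r5 * ja)) + b * (r5 * jb) + (-1) * (r5 * jm) = r5 * (b * jb - a * ja - jm)"
      by (simp_all add: algebra_simps)
    show "a *\<^sub>C za + (b *\<^sub>C zb + (-1) *\<^sub>C zm) = z\<psi>"
      unfolding za_def zb_def zm_def scaleC_collect 2 ci r1f by (simp add: scaleC_one scaleC_zero_left)
    have 3: "a\<^sup>2 * (1 + r1 - r2 * ja) + b\<^sup>2 * (r2 * jb - r1) + (-1)\<^sup>2 * (r2 * jm) = (a\<^sup>2 - (r1 * (b - a)) * (b + a)) + r2 * (b\<^sup>2 * jb - a\<^sup>2 * ja + jm)"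
      "a\<^sup>2 * (r4 * ja - r3) + b\<^sup>2 * (r3 - r4 * jb) + (-1)\<^sup>2 * (- (r4 * jm)) = (r3 * (b - a)) * (b + a) - r4 * (b\<^sup>2 * jb - a\<^sup>2 * ja + jm)"
      "a\<^sup>2 * (- (r5 * ja)) + b\<^sup>2 * (r5 * jb) + (-1)\<^sup>2 * (r5 * jm) = r5 * (b\<^sup>2 * jb - a\<^sup>2 * ja + jm)"
      by (simp_all add: algebra_simps power2_eq_square)
    have 4: "a\<^sup>2 - a * (b + a) + a * b = 0" "1 * (b + a) - (a + b) = 0" by (simp_all add: algebra_simps power2_eq_square)
    show "a\<^sup>2 *\<^sub>C za + (b\<^sup>2 *\<^sub>C zb + (-1)\<^sup>2 *\<^sub>C zm) = \<xi>"
      unfolding za_def zb_def zm_def scaleC_collect 3 ci r1f 4 by (simp add: scaleC_one scaleC_zero_left)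
  qed

  obtain D :: "nat \<Rightarrow> nat \<Rightarrow> real \<Rightarrow> 'h" where
    DC: "\<And>k m t. t > 0 \<Longrightarrow> C (D k (Suc m) t) = D k m t"
    and Dd: "\<And>k m t. t > 0 \<Longrightarrow> (D k m has_vector_derivative D (Suc k) (Suc m) t) (at t)"
    and D00: "\<And>t. t > 0 \<Longrightarrow> D 0 0 t = S \<theta> t (C (C za)) + (S (- \<theta>) t (C (C zb)) + S 0 t (C (C zm)))"
    and Dl0: "(D 0 0 \<longlongrightarrow> \<phi>) (at_right 0)" and Dl1: "(D 1 1 \<longlongrightarrow> \<psi>) (at_right 0)" and Dl2: "(D 2 2 \<longlongrightarrow> \<xi>) (at_right 0)"
    and Deq: "\<And>m t. t > 0 \<Longrightarrow> D 3 m t + (1 - (a + b)) *\<^sub>C D 2 m t + (1 - (a + b)) *\<^sub>C D 1 m t + D 0 m t = 0"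
    using orbit_sum[OF hC, of z] unfolding sum3 zval cval sums z\<phi>[symmetric] z\<psi>[symmetric] S_def by blast

  \<comment> \<open>Existence\<close>
  define u where "u = D 0 0"
  have fz: "frac_pow A 0 = inv_graph id_blinfun" by (rule frac_pow_zero)
  have P2D: "P2 (D k (Suc (Suc m)) t) = D k m t" if "t > 0" for k m t
    using that by (simp add: DC flip: CC)
  have P3D: "P3 (D k (Suc (Suc (Suc m))) t) = D k m t" if "t > 0" for k m t
    using that by (simp add: P2D DC flip: CP2)
  have vd: "vderiv j u t = D j j t" if "t > 0" for j t
    by (rule vderiv_eq[where d = "\<lambda>j. D j j" and k = j]) (use that Dd in \<open>auto simp: u_def\<close>)
  have evpos: "\<forall>\<^sub>F t in at_right (0::real). t > 0" by (simp add: eventually_at_filter)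
  have sol: "is_solution A \<alpha> \<phi> \<psi> \<xi> u"
    unfolding is_solution_def
  proof (intro conjI allI impI)
    \<comment> \<open>\<open>D j (j + m)\<close> is \<open>C^-m\<close> applied to the
      \<open>j\<close>-th derivative of \<open>u\<close>; the values 0, 1, 2, 3 of \<open>m\<close>
      serve the four spaces.\<close>
    show "Ck_frac A 3 0 u"
      by (rule Ck_fracI[OF fz, where e = "\<lambda>j. D j j"]) (use Dd in \<open>auto simp: u_def\<close>)
    show "Ck_frac A 2 (\<alpha> / 3) u"
      by (rule Ck_fracI[OF fp(1) injC, where e = "\<lambda>j. D j (Suc j)"]) (use Dd DC in \<open>auto simp: u_def\<close>)
    show "Ck_frac A 1 (2 * \<alpha> / 3) u"
      by (rule Ck_fracI[OF fp(2) injP2, where e = "\<lambda>j. D j (Suc (Suc j))"]) (use Dd P2D in \<open>auto simp: u_def\<close>)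
    show "Ck_frac A 0 \<alpha> u"
      by (rule Ck_fracI[OF fp(3) injP3, where e = "\<lambda>j. D j (Suc (Suc (Suc j)))"]) (use Dd P3D in \<open>auto simp: u_def\<close>)
    show "(u \<longlongrightarrow> \<phi>) (at_right 0)" unfolding u_def by (rule Dl0)
    show "(vderiv 1 u \<longlongrightarrow> \<psi>) (at_right 0)"
      by (rule Lim_transform_eventually[OF Dl1]) (use evpos in \<open>eventually_elim, simp add: vd[of _ 1, simplified]\<close>)
    show "(vderiv 2 u \<longlongrightarrow> \<xi>) (at_right 0)"
      by (rule Lim_transform_eventually[OF Dl2]) (use evpos in \<open>eventually_elim, simp add: vd\<close>)
    fix t :: real assume t: "t > 0"
    have "app (inv_graph C) (D 2 2 t) = D 2 3 t"
      using appC[of "D 2 3 t"] DC[OF t, of 2 2] by (simp add: numeral_3_eq_3 numeral_2_eq_2)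
    moreover have "app (inv_graph P2) (D 1 1 t) = D 1 3 t"
      using appP2[of "D 1 3 t"] P2D[OF t, of 1 1] by (simp add: numeral_3_eq_3)
    moreover have "app (inv_graph P3) (D 0 0 t) = D 0 3 t"
      using appP3[of "D 0 3 t"] P3D[OF t, of 0 0] by (simp add: numeral_3_eq_3)
    moreover have "u t = D 0 0 t" by (simp add: u_def)
    ultimately show "vderiv 3 u t + Upsilon0 \<alpha> *\<^sub>R app (frac_pow A (\<alpha> / 3)) (vderiv 2 u t)
        + Upsilon0 \<alpha> *\<^sub>R app (frac_pow A (2 * \<alpha> / 3)) (vderiv 1 u t) + app (frac_pow A \<alpha>) (u t) = 0"
      using Deq[OF t, of 3] by (simp only: fp vd[OF t] Ups[OF refl])
  qed

  \<comment> \<open>Uniqueness\<close>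
  have unique: "v t = u t" if v: "is_solution A \<alpha> \<phi> \<psi> \<xi> v" and t: "t > 0" for v t
  proof -
    have ck: "Ck_frac A 3 0 v" "Ck_frac A 2 (\<alpha> / 3) v" "Ck_frac A 1 (2 * \<alpha> / 3) v" "Ck_frac A 0 \<alpha> v"
      and eqv: "\<And>t. t > 0 \<Longrightarrow> vderiv 3 v t + Upsilon0 \<alpha> *\<^sub>R app (frac_pow A (\<alpha> / 3)) (vderiv 2 v t)
        + Upsilon0 \<alpha> *\<^sub>R app (frac_pow A (2 * \<alpha> / 3)) (vderiv 1 v t) + app (frac_pow A \<alpha>) (v t) = 0"
      and vl: "(v \<longlongrightarrow> \<phi>) (at_right 0)" "(vderiv 1 v \<longlongrightarrow> \<psi>) (at_right 0)" "(vderiv 2 v \<longlongrightarrow> \<xi>) (at_right 0)"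
      using v unfolding is_solution_def by auto
    obtain d where d0: "\<And>t. t > 0 \<Longrightarrow> d 0 t = v t"
      and dd: "\<And>j t. j < 3 \<Longrightarrow> t > 0 \<Longrightarrow> (d j has_vector_derivative d (Suc j) t) (at t)"
      by (rule Ck_fracE[OF fz _ ck(1)]) auto
    have dv: "vderiv j v t = d j t" if "j \<le> 3" "t > 0" for j t
      by (rule vderiv_eq[OF d0 dd that])
    \<comment> \<open>Each regularity class comes with its own sequence of derivatives; all are
      identified with \<open>vderiv\<close>, so that the memberships in the different ranges concern
      the same functions.\<close>
    have r2: "vderiv 2 v t \<in> range (blinfun_apply C)" if "t > 0" for t
    proof -
      obtain d2 where d2: "\<And>t. t > 0 \<Longrightarrow> d2 0 t = v t" "\<And>j t. j \<le> 2 \<Longrightarrow> t > 0 \<Longrightarrow> d2 j t \<in> range (blinfun_apply C)"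
        "\<And>j t. j < 2 \<Longrightarrow> t > 0 \<Longrightarrow> (d2 j has_vector_derivative d2 (Suc j) t) (at t)"
        by (rule Ck_fracE[OF fp(1) injC ck(2)]) auto
      have "vderiv 2 v t = d2 2 t" by (rule vderiv_eq[OF d2(1,3) order_refl that])
      then show ?thesis using d2(2)[of 2 t] that by simp
    qed
    have r1: "vderiv 1 v t \<in> range (blinfun_apply P2)" if "t > 0" for t
    proof -
      obtain d1 where d1: "\<And>t. t > 0 \<Longrightarrow> d1 0 t = v t" "\<And>j t. j \<le> 1 \<Longrightarrow> t > 0 \<Longrightarrow> d1 j t \<in> range (blinfun_apply P2)"
        "\<And>j t. j < 1 \<Longrightarrow> t > 0 \<Longrightarrow> (d1 j has_vector_derivative d1 (Suc j) t) (at t)"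
        by (rule Ck_fracE[OF fp(2) injP2 ck(3)]) auto
      have "vderiv 1 v t = d1 1 t" by (rule vderiv_eq[OF d1(1,3) order_refl that])
      then show ?thesis using d1(2)[of 1 t] that by simp
    qed
    have r0: "v t \<in> range (blinfun_apply P3)" if "t > 0" for t
    proof -
      obtain d0' :: "nat \<Rightarrow> real \<Rightarrow> 'h" where d0': "\<And>t. t > 0 \<Longrightarrow> d0' 0 t = v t" "\<And>j t. j \<le> 0 \<Longrightarrow> t > 0 \<Longrightarrow> d0' j t \<in> range (blinfun_apply P3)"
        by (rule Ck_fracE[OF fp(3) injP3 ck(4)]) auto
      show ?thesis using d0'(1)[OF that] d0'(2)[of 0 t] that by simp
    qed
    \<comment> \<open>The three memberships make every application of a fractional power a true
      inverse image; applying \<open>C\<close> three times then removes the unbounded operators from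
      the equation.\<close>
    have C3: "C (C (C (d 3 t))) + (1 - (a + b)) *\<^sub>C C (C (d 2 t)) + (1 - (a + b)) *\<^sub>C C (d 1 t) + d 0 t = 0" if t: "t > 0" for t
    proof -
      obtain y2 y1 y0 where y: "vderiv 2 v t = C y2" "vderiv 1 v t = P2 y1" "v t = P3 y0"
        using r2[OF t] r1[OF t] r0[OF t] by blast
      have "d 3 t + (1 - (a + b)) *\<^sub>C y2 + (1 - (a + b)) *\<^sub>C y1 + y0 = 0"
        using eqv[OF t] unfolding fp y appC appP2 appP3 Ups[OF refl]
        using dv[of 3 t] t by simp
      then have "C (C (C (d 3 t + (1 - (a + b)) *\<^sub>C y2 + (1 - (a + b)) *\<^sub>C y1 + y0))) = 0" by simp
      then have "C (C (C (d 3 t))) + (1 - (a + b)) *\<^sub>C C (C (C y2)) + (1 - (a + b)) *\<^sub>C C (C (C y1)) + C (C (C y0)) = 0"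
        by (simp only: blinfun.add_right C_scaleC[OF hC])
      moreover have "d 2 t = C y2" "d 1 t = C (C y1)" "d 0 t = C (C (C y0))"
        using y dv[of 2 t] dv[of 1 t] d0[OF t] t by (simp_all add: CC CP2)
      ultimately show ?thesis by simp
    qed
    define w where "w j t = d j t - D j j t" for j t
    have "w 0 t = 0"
    proof (rule third_order_unique[OF hC a b _ _ _ t])
      show "(w j has_vector_derivative w (Suc j) t) (at t)" if "j < 3" "t > 0" for j t
        unfolding w_def by (intro has_vector_derivative_diff dd Dd that)
      show "C (C (C (w 3 t))) + (1 - (a + b)) *\<^sub>C C (C (w 2 t)) + (1 - (a + b)) *\<^sub>C C (w 1 t) + w 0 t = 0" if t: "t > 0" for t
      proof -
        have "C (C (C (D 3 3 t))) = D 3 0 t" "C (C (D 2 2 t)) = D 2 0 t" "C (D 1 1 t) = D 1 0 t"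
          using DC[OF t] by (simp_all add: numeral_3_eq_3 numeral_2_eq_2)
        then have "C (C (C (w 3 t))) + (1 - (a + b)) *\<^sub>C C (C (w 2 t)) + (1 - (a + b)) *\<^sub>C C (w 1 t) + w 0 t =
          (C (C (C (d 3 t))) + (1 - (a + b)) *\<^sub>C C (C (d 2 t)) + (1 - (a + b)) *\<^sub>C C (d 1 t) + d 0 t)
          - (D 3 0 t + (1 - (a + b)) *\<^sub>C D 2 0 t + (1 - (a + b)) *\<^sub>C D 1 0 t + D 0 0 t)"
          unfolding w_def by (simp add: blinfun.diff_right scaleC_diff_right)
        then show ?thesis using C3[OF t] Deq[OF t, of 0] by simp
      qed
      show "(w j \<longlongrightarrow> 0) (at_right 0)" if "j < 3" for j
      proof -
        have l0: "(d 0 \<longlongrightarrow> \<phi>) (at_right 0)"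
          by (rule Lim_transform_eventually[OF vl(1)]) (use evpos in \<open>eventually_elim, simp add: d0\<close>)
        have l1: "(d 1 \<longlongrightarrow> \<psi>) (at_right 0)"
          by (rule Lim_transform_eventually[OF vl(2)]) (use evpos in \<open>eventually_elim, simp add: dv[of 1, simplified]\<close>)
        have l2: "(d 2 \<longlongrightarrow> \<xi>) (at_right 0)"
          by (rule Lim_transform_eventually[OF vl(3)]) (use evpos in \<open>eventually_elim, simp add: dv\<close>)
        have "(w 0 \<longlongrightarrow> \<phi> - \<phi>) (at_right 0)" "(w 1 \<longlongrightarrow> \<psi> - \<psi>) (at_right 0)" "(w 2 \<longlongrightarrow> \<xi> - \<xi>) (at_right 0)"
          unfolding w_def by (intro tendsto_diff l0 l1 l2 Dl0 Dl1 Dl2)+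
        moreover have "j = 0 \<or> j = 1 \<or> j = 2" using that by linarith
        ultimately show ?thesis by auto
      qed
    qed
    then show ?thesis using d0[OF t] by (simp add: w_def u_def)
  qed

  \<comment> \<open>The closed formula\<close>
  have formula: "u t = E a t \<phi> - (a / (b - a)) *\<^sub>C (E b t \<phi> - E a t \<phi>) + (a * b / (1 + b)) *\<^sub>C J t \<phi>
               + (1 / (b - a)) *\<^sub>C app (frac_pow A (- (\<alpha> / 3))) (E b t \<psi> - E a t \<psi>)
               - ((a + b) / (1 + b)) *\<^sub>C app (frac_pow A (- (\<alpha> / 3))) (J t \<psi>)
               + (1 / (1 + b)) *\<^sub>C app (frac_pow A (- (2 * \<alpha> / 3))) (J t \<xi>)" if t: "t > 0" for t
  proof -
    have Jt: "J t x = jb *\<^sub>C S (- \<theta>) t x - ja *\<^sub>C S \<theta> t x + jm *\<^sub>C S 0 t x" for x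
      by (simp add: J Eeq[OF t] jb_def ja_def jm_def)
    have Sa: "S \<theta> t (x + y) = S \<theta> t x + S \<theta> t y" "S \<theta> t (c *\<^sub>C x) = c *\<^sub>C S \<theta> t x" "C (S \<theta> t x) = S \<theta> t (C x)" for x y c
      using Slin[of \<theta> t] t by auto
    have Sb: "S (- \<theta>) t (x + y) = S (- \<theta>) t x + S (- \<theta>) t y" "S (- \<theta>) t (c *\<^sub>C x) = c *\<^sub>C S (- \<theta>) t x" "C (S (- \<theta>) t x) = S (- \<theta>) t (C x)" for x y c
      using Slin[of "- \<theta>" t] t by auto
    have Sm: "S 0 t (x + y) = S 0 t x + S 0 t y" "S 0 t (c *\<^sub>C x) = c *\<^sub>C S 0 t x" "C (S 0 t x) = S 0 t (C x)" for x y c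
      using Slin[of 0 t] t by auto
    have CJ: "C (J t x) = jb *\<^sub>C S (- \<theta>) t (C x) - ja *\<^sub>C S \<theta> t (C x) + jm *\<^sub>C S 0 t (C x)" for x
      by (simp add: Jt blinfun.add_right blinfun.diff_right C_scaleC[OF hC] Sa Sb Sm)
    have P2J: "P2 (J t x) = jb *\<^sub>C S (- \<theta>) t (P2 x) - ja *\<^sub>C S \<theta> t (P2 x) + jm *\<^sub>C S 0 t (P2 x)" for x
      unfolding CC[symmetric] by (simp add: Jt blinfun.add_right blinfun.diff_right C_scaleC[OF hC] Sa Sb Sm)
    have CCz: "C (C (c1 *\<^sub>C z\<phi> + c2 *\<^sub>C z\<psi> + c3 *\<^sub>C \<xi>)) = c1 *\<^sub>C \<phi> + c2 *\<^sub>C C \<psi> + c3 *\<^sub>C P2 \<xi>" for c1 c2 c3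
      by (simp only: blinfun.add_right C_scaleC[OF hC] z\<phi> z\<psi> CC)
    have "u t = ((1 + r1 - r2 * ja) *\<^sub>C S \<theta> t \<phi> + (r4 * ja - r3) *\<^sub>C S \<theta> t (C \<psi>) + (- (r5 * ja)) *\<^sub>C S \<theta> t (P2 \<xi>))
      + (((r2 * jb - r1) *\<^sub>C S (- \<theta>) t \<phi> + (r3 - r4 * jb) *\<^sub>C S (- \<theta>) t (C \<psi>) + (r5 * jb) *\<^sub>C S (- \<theta>) t (P2 \<xi>))
      + ((r2 * jm) *\<^sub>C S 0 t \<phi> + (- (r4 * jm)) *\<^sub>C S 0 t (C \<psi>) + (r5 * jm) *\<^sub>C S 0 t (P2 \<xi>)))"
      unfolding u_def D00[OF t] za_def zb_def zm_def CCz Sa(1,2) Sb(1,2) Sm(1,2) ..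
    also note scaleC_formula
    finally show ?thesis
      unfolding fn app_inv_graph_converse CJ P2J blinfun.diff_right Eeq[OF t] Sa(3) Sb(3)
      unfolding Jt r1_def r2_def r3_def r4_def r5_def .
  qed
  show ?thesis using sol unique formula by blast
qed

end
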